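(* Let $(M^3,\varphi,\xi,\eta,g)$ be a non-Kenmotsu almost Kenmotsu $3$-$h$-manifold such that the Reeb vector field $\xi$ is an eigenvector of the Ricci operator $Q$. If $g$ is a Cotton soliton with potential vector field $V$ orthogonal to the Reeb vector field $\xi$, then $M^3$ is locally isometric to $\mathbb{H}^2(-4)\times\mathbb{R}$ and the Cotton soliton is steady.
   Context: $\mathbb{H}^2(-4)$ is the hyperbolic plane of constant curvature $-4$, and $\mathbb{H}^2(-4)\times\mathbb{R}$ is the Riemannian product. An almost contact metric manifold is an odd-dimensional differentiable manifold with a $(1,1)$-tensor field $\varphi$, a unit vector field $\xi$ (the Reeb vector field), a $1$-form $\eta$ and a Riemannian metric $g$ with $\eta(X)=g(X,\xi)$, $\varphi^2X=-X+\eta(X)\xi$, $\eta(\xi)=1$, $g(\varphi X,\varphi Y)=g(X,Y)-\eta(X)\eta(Y)$. Let $\Phi(X,Y)=g(X,\varphi Y)$. It is almost Kenmotsu if $d\eta=0$ and $d\Phi=2\eta\wedge\Phi$; it is Kenmotsu if moreover it is normal, i.e. $[\varphi,\varphi]+2d\eta\otimes\xi=0$, where $[\varphi,\varphi]$ is the Nijenhuis tensor of $\varphi$. Non-Kenmotsu means not Kenmotsu. Put $h=\frac12\mathcal{L}_\xi\varphi$; in dimension $3$ an almost Kenmotsu manifold is Kenmotsu if and only if $h=0$. An almost Kenmotsu $3$-$h$-manifold is a $3$-dimensional almost Kenmotsu manifold with $\nabla_\xi h=0$, where $\nabla$ is the Levi-Civita connection. $S$ is the Ricci tensor, $r$ the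 scalar curvature, and $Q$ the Ricci operator, $S(X,Y)=g(QX,Y)$. The $(0,3)$-Cotton tensor is $$C(X,Y,Z)=(\nabla_XS)(Y,Z)-(\nabla_YS)(X,Z)-\tfrac14[X(r)g(Y,Z)-Y(r)g(X,Z)].$$ The $(0,2)$-Cotton tensor is given in a local orthonormal frame $\{e_1=\xi,e_2=e,e_3=\varphi e\}$ ($e$ a unit vector field orthogonal to $\xi$) by $C(e_i,e_j)=C_{ij}=\frac12\sum_{n,m}C_{nmi}\epsilon^{nmj}$, where $C_{nmi}=C(e_n,e_m,e_i)$ and $\epsilon$ is totally antisymmetric with $\epsilon^{123}=1$. A Cotton soliton on $M^3$ is a metric $g$ such that $(\mathcal{L}_Vg)(X,Y)+C(X,Y)-\sigma g(X,Y)=0$ for all vector fields $X,Y$, for some constant $\sigma$ and some vector field $V$, called the potential vector field; here $\mathcal{L}_V$ is the Lie derivative along $V$ and $C$ is the $(0,2)$-Cotton tensor of $g$. The soliton is steady if $\sigma=0$. $V$ is orthogonal to $\xi$ if $g(V,\xi)=0$.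
   Formalization: The manifold is assumed connected; otherwise the disjoint union of a Kenmotsu hyperbolic space H³(−1) and a non-Kenmotsu H²(−4)×R, with V = 0, satisfies all hypotheses but is not locally isometric to H²(−4)×R everywhere. *)

theory Defs
  imports "HOL-Analysis.Analysis"
begin

section \<open>Smooth maps between Euclidean spaces\<close>

primrec ck_on :: "nat \<Rightarrow> 'e::euclidean_space set \<Rightarrow> ('e \<Rightarrow> 'f::euclidean_space) \<Rightarrow> bool" where
  "ck_on 0 W f \<longleftrightarrow> continuous_on W f"
| "ck_on (Suc k) W f \<longleftrightarrow> (\<forall>x\<in>W. f differentiable (at x)) \<and>
     (\<forall>v. ck_on k W (\<lambda>x. frechet_derivative f (at x) v))"

text \<open>Only used for open \<open>W\<close>.\<close>

definition smooth_on :: "'e::euclidean_space set \<Rightarrow> ('e \<Rightarrow> 'f::euclidean_space) \<Rightarrow> bool" where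
  "smooth_on W f \<longleftrightarrow> (\<forall>k. ck_on k W f)"


section \<open>Smooth manifolds\<close>

text \<open>A chart is a pair of an open domain and a coordinate map (whose values outside the domain
  are irrelevant). A manifold is a topology together with an atlas, not necessarily maximal.\<close>

type_synonym ('a, 'e) chart = "'a set \<times> ('a \<Rightarrow> 'e)"

definition chart_inv :: "('a, 'e) chart \<Rightarrow> 'e \<Rightarrow> 'a" where
  "chart_inv c = inv_into (fst c) (snd c)"

definition chart_range :: "('a, 'e) chart \<Rightarrow> 'e set" where
  "chart_range c = snd c ` fst c"

definition overlap :: "('a, 'e) chart \<Rightarrow> ('a, 'e) chart \<Rightarrow> 'e set" where
  "overlap c d = snd c ` (fst c \<inter> fst d)"

definition transition :: "('a, 'e) chart \<Rightarrow> ('a, 'e) chart \<Rightarrow> 'e \<Rightarrow> 'e" where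
  "transition c d = snd d \<circ> chart_inv c"

definition smooth_atlas :: "'a topology \<Rightarrow> ('a, 'e::euclidean_space) chart set \<Rightarrow> bool" where
  "smooth_atlas M A \<longleftrightarrow>
     (\<forall>c\<in>A. openin M (fst c) \<and> open (chart_range c) \<and>
        homeomorphic_map (subtopology M (fst c)) (top_of_set (chart_range c)) (snd c)) \<and>
     (\<Union>c\<in>A. fst c) = topspace M \<and>
     (\<forall>c\<in>A. \<forall>d\<in>A. smooth_on (overlap c d) (transition c d))"

definition smooth_manifold :: "'a topology \<Rightarrow> ('a, 'e::euclidean_space) chart set \<Rightarrow> bool" where
  "smooth_manifold M A \<longleftrightarrow> Hausdorff_space M \<and> second_countable M \<and> smooth_atlas M A"


section \<open>Tensor fields\<close>

text \<open>A tensor field is given by its local representatives in the charts, which are smooth and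
  are related by the usual transformation law: for a chart \<open>c\<close> and \<open>x\<close> in its range, a vector
  field has the value \<open>X c x\<close>, a 1-form is a linear form \<open>w c x\<close>, a (1,1)-tensor an endomorphism
  \<open>F c x\<close>, and a (0,2)-tensor a bilinear form \<open>T c x\<close> of the model space.\<close>

type_synonym 'e vec_field = "'e \<Rightarrow> 'e"
type_synonym 'e one_form = "'e \<Rightarrow> 'e \<Rightarrow> real"
type_synonym 'e endo_field = "'e \<Rightarrow> 'e \<Rightarrow> 'e"
type_synonym 'e form2 = "'e \<Rightarrow> 'e \<Rightarrow> 'e \<Rightarrow> real"

abbreviation D :: "('e::euclidean_space \<Rightarrow> 'f::euclidean_space) \<Rightarrow> 'e \<Rightarrow> 'e \<Rightarrow> 'f" where
  "D f x v \<equiv> frechet_derivative f (at x) v"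

definition vector_field_on ::
  "('a, 'e::euclidean_space) chart set \<Rightarrow> (('a, 'e) chart \<Rightarrow> 'e vec_field) \<Rightarrow> bool" where
  "vector_field_on A X \<longleftrightarrow>
     (\<forall>c\<in>A. smooth_on (chart_range c) (X c)) \<and>
     (\<forall>c\<in>A. \<forall>d\<in>A. \<forall>x\<in>overlap c d.
        X d (transition c d x) = D (transition c d) x (X c x))"

definition one_form_on ::
  "('a, 'e::euclidean_space) chart set \<Rightarrow> (('a, 'e) chart \<Rightarrow> 'e one_form) \<Rightarrow> bool" where
  "one_form_on A w \<longleftrightarrow>
     (\<forall>c\<in>A. (\<forall>x\<in>chart_range c. linear (w c x)) \<and>
        (\<forall>v. smooth_on (chart_range c) (\<lambda>x. w c x v))) \<and>
     (\<forall>c\<in>A. \<forall>d\<in>A. \<forall>x\<in>overlap c d. \<forall>v.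
        w d (transition c d x) (D (transition c d) x v) = w c x v)"

definition endo_field_on ::
  "('a, 'e::euclidean_space) chart set \<Rightarrow> (('a, 'e) chart \<Rightarrow> 'e endo_field) \<Rightarrow> bool" where
  "endo_field_on A F \<longleftrightarrow>
     (\<forall>c\<in>A. (\<forall>x\<in>chart_range c. linear (F c x)) \<and>
        (\<forall>v. smooth_on (chart_range c) (\<lambda>x. F c x v))) \<and>
     (\<forall>c\<in>A. \<forall>d\<in>A. \<forall>x\<in>overlap c d. \<forall>v.
        F d (transition c d x) (D (transition c d) x v) = D (transition c d) x (F c x v))"

definition form2_on ::
  "('a, 'e::euclidean_space) chart set \<Rightarrow> (('a, 'e) chart \<Rightarrow> 'e form2) \<Rightarrow> bool" where
  "form2_on A T \<longleftrightarrow>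
     (\<forall>c\<in>A. (\<forall>x\<in>chart_range c. bilinear (T c x)) \<and>
        (\<forall>v w. smooth_on (chart_range c) (\<lambda>x. T c x v w))) \<and>
     (\<forall>c\<in>A. \<forall>d\<in>A. \<forall>x\<in>overlap c d. \<forall>v w.
        T d (transition c d x) (D (transition c d) x v) (D (transition c d) x w) = T c x v w)"

definition riemannian_metric_on ::
  "('a, 'e::euclidean_space) chart set \<Rightarrow> (('a, 'e) chart \<Rightarrow> 'e form2) \<Rightarrow> bool" where
  "riemannian_metric_on A g \<longleftrightarrow> form2_on A g \<and>
     (\<forall>c\<in>A. \<forall>x\<in>chart_range c.
        (\<forall>v w. g c x v w = g c x w v) \<and> (\<forall>v. v \<noteq> 0 \<longrightarrow> g c x v v > 0))"


section \<open>Tensor calculus in a chart\<close>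

text \<open>The operators below act on vector fields of an open subset of the model space.
  Expressions that are tensorial in a vector field are evaluated on a tangent vector \<open>v\<close> by
  extending \<open>v\<close> to the field \<open>K v\<close> with constant components (a combination of coordinate fields).\<close>

abbreviation K :: "'e \<Rightarrow> 'e vec_field" where
  "K v \<equiv> (\<lambda>_. v)"

definition lie_bracket :: "'e::euclidean_space vec_field \<Rightarrow> 'e vec_field \<Rightarrow> 'e vec_field" where
  "lie_bracket X Y x = D Y x (X x) - D X x (Y x)"

definition lie_endo ::
  "'e::euclidean_space vec_field \<Rightarrow> 'e endo_field \<Rightarrow> 'e vec_field \<Rightarrow> 'e vec_field" where
  "lie_endo V F X x = lie_bracket V (\<lambda>y. F y (X y)) x - F x (lie_bracket V X x)"

definition lie_form2 ::
  "'e::euclidean_space vec_field \<Rightarrow> 'e form2 \<Rightarrow> 'e vec_field \<Rightarrow> 'e vec_field \<Rightarrow> 'e \<Rightarrow> real" where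
  "lie_form2 V T X Y x =
     D (\<lambda>y. T y (X y) (Y y)) x (V x)
     - T x (lie_bracket V X x) (Y x) - T x (X x) (lie_bracket V Y x)"

definition nijenhuis ::
  "'e::euclidean_space endo_field \<Rightarrow> 'e vec_field \<Rightarrow> 'e vec_field \<Rightarrow> 'e vec_field" where
  "nijenhuis F X Y x =
     F x (F x (lie_bracket X Y x))
     + lie_bracket (\<lambda>y. F y (X y)) (\<lambda>y. F y (Y y)) x
     - F x (lie_bracket (\<lambda>y. F y (X y)) Y x)
     - F x (lie_bracket X (\<lambda>y. F y (Y y)) x)"

text \<open>Normalisations customary in contact geometry: the exterior derivative of a \<open>p\<close>-form
  carries a factor \<open>1/(p+1)\<close>, and the wedge product of a 1-form and a 2-form is \<open>1/3\<close> of the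
  cyclic sum. (The equation \<open>d\<Phi> = 2 \<eta> \<and> \<Phi>\<close> is the same with both factors dropped.)\<close>

definition ext_d1 ::
  "'e::euclidean_space one_form \<Rightarrow> 'e vec_field \<Rightarrow> 'e vec_field \<Rightarrow> 'e \<Rightarrow> real" where
  "ext_d1 w X Y x = (1/2) *
     (D (\<lambda>y. w y (Y y)) x (X x) - D (\<lambda>y. w y (X y)) x (Y x) - w x (lie_bracket X Y x))"

definition ext_d2 ::
  "'e::euclidean_space form2 \<Rightarrow> 'e vec_field \<Rightarrow> 'e vec_field \<Rightarrow> 'e vec_field \<Rightarrow> 'e \<Rightarrow> real" where
  "ext_d2 P X Y Z x = (1/3) *
     (D (\<lambda>y. P y (Y y) (Z y)) x (X x)
      + D (\<lambda>y. P y (Z y) (X y)) x (Y x)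
      + D (\<lambda>y. P y (X y) (Y y)) x (Z x)
      - P x (lie_bracket X Y x) (Z x)
      - P x (lie_bracket Y Z x) (X x)
      - P x (lie_bracket Z X x) (Y x))"

definition wedge12 ::
  "'e::euclidean_space one_form \<Rightarrow> 'e form2 \<Rightarrow> 'e \<Rightarrow> 'e \<Rightarrow> 'e \<Rightarrow> 'e \<Rightarrow> real" where
  "wedge12 w P x u v z = (1/3) * (w x u * P x v z + w x v * P x z u + w x z * P x u v)"

text \<open>The Levi-Civita connection is \<open>\<nabla>\<^sub>X Y = D Y X + \<Gamma>(X, Y)\<close>, where \<open>\<Gamma>\<close> is the unique bilinear
  map making it torsion-free (\<open>\<Gamma>\<close> is symmetric) and compatible with \<open>g\<close>.\<close>

definition christoffel :: "'e::euclidean_space form2 \<Rightarrow> 'e \<Rightarrow> 'e \<Rightarrow> 'e \<Rightarrow> 'e" where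
  "christoffel g x = (THE G. bilinear G \<and> (\<forall>u v. G u v = G v u) \<and>
     (\<forall>u v w. D (\<lambda>y. g y v w) x u = g x (G u v) w + g x v (G u w)))"

definition nabla ::
  "'e::euclidean_space form2 \<Rightarrow> 'e vec_field \<Rightarrow> 'e vec_field \<Rightarrow> 'e vec_field" where
  "nabla g X Y x = D Y x (X x) + christoffel g x (X x) (Y x)"

definition nabla_endo ::
  "'e::euclidean_space form2 \<Rightarrow> 'e endo_field \<Rightarrow> 'e vec_field \<Rightarrow> 'e vec_field \<Rightarrow> 'e vec_field" where
  "nabla_endo g F X Y x = nabla g X (\<lambda>y. F y (Y y)) x - F x (nabla g X Y x)"

definition nabla_form2 ::
  "'e::euclidean_space form2 \<Rightarrow> 'e form2 \<Rightarrow>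
     'e vec_field \<Rightarrow> 'e vec_field \<Rightarrow> 'e vec_field \<Rightarrow> 'e \<Rightarrow> real" where
  "nabla_form2 g T X Y Z x =
     D (\<lambda>y. T y (Y y) (Z y)) x (X x) - T x (nabla g X Y x) (Z x) - T x (Y x) (nabla g X Z x)"

definition riemann ::
  "'e::euclidean_space form2 \<Rightarrow> 'e vec_field \<Rightarrow> 'e vec_field \<Rightarrow> 'e vec_field \<Rightarrow> 'e vec_field" where
  "riemann g X Y Z x =
     nabla g X (nabla g Y Z) x - nabla g Y (nabla g X Z) x - nabla g (lie_bracket X Y) Z x"

definition trace_endo :: "('e::euclidean_space \<Rightarrow> 'e) \<Rightarrow> real" where
  "trace_endo F = (\<Sum>b\<in>Basis. F b \<bullet> b)"

definition ricci :: "'e::euclidean_space form2 \<Rightarrow> 'e form2" where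
  "ricci g x v w = trace_endo (\<lambda>u. riemann g (K u) (K v) (K w) x)"

definition ricci_op :: "'e::euclidean_space form2 \<Rightarrow> 'e endo_field" where
  "ricci_op g x v = (THE u. \<forall>w. ricci g x v w = g x u w)"

definition scalar_curv :: "'e::euclidean_space form2 \<Rightarrow> 'e \<Rightarrow> real" where
  "scalar_curv g x = trace_endo (ricci_op g x)"

text \<open>The (0,3)-Cotton tensor in dimension 3.\<close>

definition cotton3 ::
  "'e::euclidean_space form2 \<Rightarrow> 'e vec_field \<Rightarrow> 'e vec_field \<Rightarrow> 'e vec_field \<Rightarrow> 'e \<Rightarrow> real" where
  "cotton3 g X Y Z x =
     nabla_form2 g (ricci g) X Y Z x - nabla_form2 g (ricci g) Y X Z x
     - (1/4) * (D (scalar_curv g) x (X x) * g x (Y x) (Z x)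
                - D (scalar_curv g) x (Y x) * g x (X x) (Z x))"


section \<open>Almost contact metric and almost Kenmotsu manifolds\<close>

definition almost_contact_metric ::
  "'a topology \<Rightarrow> ('a, 'e::euclidean_space) chart set \<Rightarrow>
     (('a, 'e) chart \<Rightarrow> 'e endo_field) \<Rightarrow> (('a, 'e) chart \<Rightarrow> 'e vec_field) \<Rightarrow>
     (('a, 'e) chart \<Rightarrow> 'e one_form) \<Rightarrow> (('a, 'e) chart \<Rightarrow> 'e form2) \<Rightarrow> bool" where
  "almost_contact_metric M A \<phi> \<xi> \<eta> g \<longleftrightarrow>
     smooth_manifold M A \<and> odd DIM('e) \<and>
     endo_field_on A \<phi> \<and> vector_field_on A \<xi> \<and> one_form_on A \<eta> \<and> riemannian_metric_on A g \<and>
     (\<forall>c\<in>A. \<forall>x\<in>chart_range c.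
        g c x (\<xi> c x) (\<xi> c x) = 1 \<and>
        (\<forall>v. \<eta> c x v = g c x v (\<xi> c x)) \<and>
        (\<forall>v. \<phi> c x (\<phi> c x v) = - v + \<eta> c x v *\<^sub>R \<xi> c x) \<and>
        \<eta> c x (\<xi> c x) = 1 \<and>
        (\<forall>v w. g c x (\<phi> c x v) (\<phi> c x w) = g c x v w - \<eta> c x v * \<eta> c x w))"

definition fund_form :: "'e::euclidean_space endo_field \<Rightarrow> 'e form2 \<Rightarrow> 'e form2" where
  "fund_form F g x v w = g x v (F x w)"

definition almost_kenmotsu ::
  "'a topology \<Rightarrow> ('a, 'e::euclidean_space) chart set \<Rightarrow>
     (('a, 'e) chart \<Rightarrow> 'e endo_field) \<Rightarrow> (('a, 'e) chart \<Rightarrow> 'e vec_field) \<Rightarrow>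
     (('a, 'e) chart \<Rightarrow> 'e one_form) \<Rightarrow> (('a, 'e) chart \<Rightarrow> 'e form2) \<Rightarrow> bool" where
  "almost_kenmotsu M A \<phi> \<xi> \<eta> g \<longleftrightarrow>
     almost_contact_metric M A \<phi> \<xi> \<eta> g \<and>
     (\<forall>c\<in>A. \<forall>x\<in>chart_range c.
        (\<forall>u v. ext_d1 (\<eta> c) (K u) (K v) x = 0) \<and>
        (\<forall>u v w. ext_d2 (fund_form (\<phi> c) (g c)) (K u) (K v) (K w) x
                  = 2 * wedge12 (\<eta> c) (fund_form (\<phi> c) (g c)) x u v w))"

definition normal_structure ::
  "('a, 'e::euclidean_space) chart set \<Rightarrow> (('a, 'e) chart \<Rightarrow> 'e endo_field) \<Rightarrow>
     (('a, 'e) chart \<Rightarrow> 'e vec_field) \<Rightarrow> (('a, 'e) chart \<Rightarrow> 'e one_form) \<Rightarrow> bool" where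
  "normal_structure A \<phi> \<xi> \<eta> \<longleftrightarrow>
     (\<forall>c\<in>A. \<forall>x\<in>chart_range c. \<forall>u v.
        nijenhuis (\<phi> c) (K u) (K v) x + (2 * ext_d1 (\<eta> c) (K u) (K v) x) *\<^sub>R \<xi> c x = 0)"

definition kenmotsu ::
  "'a topology \<Rightarrow> ('a, 'e::euclidean_space) chart set \<Rightarrow>
     (('a, 'e) chart \<Rightarrow> 'e endo_field) \<Rightarrow> (('a, 'e) chart \<Rightarrow> 'e vec_field) \<Rightarrow>
     (('a, 'e) chart \<Rightarrow> 'e one_form) \<Rightarrow> (('a, 'e) chart \<Rightarrow> 'e form2) \<Rightarrow> bool" where
  "kenmotsu M A \<phi> \<xi> \<eta> g \<longleftrightarrow> almost_kenmotsu M A \<phi> \<xi> \<eta> g \<and> normal_structure A \<phi> \<xi> \<eta>"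

definition h_tensor :: "'e::euclidean_space endo_field \<Rightarrow> 'e vec_field \<Rightarrow> 'e endo_field" where
  "h_tensor F X x v = (1/2) *\<^sub>R lie_endo X F (K v) x"

definition almost_kenmotsu_3h ::
  "'a topology \<Rightarrow> ('a, 'e::euclidean_space) chart set \<Rightarrow>
     (('a, 'e) chart \<Rightarrow> 'e endo_field) \<Rightarrow> (('a, 'e) chart \<Rightarrow> 'e vec_field) \<Rightarrow>
     (('a, 'e) chart \<Rightarrow> 'e one_form) \<Rightarrow> (('a, 'e) chart \<Rightarrow> 'e form2) \<Rightarrow> bool" where
  "almost_kenmotsu_3h M A \<phi> \<xi> \<eta> g \<longleftrightarrow>
     DIM('e) = 3 \<and> almost_kenmotsu M A \<phi> \<xi> \<eta> g \<and>
     (\<forall>c\<in>A. \<forall>x\<in>chart_range c. \<forall>v.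
        nabla_endo (g c) (h_tensor (\<phi> c) (\<xi> c)) (\<xi> c) (K v) x = 0)"

definition reeb_ricci_eigenvector ::
  "('a, 'e::euclidean_space) chart set \<Rightarrow> (('a, 'e) chart \<Rightarrow> 'e vec_field) \<Rightarrow>
     (('a, 'e) chart \<Rightarrow> 'e form2) \<Rightarrow> bool" where
  "reeb_ricci_eigenvector A \<xi> g \<longleftrightarrow>
     (\<forall>c\<in>A. \<forall>x\<in>chart_range c. \<exists>\<rho>. ricci_op (g c) x (\<xi> c x) = \<rho> *\<^sub>R \<xi> c x)"


section \<open>Cotton solitons\<close>

definition levi_civita_symbol :: "3 \<Rightarrow> 3 \<Rightarrow> 3 \<Rightarrow> real" where
  "levi_civita_symbol i j k =
     (if (i, j, k) \<in> {(1, 2, 3), (2, 3, 1), (3, 1, 2)} then 1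
      else if (i, j, k) \<in> {(2, 1, 3), (1, 3, 2), (3, 2, 1)} then -1 else 0)"

definition adapted_frame ::
  "'e::euclidean_space endo_field \<Rightarrow> 'e vec_field \<Rightarrow> 'e \<Rightarrow> 'e \<Rightarrow> 'e ^ 3" where
  "adapted_frame F X x e = vector [X x, e, F x e]"

definition cotton_comp :: "'e::euclidean_space form2 \<Rightarrow> 'e ^ 3 \<Rightarrow> 'e \<Rightarrow> 3 \<Rightarrow> 3 \<Rightarrow> real" where
  "cotton_comp g E x i j = (1/2) * (\<Sum>n\<in>UNIV. \<Sum>m\<in>UNIV.
     cotton3 g (K (E $ n)) (K (E $ m)) (K (E $ i)) x * levi_civita_symbol n m j)"

text \<open>\<open>C\<close> is the (0,2)-Cotton tensor: the bilinear form whose components are the above in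
  every frame \<open>\<xi>, e, \<phi> e\<close> with \<open>e\<close> a unit vector orthogonal to \<open>\<xi>\<close>.\<close>

definition cotton2_tensor ::
  "('a, 'e::euclidean_space) chart set \<Rightarrow> (('a, 'e) chart \<Rightarrow> 'e endo_field) \<Rightarrow>
     (('a, 'e) chart \<Rightarrow> 'e vec_field) \<Rightarrow> (('a, 'e) chart \<Rightarrow> 'e form2) \<Rightarrow>
     (('a, 'e) chart \<Rightarrow> 'e form2) \<Rightarrow> bool" where
  "cotton2_tensor A \<phi> \<xi> g C \<longleftrightarrow>
     (\<forall>c\<in>A. \<forall>x\<in>chart_range c. bilinear (C c x) \<and>
        (\<forall>e. g c x e e = 1 \<and> g c x e (\<xi> c x) = 0 \<longrightarrow>
           (let E = adapted_frame (\<phi> c) (\<xi> c) x e in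
              \<forall>i j. C c x (E $ i) (E $ j) = cotton_comp (g c) E x i j)))"

definition cotton_soliton ::
  "('a, 'e::euclidean_space) chart set \<Rightarrow> (('a, 'e) chart \<Rightarrow> 'e endo_field) \<Rightarrow>
     (('a, 'e) chart \<Rightarrow> 'e vec_field) \<Rightarrow> (('a, 'e) chart \<Rightarrow> 'e form2) \<Rightarrow>
     (('a, 'e) chart \<Rightarrow> 'e vec_field) \<Rightarrow> real \<Rightarrow> bool" where
  "cotton_soliton A \<phi> \<xi> g V \<sigma> \<longleftrightarrow> vector_field_on A V \<and>
     (\<exists>C. cotton2_tensor A \<phi> \<xi> g C \<and>
        (\<forall>c\<in>A. \<forall>x\<in>chart_range c. \<forall>v w.
           lie_form2 (V c) (g c) (K v) (K w) x + C c x v w - \<sigma> * g c x v w = 0))"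

definition steady :: "real \<Rightarrow> bool" where
  "steady \<sigma> \<longleftrightarrow> \<sigma> = 0"

definition orthogonal_fields ::
  "('a, 'e::euclidean_space) chart set \<Rightarrow> (('a, 'e) chart \<Rightarrow> 'e form2) \<Rightarrow>
     (('a, 'e) chart \<Rightarrow> 'e vec_field) \<Rightarrow> (('a, 'e) chart \<Rightarrow> 'e vec_field) \<Rightarrow> bool" where
  "orthogonal_fields A g X Y \<longleftrightarrow> (\<forall>c\<in>A. \<forall>x\<in>chart_range c. g c x (X c x) (Y c x) = 0)"


section \<open>Local isometry\<close>

definition smooth_map_on ::
  "('a, 'e::euclidean_space) chart set \<Rightarrow> ('b, 'f::euclidean_space) chart set \<Rightarrow>
     'a set \<Rightarrow> ('a \<Rightarrow> 'b) \<Rightarrow> bool" where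
  "smooth_map_on A B U f \<longleftrightarrow> (\<forall>c\<in>A. \<forall>d\<in>B.
     smooth_on (snd c ` (fst c \<inter> U \<inter> f -` fst d)) (snd d \<circ> f \<circ> chart_inv c))"

definition isometry_between ::
  "'a topology \<Rightarrow> ('a, 'e::euclidean_space) chart set \<Rightarrow> (('a, 'e) chart \<Rightarrow> 'e form2) \<Rightarrow> 'a set \<Rightarrow>
   'b topology \<Rightarrow> ('b, 'f::euclidean_space) chart set \<Rightarrow> (('b, 'f) chart \<Rightarrow> 'f form2) \<Rightarrow> 'b set \<Rightarrow>
     ('a \<Rightarrow> 'b) \<Rightarrow> bool" where
  "isometry_between M A g U N B k W f \<longleftrightarrow>
     homeomorphic_map (subtopology M U) (subtopology N W) f \<and>
     smooth_map_on A B U f \<and> smooth_map_on B A W (inv_into U f) \<and>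
     (\<forall>c\<in>A. \<forall>d\<in>B. \<forall>x\<in>snd c ` (fst c \<inter> U \<inter> f -` fst d).
        let F = snd d \<circ> f \<circ> chart_inv c
        in \<forall>v w. k d (F x) (D F x v) (D F x w) = g c x v w)"

definition locally_isometric ::
  "'a topology \<Rightarrow> ('a, 'e::euclidean_space) chart set \<Rightarrow> (('a, 'e) chart \<Rightarrow> 'e form2) \<Rightarrow>
   'b topology \<Rightarrow> ('b, 'f::euclidean_space) chart set \<Rightarrow> (('b, 'f) chart \<Rightarrow> 'f form2) \<Rightarrow> bool" where
  "locally_isometric M A g N B k \<longleftrightarrow>
     (\<forall>p\<in>topspace M. \<exists>U W f. p \<in> U \<and> openin M U \<and> openin N W \<and> isometry_between M A g U N B k W f)"

text \<open>Upper half plane model of the hyperbolic plane of curvature \<open>-\<kappa>\<close>, where \<open>\<kappa> > 0\<close>, and its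
  Riemannian product with the line; the product carries a single global chart.\<close>

definition upper_half_plane :: "complex set" where
  "upper_half_plane = {z. Im z > 0}"

definition hyperbolic_metric :: "real \<Rightarrow> complex form2" where
  "hyperbolic_metric \<kappa> z v w = (v \<bullet> w) / (\<kappa> * (Im z)\<^sup>2)"

definition line_metric :: "real form2" where
  "line_metric t v w = v * w"

definition prod_metric :: "'e form2 \<Rightarrow> 'f form2 \<Rightarrow> ('e \<times> 'f) form2" where
  "prod_metric g k x v w = g (fst x) (fst v) (fst w) + k (snd x) (snd v) (snd w)"

definition HxR_space :: "(complex \<times> real) topology" where
  "HxR_space = top_of_set (upper_half_plane \<times> UNIV)"

definition HxR_atlas :: "(complex \<times> real, complex \<times> real) chart set" where
  "HxR_atlas = {(upper_half_plane \<times> UNIV, id)}"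

definition HxR_metric ::
  "real \<Rightarrow> (complex \<times> real, complex \<times> real) chart \<Rightarrow> (complex \<times> real) form2" where
  "HxR_metric \<kappa> = (\<lambda>_. prod_metric (hyperbolic_metric \<kappa>) line_metric)"

end

theory Submission
  imports Defs
begin

text \<open>Where \<open>h\<close> does not vanish, the symmetric operator \<open>\<nabla>\<xi>\<close> has on the contact distribution the
  eigenvalues \<open>q = 1 + \<lambda>\<close> and \<open>2 - q\<close> with unit eigenvectors \<open>e\<close> and \<open>\<phi> e\<close>. The condition
  \<open>\<nabla>\<^sub>\<xi> h = 0\<close> makes this frame parallel along \<open>\<xi>\<close>; the Ricci condition, the Bianchi identity and
  \<open>[\<xi>, e] q\<close>, \<open>[\<xi>, \<phi> e] q\<close> then force \<open>q\<close> to be locally constant and the remaining connection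
  coefficients to vanish. The only nonzero Cotton component is \<open>C(e, \<phi> e) = 2 q (q - 1) (q - 2)\<close>.
  For \<open>V = f\<^sub>2 e + f\<^sub>3 \<phi> e\<close> the \<open>(\<xi>, \<xi>)\<close> component of the soliton equation is \<open>\<sigma> = 0\<close>, and
  differentiating its \<open>(e, \<phi> e)\<close> component along \<open>\<xi>\<close> twice gives \<open>C(e, \<phi> e) = 0\<close>, so \<open>q = 2\<close>.
  Hence the trace of \<open>h\<^sup>2\<close> only takes the values 0 and 2; by connectedness and since \<open>h = 0\<close>
  implies normality, it is 2 everywhere. With \<open>q = 2\<close> the Poincare lemma integrates the dual
  coframe to \<open>dt\<close>, \<open>exp (2 t) dy\<close>, \<open>dz\<close>, which is the metric of the product.\<close>

section \<open>Calculus of smooth maps\<close>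

text \<open>The hypothesis that the structure is not Kenmotsu yields only one point with
  \<open>h \<noteq> 0\<close>, and a smooth eigenframe of \<nabla>\<xi> is available only near such
  points, where its two eigenvalues on the contact distribution differ. All curvature computations
  are therefore local, and a function that makes sense everywhere is needed to spread the result:
  the trace of h^2 is continuous in every chart without reference to a frame and equals 2 (q - 1)^2
  in an eigenframe. Naming the larger eigenvalue q gives q > 1. This permits division by q - 1 and
  leaves q = 2 as the only admissible root of 2 q (q - 1) (q - 2). That this expression vanishes
  comes from incompatible growth rates: along \<xi> the functions e(f_3) and (\<phi> e)(f_2) satisfy
  linear equations with the opposite rates 2 - 2 q and 2 q - 2, while their sum is locally constant.
  For q = 2 the other eigenvalue is 0, so \<phi> e becomes a parallel line direction, while \<xi>
  and e span surfaces with coframe dt, exp (2 t) dy, whose curvature is -2^2; this is the origin of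
  -4.\<close>

lemma D_eqI: "(f has_derivative f') (at x) \<Longrightarrow> D f x v = f' v"
  using frechet_derivative_at by metis

lemma has_derivative_D: "f differentiable (at x) \<Longrightarrow> (f has_derivative D f x) (at x)"
  using frechet_derivative_works by blast

lemma linear_D: "f differentiable (at x) \<Longrightarrow> linear (D f x)"
  by (rule linear_frechet_derivative)

lemma D_cong:
  assumes "open W" "x \<in> W" "\<And>y. y \<in> W \<Longrightarrow> f y = g y" "f differentiable (at x)"
  shows "D f x v = D g x v"
  using frechet_derivative_transform_within_open[OF assms(4,1,2,3)] by simp

lemma differentiable_cong:
  assumes "open W" "x \<in> W" "\<And>y. y \<in> W \<Longrightarrow> f y = g y" "f differentiable (at x)"
  shows "g differentiable (at x)"
  using assms by (meson differentiable_def has_derivative_transform_within_open)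

text \<open>Derivatives are taken along full neighbourhoods, so on an open set they see only the
  values there. The induction leaves \<open>f\<close> and \<open>g\<close> arbitrary because it
  passes to their directional derivatives.\<close>

lemma ck_on_cong:
  assumes "open W" "\<And>x. x \<in> W \<Longrightarrow> f x = g x"
  shows "ck_on k W f \<longleftrightarrow> ck_on k W g"
  using assms(2)
proof (induction k arbitrary: f g)
  case 0
  then show ?case by (simp cong: continuous_on_cong)
next
  case (Suc k)
  have d: "(\<forall>x\<in>W. f differentiable (at x)) \<longleftrightarrow> (\<forall>x\<in>W. g differentiable (at x))"
    using differentiable_cong[OF assms(1)] Suc.prems by metis
  show ?case
  proof (cases "\<forall>x\<in>W. f differentiable (at x)")
    case True
    have "ck_on k W (\<lambda>x. D f x v) \<longleftrightarrow> ck_on k W (\<lambda>x. D g x v)" for v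
      by (rule Suc.IH) (use D_cong[OF assms(1)] Suc.prems True in blast)
    then show ?thesis using d by simp
  next
    case False
    then show ?thesis unfolding ck_on.simps using d by blast
  qed
qed

lemma ck_on_subset: "W' \<subseteq> W \<Longrightarrow> ck_on k W f \<Longrightarrow> ck_on k W' f"
  by (induction k arbitrary: f) (auto intro: continuous_on_subset)

lemma ck_on_Suc_imp: "ck_on (Suc k) W f \<Longrightarrow> ck_on k W f"
proof (induction k arbitrary: f)
  case 0
  then show ?case
    by (auto intro!: continuous_at_imp_continuous_on differentiable_imp_continuous_within)
qed auto

text \<open>Lets a known formula \<open>f'\<close> stand in for the chosen derivative
  \<open>D f\<close>, so that each closure rule reduces to the matching differentiation rule and to
  rules of one order less.\<close>

lemma ck_on_SucI:
  assumes "open W" "\<And>x. x \<in> W \<Longrightarrow> (f has_derivative f' x) (at x)"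
    "\<And>v. ck_on k W (\<lambda>x. f' x v)"
  shows "ck_on (Suc k) W f"
proof -
  have "ck_on k W (\<lambda>x. D f x v)" for v
    using ck_on_cong[OF assms(1), of "\<lambda>x. D f x v" "\<lambda>x. f' x v"] D_eqI[OF assms(2)] assms(3)
    by blast
  then show ?thesis using assms(2) by (auto simp: differentiable_def)
qed

lemma ck_on_const: "ck_on k W (\<lambda>_. c)"
  by (induction k arbitrary: c) auto

lemma ck_on_linear_compose:
  assumes "open W" "bounded_linear L" "ck_on k W f"
  shows "ck_on k W (\<lambda>x. L (f x))"
  using assms(3)
proof (induction k arbitrary: f)
  case 0
  then show ?case by (simp add: bounded_linear.continuous_on[OF assms(2)])
next
  case (Suc k)
  show ?case
    by (rule ck_on_SucI[OF assms(1) bounded_linear.has_derivative[OF assms(2) has_derivative_D]])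
      (use Suc in auto)
qed

lemma ck_on_add:
  assumes "open W" "ck_on k W f" "ck_on k W g"
  shows "ck_on k W (\<lambda>x. f x + g x)"
  using assms(2,3)
proof (induction k arbitrary: f g)
  case 0
  then show ?case by (simp add: continuous_on_add)
next
  case (Suc k)
  show ?case
    by (rule ck_on_SucI[OF assms(1) has_derivative_add[OF has_derivative_D has_derivative_D]])
      (use Suc in auto)
qed

lemma ck_on_sum:
  assumes "open W" "\<And>i. i \<in> I \<Longrightarrow> ck_on k W (f i)"
  shows "ck_on k W (\<lambda>x. \<Sum>i\<in>I. f i x)"
  using assms(2)
  by (induction I rule: infinite_finite_induct) (auto intro!: ck_on_add ck_on_const assms(1))

lemma ck_on_bilinear:
  assumes "open W" "bounded_bilinear B" "ck_on k W f" "ck_on k W g"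
  shows "ck_on k W (\<lambda>x. B (f x) (g x))"
  using assms(3,4)
proof (induction k arbitrary: f g)
  case 0
  then show ?case by (simp add: bounded_bilinear.continuous_on[OF assms(2)])
next
  case (Suc k)
  note fg = ck_on_Suc_imp[OF Suc.prems(1)] ck_on_Suc_imp[OF Suc.prems(2)]
  show ?case
    by (rule ck_on_SucI[OF assms(1)
          bounded_bilinear.FDERIV[OF assms(2) has_derivative_D has_derivative_D]])
      (use Suc fg in \<open>auto intro!: ck_on_add assms(1)\<close>)
qed

lemma linear_basis_expand:
  fixes L :: "'e::euclidean_space \<Rightarrow> 'f::real_vector"
  assumes "linear L"
  shows "L v = (\<Sum>b\<in>Basis. (v \<bullet> b) *\<^sub>R L b)"
proof -
  have "L v = L (\<Sum>b\<in>Basis. (v \<bullet> b) *\<^sub>R b)" by (simp add: euclidean_representation)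
  also have "\<dots> = (\<Sum>b\<in>Basis. (v \<bullet> b) *\<^sub>R L b)"
    using assms by (simp add: linear_sum linear_scale)
  finally show ?thesis .
qed

text \<open>Tensor fields are known to be smooth only on constant arguments. Expanding the moving
  argument in the standard basis leaves a finite sum of products.\<close>

lemma ck_on_apply:
  fixes F :: "'d::euclidean_space \<Rightarrow> 'e::euclidean_space \<Rightarrow> 'f::euclidean_space"
  assumes "open W" "\<And>x. x \<in> W \<Longrightarrow> linear (F x)" "\<And>v. ck_on k W (\<lambda>x. F x v)" "ck_on k W X"
  shows "ck_on k W (\<lambda>x. F x (X x))"
proof -
  have "ck_on k W (\<lambda>x. \<Sum>b\<in>Basis. (X x \<bullet> b) *\<^sub>R F x b)"
    by (intro ck_on_sum ck_on_bilinear[OF assms(1) bounded_bilinear_scaleR] assms(1,3,4)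
        ck_on_linear_compose[OF assms(1) bounded_linear_inner_left])
  then show ?thesis
    by (subst ck_on_cong[OF assms(1)]) (use linear_basis_expand[OF assms(2)] in auto)
qed

text \<open>The chain rule produces \<open>D g (f x)\<close> evaluated on the moving vector
  \<open>D f x v\<close>. \<open>ck_on_apply\<close> handles the evaluation, and the induction
  hypothesis, used for the directional derivatives of \<open>g\<close>, handles the inner
  composition.\<close>

lemma ck_on_compose:
  fixes f :: "'d::euclidean_space \<Rightarrow> 'e::euclidean_space" and g :: "'e \<Rightarrow> 'f::euclidean_space"
  assumes "open W" "open V" "\<And>x. x \<in> W \<Longrightarrow> f x \<in> V" "ck_on k W f" "ck_on k V g"
  shows "ck_on k W (\<lambda>x. g (f x))"
  using assms(4,5)
proof (induction k arbitrary: g)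
  case 0
  then show ?case using assms(3) by (auto intro: continuous_on_compose2)
next
  case (Suc k)
  note f = ck_on_Suc_imp[OF Suc.prems(1)]
  have d: "((\<lambda>x. g (f x)) has_derivative (\<lambda>v. D g (f x) (D f x v))) (at x)" if "x \<in> W" for x
    by (rule has_derivative_compose[of f "D f x" x UNIV g "D g (f x)"]; rule has_derivative_D)
      (use that assms(3) Suc.prems in auto)
  show ?case
  proof (rule ck_on_SucI[OF assms(1) d], assumption)
    fix v
    show "ck_on k W (\<lambda>x. D g (f x) (D f x v))"
    proof (rule ck_on_apply[OF assms(1), of "\<lambda>x. D g (f x)"])
      show "ck_on k W (\<lambda>x. D g (f x) u)" for u
        using Suc.IH[OF f, of "\<lambda>y. D g y u"] Suc.prems(2) by simp
    qed (use Suc.prems assms(3) in \<open>auto intro!: linear_D\<close>)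
  qed
qed

section \<open>Closure properties of smooth maps\<close>

lemma smooth_on_differentiable: "smooth_on W f \<Longrightarrow> x \<in> W \<Longrightarrow> f differentiable (at x)"
  unfolding smooth_on_def by (auto dest!: spec[of _ "Suc 0"])

lemma smooth_on_D1: "smooth_on W f \<Longrightarrow> smooth_on W (\<lambda>x. D f x v)"
  unfolding smooth_on_def using ck_on.simps(2) by blast

lemma smooth_on_continuous: "smooth_on W f \<Longrightarrow> continuous_on W f"
  unfolding smooth_on_def by (auto dest!: spec[of _ 0])

lemma smooth_on_cong:
  assumes "open W" "\<And>x. x \<in> W \<Longrightarrow> f x = g x"
  shows "smooth_on W f \<longleftrightarrow> smooth_on W g"
  unfolding smooth_on_def using ck_on_cong[OF assms(1), of f g] assms(2) by blast

lemma smooth_on_subset: "smooth_on W f \<Longrightarrow> W' \<subseteq> W \<Longrightarrow> smooth_on W' f"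
  unfolding smooth_on_def using ck_on_subset by blast

lemma smooth_on_if_D:
  assumes "open W" "\<And>x. x \<in> W \<Longrightarrow> (f has_derivative f' x) (at x)"
    "\<And>v. smooth_on W (\<lambda>x. f' x v)"
  shows "smooth_on W f"
proof -
  have "ck_on (Suc k) W f" for k
    by (rule ck_on_SucI[OF assms(1,2)]) (use assms(3) in \<open>auto simp: smooth_on_def\<close>)
  then have "ck_on k W f" for k by (rule ck_on_Suc_imp)
  then show ?thesis unfolding smooth_on_def by blast
qed

lemma smooth_on_const: "smooth_on W (\<lambda>_. c)"
  unfolding smooth_on_def by (simp add: ck_on_const)

lemma smooth_on_ident: "open W \<Longrightarrow> smooth_on W (\<lambda>x. x)"
  by (rule smooth_on_if_D[OF _ has_derivative_ident]) (auto simp: smooth_on_const)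

lemma smooth_on_linear_compose:
  "open W \<Longrightarrow> bounded_linear L \<Longrightarrow> smooth_on W f \<Longrightarrow> smooth_on W (\<lambda>x. L (f x))"
  unfolding smooth_on_def by (simp add: ck_on_linear_compose)

lemma smooth_on_add:
  "open W \<Longrightarrow> smooth_on W f \<Longrightarrow> smooth_on W g \<Longrightarrow> smooth_on W (\<lambda>x. f x + g x)"
  unfolding smooth_on_def by (simp add: ck_on_add)

lemma smooth_on_sum:
  "open W \<Longrightarrow> (\<And>i. i \<in> I \<Longrightarrow> smooth_on W (f i)) \<Longrightarrow> smooth_on W (\<lambda>x. \<Sum>i\<in>I. f i x)"
  unfolding smooth_on_def by (simp add: ck_on_sum)

lemma smooth_on_bilinear:
  "open W \<Longrightarrow> bounded_bilinear B \<Longrightarrow> smooth_on W f \<Longrightarrow> smooth_on W g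
    \<Longrightarrow> smooth_on W (\<lambda>x. B (f x) (g x))"
  unfolding smooth_on_def by (simp add: ck_on_bilinear)

lemmas smooth_on_scaleR = smooth_on_bilinear[OF _ bounded_bilinear_scaleR]
lemmas smooth_on_inner = smooth_on_bilinear[OF _ bounded_bilinear_inner]

lemma smooth_on_mult:
  fixes f :: "'e::euclidean_space \<Rightarrow> real"
  shows "open W \<Longrightarrow> smooth_on W f \<Longrightarrow> smooth_on W g \<Longrightarrow> smooth_on W (\<lambda>x. f x * g x)"
  by (rule smooth_on_bilinear[OF _ bounded_bilinear_mult])

lemma smooth_on_minus:
  "open W \<Longrightarrow> smooth_on W f \<Longrightarrow> smooth_on W (\<lambda>x. - f x)"
  by (rule smooth_on_linear_compose[OF _ bounded_linear_minus[OF bounded_linear_ident]])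

lemma smooth_on_diff:
  "open W \<Longrightarrow> smooth_on W f \<Longrightarrow> smooth_on W g \<Longrightarrow> smooth_on W (\<lambda>x. f x - g x)"
  using smooth_on_add[of W f "\<lambda>x. - g x"] smooth_on_minus[of W g] by simp

lemma smooth_on_apply:
  fixes F :: "'d::euclidean_space \<Rightarrow> 'e::euclidean_space \<Rightarrow> 'f::euclidean_space"
  assumes "open W" "\<And>x. x \<in> W \<Longrightarrow> linear (F x)" "\<And>v. smooth_on W (\<lambda>x. F x v)" "smooth_on W X"
  shows "smooth_on W (\<lambda>x. F x (X x))"
  unfolding smooth_on_def
  by (rule allI, rule ck_on_apply[of W F, OF assms(1,2)]) (use assms(3,4) in \<open>auto simp: smooth_on_def\<close>)

lemma smooth_on_apply2:
  fixes T :: "'d::euclidean_space \<Rightarrow> 'e::euclidean_space \<Rightarrow> 'e \<Rightarrow> 'f::euclidean_space"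
  assumes "open W" "\<And>x. x \<in> W \<Longrightarrow> bilinear (T x)" "\<And>v w. smooth_on W (\<lambda>x. T x v w)"
    "smooth_on W X" "smooth_on W Y"
  shows "smooth_on W (\<lambda>x. T x (X x) (Y x))"
proof (rule smooth_on_apply[OF assms(1) _ _ assms(5)])
  fix v
  show "smooth_on W (\<lambda>x. T x (X x) v)"
    by (rule smooth_on_apply[OF assms(1) _ _ assms(4), of "\<lambda>x u. T x u v"])
      (use assms(2,3) in \<open>auto simp: bilinear_def\<close>)
qed (use assms(2) in \<open>auto simp: bilinear_def\<close>)

lemma smooth_on_D:
  assumes "open W" "smooth_on W f" "smooth_on W X"
  shows "smooth_on W (\<lambda>x. D f x (X x))"
  by (rule smooth_on_apply[OF assms(1) _ _ assms(3), of "D f"])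
    (use assms in \<open>auto intro: linear_D smooth_on_differentiable smooth_on_D1\<close>)

lemma smooth_on_compose:
  fixes f :: "'d::euclidean_space \<Rightarrow> 'e::euclidean_space" and g :: "'e \<Rightarrow> 'f::euclidean_space"
  assumes "open W" "open V" "\<And>x. x \<in> W \<Longrightarrow> f x \<in> V" "smooth_on W f" "smooth_on V g"
  shows "smooth_on W (\<lambda>x. g (f x))"
  unfolding smooth_on_def
  by (rule allI, rule ck_on_compose[of W V f, OF assms(1,2,3)]) (use assms(4,5) in \<open>auto simp: smooth_on_def\<close>)

section \<open>Smoothness of elementary real functions\<close>

lemma smooth_on_exp: "smooth_on UNIV (exp :: real \<Rightarrow> real)"
proof -
  have "ck_on k UNIV (exp :: real \<Rightarrow> real)" for k
  proof (induction k)
    case (Suc k)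
    show ?case
      by (rule ck_on_SucI[where f' = "\<lambda>x v. v * exp x"])
        (auto intro!: derivative_eq_intros ck_on_bilinear[OF _ bounded_bilinear_mult] ck_on_const Suc)
  qed (auto intro: continuous_intros)
  then show ?thesis unfolding smooth_on_def by blast
qed

text \<open>The derivative of inversion is a product of copies of inversion itself, so each order of
  differentiability yields the next.\<close>

lemma smooth_on_inverse: "smooth_on (- {0}) (inverse :: real \<Rightarrow> real)"
proof -
  have "ck_on k (- {0}) (inverse :: real \<Rightarrow> real)" for k
  proof (induction k)
    case (Suc k)
    show ?case
    proof (rule ck_on_SucI[where f' = "\<lambda>x v. (- v) * (inverse x * inverse x)"])
      show "ck_on k (- {0}) (\<lambda>x. (- v) * (inverse x * inverse x))" for v :: real
        by (intro ck_on_bilinear[OF _ bounded_bilinear_mult] ck_on_const Suc) auto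
    qed (auto intro!: derivative_eq_intros)
  qed (auto intro: continuous_intros)
  then show ?thesis unfolding smooth_on_def by blast
qed

lemma ck_on_inverse_compose:
  fixes f :: "'e::euclidean_space \<Rightarrow> real"
  assumes "open W" "\<And>x. x \<in> W \<Longrightarrow> f x \<noteq> 0" "ck_on k W f"
  shows "ck_on k W (\<lambda>x. inverse (f x))"
  by (rule ck_on_compose[OF assms(1), where V = "- {0}" and g = inverse])
    (use assms smooth_on_inverse in \<open>auto simp: smooth_on_def\<close>)

lemma smooth_on_sqrt: "smooth_on {0<..} sqrt"
proof -
  have "ck_on k {0<..} sqrt" for k
  proof (induction k)
    case (Suc k)
    show ?case
    proof (rule ck_on_SucI[where f' = "\<lambda>x v. v * (inverse (sqrt x) * inverse 2)"])
      show "ck_on k {0<..} (\<lambda>x. v * (inverse (sqrt x) * inverse 2))" for v :: real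
        by (intro ck_on_bilinear[OF _ bounded_bilinear_mult] ck_on_const ck_on_inverse_compose Suc)
          auto
    qed (auto intro!: derivative_eq_intros simp: field_simps)
  qed (auto intro: continuous_intros)
  then show ?thesis unfolding smooth_on_def by blast
qed

lemma smooth_on_inverse_compose:
  fixes f :: "'e::euclidean_space \<Rightarrow> real"
  assumes "open W" "\<And>x. x \<in> W \<Longrightarrow> f x \<noteq> 0" "smooth_on W f"
  shows "smooth_on W (\<lambda>x. inverse (f x))"
  unfolding smooth_on_def
  by (rule allI, rule ck_on_inverse_compose[of W f, OF assms(1,2)]) (use assms(3) in \<open>auto simp: smooth_on_def\<close>)

lemma smooth_on_divide:
  fixes f :: "'e::euclidean_space \<Rightarrow> real"
  assumes "open W" "\<And>x. x \<in> W \<Longrightarrow> g x \<noteq> 0" "smooth_on W f" "smooth_on W g"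
  shows "smooth_on W (\<lambda>x. f x / g x)"
  unfolding divide_inverse
  by (intro smooth_on_mult smooth_on_inverse_compose assms)

lemma smooth_on_sqrt_compose:
  fixes f :: "'e::euclidean_space \<Rightarrow> real"
  assumes "open W" "\<And>x. x \<in> W \<Longrightarrow> f x > 0" "smooth_on W f"
  shows "smooth_on W (\<lambda>x. sqrt (f x))"
  by (rule smooth_on_compose[OF assms(1) open_greaterThan _ assms(3) smooth_on_sqrt])
    (use assms in auto)

lemma smooth_on_exp_compose:
  fixes f :: "'e::euclidean_space \<Rightarrow> real"
  assumes "open W" "smooth_on W f"
  shows "smooth_on W (\<lambda>x. exp (f x))"
  by (rule smooth_on_compose[OF assms(1) open_UNIV _ assms(2) smooth_on_exp]) auto

text \<open>Bootstrapping: if \<open>G\<close> is of class \<open>C\<^sup>k\<close>, then so is its derivative, hence \<open>G\<close> is of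
  class \<open>C\<^bsup>k+1\<^esup>\<close>.\<close>

lemma smooth_on_if_autonomous:
  fixes G :: "'e::euclidean_space \<Rightarrow> 'f::euclidean_space"
  assumes "open V" "open W" "\<And>y. y \<in> V \<Longrightarrow> G y \<in> W"
    and "\<And>y. y \<in> V \<Longrightarrow> (G has_derivative (\<lambda>v. \<Sum>i\<in>I. c i v y *\<^sub>R E i (G y))) (at y)"
    and "\<And>i v. i \<in> I \<Longrightarrow> smooth_on V (c i v)" "\<And>i. i \<in> I \<Longrightarrow> smooth_on W (E i)"
  shows "smooth_on V G"
proof -
  have "ck_on k V G" for k
  proof (induction k)
    case 0
    show ?case
      using assms(4) by (auto intro!: continuous_at_imp_continuous_on has_derivative_continuous)
  next
    case (Suc k)
    show ?case
      by (rule ck_on_SucI[OF assms(1,4)], assumption)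
        (use assms Suc in \<open>auto intro!: ck_on_sum ck_on_bilinear[OF _ bounded_bilinear_scaleR]
          ck_on_compose[OF assms(1,2,3)] simp: smooth_on_def\<close>)
  qed
  then show ?thesis unfolding smooth_on_def by blast
qed

subsection \<open>Differentiating along fields\<close>

lemma D_add:
  "f differentiable (at x) \<Longrightarrow> g differentiable (at x) \<Longrightarrow>
    D (\<lambda>y. f y + g y) x v = D f x v + D g x v"
  by (rule D_eqI) (intro has_derivative_add has_derivative_D)

lemma D_diff:
  "f differentiable (at x) \<Longrightarrow> g differentiable (at x) \<Longrightarrow>
    D (\<lambda>y. f y - g y) x v = D f x v - D g x v"
  by (rule D_eqI) (intro has_derivative_diff has_derivative_D)

lemma D_minus: "f differentiable (at x) \<Longrightarrow> D (\<lambda>y. - f y) x v = - D f x v"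
  by (rule D_eqI) (intro has_derivative_minus has_derivative_D)

lemma D_bilinear:
  "bounded_bilinear B \<Longrightarrow> f differentiable (at x) \<Longrightarrow> g differentiable (at x) \<Longrightarrow>
    D (\<lambda>y. B (f y) (g y)) x v = B (f x) (D g x v) + B (D f x v) (g x)"
  by (rule D_eqI, rule bounded_bilinear.FDERIV, assumption; rule has_derivative_D)

lemmas D_scaleR = D_bilinear[OF bounded_bilinear_scaleR]

lemma D_mult:
  fixes f :: "'e::euclidean_space \<Rightarrow> real"
  shows "f differentiable (at x) \<Longrightarrow> g differentiable (at x) \<Longrightarrow>
    D (\<lambda>y. f y * g y) x v = f x * D g x v + D f x v * g x"
  by (rule D_bilinear[OF bounded_bilinear_mult])

lemma D_linear_compose:
  "bounded_linear L \<Longrightarrow> f differentiable (at x) \<Longrightarrow> D (\<lambda>y. L (f y)) x v = L (D f x v)"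
  by (rule D_eqI, rule bounded_linear.has_derivative, assumption, rule has_derivative_D)

lemma D_sum:
  "(\<And>i. i \<in> I \<Longrightarrow> f i differentiable (at x)) \<Longrightarrow>
    D (\<lambda>y. \<Sum>i\<in>I. f i y) x v = (\<Sum>i\<in>I. D (f i) x v)"
  by (rule D_eqI, rule has_derivative_sum, rule has_derivative_D)

text \<open>Product rule for evaluating a varying linear map on a varying vector. The derivative of
  \<open>F\<close> is expressed with its argument frozen at \<open>X x\<close>; expansion in the
  basis reduces the claim to products of real functions with vectors.\<close>

lemma D_apply:
  fixes F :: "'d::euclidean_space \<Rightarrow> 'e::euclidean_space \<Rightarrow> 'f::euclidean_space"
  assumes "open W" "x \<in> W" "\<And>y. y \<in> W \<Longrightarrow> linear (F y)"
    and F: "\<And>v. (\<lambda>y. F y v) differentiable (at x)" and X: "X differentiable (at x)"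
  shows "(\<lambda>y. F y (X y)) differentiable (at x)"
    and "D (\<lambda>y. F y (X y)) x v = D (\<lambda>y. F y (X x)) x v + F x (D X x v)"
proof -
  let ?G = "\<lambda>y. \<Sum>b\<in>Basis. (X y \<bullet> b) *\<^sub>R F y b"
  have h: "(?G has_derivative (\<lambda>v. \<Sum>b\<in>Basis. (X x \<bullet> b) *\<^sub>R D (\<lambda>y. F y b) x v
      + (D X x v \<bullet> b) *\<^sub>R F x b)) (at x)"
    by (intro has_derivative_sum has_derivative_scaleR has_derivative_inner_left
        has_derivative_D F X)
  have h0: "((\<lambda>y. \<Sum>b\<in>Basis. (X x \<bullet> b) *\<^sub>R F y b) has_derivative
      (\<lambda>v. \<Sum>b\<in>Basis. (X x \<bullet> b) *\<^sub>R D (\<lambda>y. F y b) x v)) (at x)"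
    by (intro has_derivative_sum has_derivative_scaleR_right has_derivative_D F)
  have e: "F y u = (\<Sum>b\<in>Basis. (u \<bullet> b) *\<^sub>R F y b)" if "y \<in> W" for y u
    using linear_basis_expand[OF assms(3)[OF that]] .
  have h': "((\<lambda>y. F y (X y)) has_derivative (\<lambda>v. \<Sum>b\<in>Basis. (X x \<bullet> b) *\<^sub>R D (\<lambda>y. F y b) x v
      + (D X x v \<bullet> b) *\<^sub>R F x b)) (at x)"
    by (rule has_derivative_transform_within_open[OF h assms(1,2)]) (use e in metis)
  have h0': "((\<lambda>y. F y (X x)) has_derivative
      (\<lambda>v. \<Sum>b\<in>Basis. (X x \<bullet> b) *\<^sub>R D (\<lambda>y. F y b) x v)) (at x)"
    by (rule has_derivative_transform_within_open[OF h0 assms(1,2)]) (use e in metis)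
  show "(\<lambda>y. F y (X y)) differentiable (at x)"
    using h' by (auto simp: differentiable_def)
  show "D (\<lambda>y. F y (X y)) x v = D (\<lambda>y. F y (X x)) x v + F x (D X x v)"
    using D_eqI[OF h'] D_eqI[OF h0'] e[OF assms(2), of "D X x v"] by (simp add: sum.distrib)
qed

lemma D_apply2:
  fixes T :: "'d::euclidean_space \<Rightarrow> 'e::euclidean_space \<Rightarrow> 'e \<Rightarrow> 'f::euclidean_space"
  assumes "open W" "x \<in> W" "\<And>y. y \<in> W \<Longrightarrow> bilinear (T y)"
    and T: "\<And>v w. (\<lambda>y. T y v w) differentiable (at x)"
    and X: "X differentiable (at x)" and Y: "Y differentiable (at x)"
  shows "(\<lambda>y. T y (X y) (Y y)) differentiable (at x)"
    and "D (\<lambda>y. T y (X y) (Y y)) x v =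
      D (\<lambda>y. T y (X x) (Y x)) x v + T x (D X x v) (Y x) + T x (X x) (D Y x v)"
proof -
  have lin: "linear (\<lambda>u. T y u w)" "linear (T y u)" if "y \<in> W" for y u w
    using assms(3)[OF that] by (auto simp: bilinear_def)
  note 1 = D_apply[OF assms(1,2), of "\<lambda>y u. T y u w" X for w, OF lin(1) T X]
  note 2 = D_apply[OF assms(1,2), of "\<lambda>y. T y (X y)" Y, OF lin(2) 1(1) Y]
  show "(\<lambda>y. T y (X y) (Y y)) differentiable (at x)" using 2(1) .
  show "D (\<lambda>y. T y (X y) (Y y)) x v =
      D (\<lambda>y. T y (X x) (Y x)) x v + T x (D X x v) (Y x) + T x (X x) (D Y x v)"
    using 2(2) 1(2) by simp
qed

lemma linear_D_arg:
  fixes F :: "'d::euclidean_space \<Rightarrow> 'e::euclidean_space \<Rightarrow> 'f::euclidean_space"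
  assumes x: "open W" "x \<in> W" and lin: "\<And>y. y \<in> W \<Longrightarrow> linear (F y)"
    and d: "\<And>v. (\<lambda>y. F y v) differentiable (at x)"
  shows "linear (\<lambda>v. D (\<lambda>y. F y v) x u)"
proof (rule linearI)
  fix a b
  have "D (\<lambda>y. F y (a + b)) x u = D (\<lambda>y. F y a + F y b) x u"
    by (rule D_cong[OF x _ d]) (simp add: linear_add[OF lin])
  then show "D (\<lambda>y. F y (a + b)) x u = D (\<lambda>y. F y a) x u + D (\<lambda>y. F y b) x u"
    by (simp add: D_add[OF d d])
next
  fix c a
  have "D (\<lambda>y. F y (c *\<^sub>R a)) x u = D (\<lambda>y. c *\<^sub>R F y a) x u"
    by (rule D_cong[OF x _ d]) (simp add: linear_scale[OF lin])
  then show "D (\<lambda>y. F y (c *\<^sub>R a)) x u = c *\<^sub>R D (\<lambda>y. F y a) x u"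
    by (simp add: D_linear_compose[OF bounded_linear_scaleR_right d])
qed

lemma D_compose:
  assumes "f differentiable (at x)" "g differentiable (at (f x))"
  shows "(\<lambda>y. g (f y)) differentiable (at x)" "D (\<lambda>y. g (f y)) x v = D g (f x) (D f x v)"
proof -
  have "((\<lambda>y. g (f y)) has_derivative (\<lambda>v. D g (f x) (D f x v))) (at x)"
    by (rule has_derivative_compose[of f "D f x" x UNIV g "D g (f x)"];
        rule has_derivative_D) (use assms in auto)
  then show "(\<lambda>y. g (f y)) differentiable (at x)" "D (\<lambda>y. g (f y)) x v = D g (f x) (D f x v)"
    by (auto simp: differentiable_def dest: D_eqI)
qed

subsection \<open>Symmetry of second derivatives\<close>

lemma DERIV_along_line:
  fixes f :: "'e::euclidean_space \<Rightarrow> real"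
  assumes "f differentiable (at (p + t *\<^sub>R v))"
  shows "((\<lambda>s. f (p + s *\<^sub>R v)) has_real_derivative D f (p + t *\<^sub>R v) v) (at t)"
proof -
  have 1: "((\<lambda>s. p + s *\<^sub>R v) has_derivative (\<lambda>h. h *\<^sub>R v)) (at t)"
    by (auto intro!: derivative_eq_intros)
  have "((\<lambda>s. f (p + s *\<^sub>R v)) has_derivative (\<lambda>h. D f (p + t *\<^sub>R v) (h *\<^sub>R v))) (at t)"
    by (rule has_derivative_compose[OF 1]) (rule has_derivative_D[OF assms])
  moreover have "(\<lambda>h. D f (p + t *\<^sub>R v) (h *\<^sub>R v)) = (*) (D f (p + t *\<^sub>R v) v)"
    by (simp add: linear_scale[OF linear_D[OF assms]] fun_eq_iff)
  ultimately show ?thesis by (simp add: has_field_derivative_def)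
qed

text \<open>The mean value theorem is applied twice: along \<open>v\<close> to the difference of
  \<open>f\<close> and its shift by \<open>s *\<^sub>R w\<close>, then along \<open>w\<close> to the
  derivative of \<open>f\<close> in direction \<open>v\<close>.\<close>

lemma double_difference:
  fixes f :: "'e::euclidean_space \<Rightarrow> real"
  assumes f: "smooth_on (ball x r) f" and s: "0 < s" "s * (norm v + norm w) < r"
  obtains z where "dist x z \<le> s * (norm v + norm w)"
    "f (x + s *\<^sub>R v + s *\<^sub>R w) - f (x + s *\<^sub>R v) - f (x + s *\<^sub>R w) + f x
      = s * (s * D (\<lambda>y. D f y v) z w)"
proof -
  have dist: "dist x (x + a *\<^sub>R v + b *\<^sub>R w) \<le> s * (norm v + norm w)"
    if "0 \<le> a" "a \<le> s" "0 \<le> b" "b \<le> s" for a b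
  proof -
    have "norm (a *\<^sub>R v + b *\<^sub>R w) \<le> norm (a *\<^sub>R v) + norm (b *\<^sub>R w)" by (rule norm_triangle_ineq)
    also have "\<dots> \<le> s * norm v + s * norm w"
      using that by (auto intro!: add_mono mult_right_mono)
    finally show ?thesis by (simp add: dist_norm algebra_simps norm_minus_commute)
  qed
  then have inb: "x + a *\<^sub>R v + b *\<^sub>R w \<in> ball x r"
    if "0 \<le> a" "a \<le> s" "0 \<le> b" "b \<le> s" for a b
    using that s(2) by fastforce
  have df: "f differentiable (at (x + a *\<^sub>R v + b *\<^sub>R w))"
    and df': "(\<lambda>y. D f y v) differentiable (at (x + a *\<^sub>R v + b *\<^sub>R w))"
    if "0 \<le> a" "a \<le> s" "0 \<le> b" "b \<le> s" for a b
    using smooth_on_differentiable[OF f inb] smooth_on_differentiable[OF smooth_on_D1[OF f] inb] that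
    by blast+
  let ?u = "\<lambda>t. f ((x + s *\<^sub>R w) + t *\<^sub>R v) - f (x + t *\<^sub>R v)"
  have "(?u has_real_derivative D f ((x + s *\<^sub>R w) + t *\<^sub>R v) v - D f (x + t *\<^sub>R v) v) (at t)"
    if "0 \<le> t" "t \<le> s" for t
    using df[of t s] df[of t 0] that s(1)
    by (intro DERIV_diff DERIV_along_line) (auto simp: algebra_simps)
  then obtain a where a: "0 < a" "a < s"
    "?u s - ?u 0 = (s - 0) * (D f ((x + s *\<^sub>R w) + a *\<^sub>R v) v - D f (x + a *\<^sub>R v) v)"
    using MVT2[OF s(1), of ?u "\<lambda>t. D f ((x + s *\<^sub>R w) + t *\<^sub>R v) v - D f (x + t *\<^sub>R v) v"] by blast
  let ?g = "\<lambda>t. D f ((x + a *\<^sub>R v) + t *\<^sub>R w) v"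
  have "(?g has_real_derivative D (\<lambda>y. D f y v) ((x + a *\<^sub>R v) + t *\<^sub>R w) w) (at t)"
    if "0 \<le> t" "t \<le> s" for t
    using df'[of a t] that a by (intro DERIV_along_line) auto
  then obtain b where b: "0 < b" "b < s"
    "?g s - ?g 0 = (s - 0) * D (\<lambda>y. D f y v) ((x + a *\<^sub>R v) + b *\<^sub>R w) w"
    using MVT2[OF s(1), of ?g "\<lambda>t. D (\<lambda>y. D f y v) ((x + a *\<^sub>R v) + t *\<^sub>R w) w"] by blast
  have "?u s - ?u 0 = s * (s * D (\<lambda>y. D f y v) ((x + a *\<^sub>R v) + b *\<^sub>R w) w)"
    using a(3) b(3) by (simp add: algebra_simps)
  then show ?thesis
    using that[OF dist[of a b]] a b by (simp add: algebra_simps)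
qed

text \<open>The second difference of \<open>f\<close> is symmetric in \<open>v\<close> and
  \<open>w\<close>, so the two mixed derivatives share a value, each at some point close to
  \<open>x\<close>; by continuity they cannot differ at \<open>x\<close>.\<close>

lemma D_D_commute_real:
  fixes f :: "'e::euclidean_space \<Rightarrow> real"
  assumes W: "open W" "x \<in> W" and f: "smooth_on W f"
  shows "D (\<lambda>y. D f y v) x w = D (\<lambda>y. D f y w) x v"
proof (rule ccontr)
  let ?H = "\<lambda>v w y. D (\<lambda>y. D f y v) y w"
  assume ne: "?H v w x \<noteq> ?H w v x"
  define e where "e = \<bar>?H v w x - ?H w v x\<bar> / 2"
  have e: "e > 0" using ne by (simp add: e_def)
  have cont: "isCont (?H v w) x" for v w
    using smooth_on_continuous[OF smooth_on_D1[OF smooth_on_D1[OF f]]] W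
    by (simp add: continuous_on_eq_continuous_at)
  obtain r where r: "r > 0" "ball x r \<subseteq> W" using W open_contains_ball by blast
  have f: "smooth_on (ball x r) f" using f r(2) by (rule smooth_on_subset)
  obtain d1 where d1: "d1 > 0" "\<And>y. dist y x < d1 \<Longrightarrow> dist (?H v w y) (?H v w x) < e"
    using cont[of v w] e unfolding continuous_at_eps_delta by blast
  obtain d2 where d2: "d2 > 0" "\<And>y. dist y x < d2 \<Longrightarrow> dist (?H w v y) (?H w v x) < e"
    using cont[of w v] e unfolding continuous_at_eps_delta by blast
  define m where "m = min r (min d1 d2)"
  \<comment> \<open>The summand 1 keeps the denominator positive when \<open>v\<close> and
    \<open>w\<close> vanish and makes the bound by \<open>m\<close> strict.\<close>
  define s where "s = m / (norm v + norm w + 1)"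
  have m: "m > 0" using r d1 d2 by (simp add: m_def)
  have s: "s > 0" unfolding s_def using m by (intro divide_pos_pos) (auto intro: add_nonneg_pos)
  have "s * (norm v + norm w) < s * (norm v + norm w + 1)" using s by simp
  also have "\<dots> = m" unfolding s_def using norm_ge_zero[of v] norm_ge_zero[of w]
    by (simp add: add_nonneg_eq_0_iff field_simps)
  finally have sm: "s * (norm v + norm w) < m" .
  then have sr: "s * (norm v + norm w) < r" "s * (norm w + norm v) < r"
    by (auto simp: m_def add.commute)
  obtain z1 where z1: "dist x z1 \<le> s * (norm v + norm w)"
    "f (x + s *\<^sub>R v + s *\<^sub>R w) - f (x + s *\<^sub>R v) - f (x + s *\<^sub>R w) + f x = s * (s * ?H v w z1)"
    using double_difference[OF f s sr(1)] by blast
  obtain z2 where z2: "dist x z2 \<le> s * (norm w + norm v)"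
    "f (x + s *\<^sub>R w + s *\<^sub>R v) - f (x + s *\<^sub>R w) - f (x + s *\<^sub>R v) + f x = s * (s * ?H w v z2)"
    using double_difference[OF f s sr(2)] by blast
  have "s * (s * ?H v w z1) = s * (s * ?H w v z2)"
    using z1(2) z2(2) by (simp add: algebra_simps)
  then have "?H v w z1 = ?H w v z2" using s by simp
  moreover have "dist (?H v w z1) (?H v w x) < e" "dist (?H w v z2) (?H w v x) < e"
    using z1(1) z2(1) sm d1(2)[of z1] d2(2)[of z2]
    by (auto simp: m_def dist_commute[of x] add.commute[of "norm w"])
  moreover have False if "p = q" "\<bar>p - a\<bar> < \<bar>a - b\<bar> / 2" "\<bar>q - b\<bar> < \<bar>a - b\<bar> / 2" for p q a b :: real
    using that by (auto simp: abs_if split: if_splits)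
  ultimately show False unfolding dist_real_def e_def by blast
qed

lemma D_D_commute:
  fixes f :: "'e::euclidean_space \<Rightarrow> 'f::euclidean_space"
  assumes W: "open W" "x \<in> W" and f: "smooth_on W f"
  shows "D (\<lambda>y. D f y v) x w = D (\<lambda>y. D f y w) x v"
proof (rule euclidean_eqI)
  fix b :: 'f assume "b \<in> Basis"
  have fb: "smooth_on W (\<lambda>y. f y \<bullet> b)"
    by (rule smooth_on_linear_compose[OF W(1) bounded_linear_inner_left f])
  have 1: "D (\<lambda>y. f y \<bullet> b) y u = D f y u \<bullet> b" if "y \<in> W" for y u
    by (rule D_linear_compose[OF bounded_linear_inner_left smooth_on_differentiable[OF f that]])
  have 2: "D (\<lambda>y. D (\<lambda>y. f y \<bullet> b) y u) x u' = D (\<lambda>y. D f y u) x u' \<bullet> b" for u u'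
  proof -
    have "D (\<lambda>y. D (\<lambda>y. f y \<bullet> b) y u) x u' = D (\<lambda>y. D f y u \<bullet> b) x u'"
      by (rule D_cong[OF W]) (use 1 smooth_on_differentiable[OF smooth_on_D1[OF fb] W(2)] in auto)
    also have "\<dots> = D (\<lambda>y. D f y u) x u' \<bullet> b"
      by (rule D_linear_compose[OF bounded_linear_inner_left])
        (rule smooth_on_differentiable[OF smooth_on_D1[OF f] W(2)])
    finally show ?thesis .
  qed
  show "D (\<lambda>y. D f y v) x w \<bullet> b = D (\<lambda>y. D f y w) x v \<bullet> b"
    using D_D_commute_real[OF W fb] 2 by metis
qed

subsection \<open>Closed 1-forms on convex sets\<close>

text \<open>The potential is the integral of the form along the segment from \<open>a\<close>,
  differentiated under the integral sign. Closedness turns the derivative of the integrand into a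
  total derivative in the segment parameter, which integrates to the value of the form at
  \<open>x\<close>.\<close>

lemma poincare_closed_one_form:
  fixes th :: "'e::euclidean_space \<Rightarrow> 'e \<Rightarrow> real"
  assumes W: "open W" "convex W" "a \<in> W"
    and lin: "\<And>x. x \<in> W \<Longrightarrow> linear (th x)" and sm: "\<And>v. smooth_on W (\<lambda>x. th x v)"
    and closed: "\<And>x u v. x \<in> W \<Longrightarrow> D (\<lambda>y. th y v) x u = D (\<lambda>y. th y u) x v"
  obtains f where "smooth_on W f" "\<And>x. x \<in> W \<Longrightarrow> (f has_derivative th x) (at x)"
proof -
  define c where "c x t = a + t *\<^sub>R (x - a)" for x t
  have c: "c x t \<in> W" if "x \<in> W" "t \<in> {0..1}" for x t
    using that W(2,3) convexD[OF W(2,3) that(1), of "1 - t" t] by (simp add: c_def algebra_simps)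
  have cc: "continuous_on (W \<times> {0..1}) (\<lambda>(x, t). c x t)"
    unfolding c_def split_beta by (intro continuous_intros)
  have cont: "continuous_on (W \<times> {0..1}) (\<lambda>(x, t). h (c x t))" if "continuous_on W h" for h :: "'e \<Rightarrow> real"
    using continuous_on_compose2[OF that cc] c by (auto simp: split_beta image_subset_iff)
  have Dlin: "linear (D (\<lambda>y. th y v) x)" if "x \<in> W" for x v
    by (rule linear_D[OF smooth_on_differentiable[OF sm that]])
  \<comment> \<open>The derivative in \<open>x\<close> of the integrand, already rewritten by
    closedness: it equals the derivative of \<open>t * th (c x t) v\<close> in \<open>t\<close>.
    Differentiation under the integral sign asks for continuity as a bounded linear map, hence
    \<open>Blinfun\<close>.\<close>
  define L where "L x t = Blinfun (\<lambda>v. t * D (\<lambda>y. th y v) (c x t) (x - a) + th (c x t) v)" for x t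
  have Leq: "L x t v = t * D (\<lambda>y. th y v) (c x t) (x - a) + th (c x t) v"
    if x: "x \<in> W" and t: "t \<in> {0..1}" for x t v
  proof -
    \<comment> \<open>Linearity in \<open>v\<close> becomes visible once closedness exchanges
      \<open>v\<close> with the direction \<open>x - a\<close>.\<close>
    have "linear (\<lambda>v. t * D (\<lambda>y. th y v) (c x t) (x - a) + th (c x t) v)"
      using Dlin[OF c[OF x t], of "x - a"] lin[OF c[OF x t]]
      by (simp add: closed[OF c[OF x t]] linear_iff algebra_simps)
    then show ?thesis
      unfolding L_def by (simp add: bounded_linear_Blinfun_apply linear_conv_bounded_linear)
  qed
  have Lcont: "continuous_on (W \<times> cbox 0 1) (\<lambda>(x, t). L x t)"
  proof (rule continuous_on_blinfun_componentwise)
    fix i :: 'e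
    have h: "continuous_on (W \<times> {0..1}) (\<lambda>xt. D (\<lambda>y. th y i) (c (fst xt) (snd xt)) b)" for b
      using cont[OF smooth_on_continuous[OF smooth_on_D1[OF sm]], of i b] by (simp add: split_beta)
    have "continuous_on (W \<times> {0..1}) (\<lambda>xt. snd xt *
        (\<Sum>b\<in>Basis. ((fst xt - a) \<bullet> b) *\<^sub>R D (\<lambda>y. th y i) (c (fst xt) (snd xt)) b) + th (c (fst xt) (snd xt)) i)"
      using cont[OF smooth_on_continuous[OF sm], of i]
      by (auto intro!: continuous_intros h simp: split_beta)
    moreover have "(case xt of (x, t) \<Rightarrow> L x t) i = snd xt *
        (\<Sum>b\<in>Basis. ((fst xt - a) \<bullet> b) *\<^sub>R D (\<lambda>y. th y i) (c (fst xt) (snd xt)) b) + th (c (fst xt) (snd xt)) i"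
      if "xt \<in> W \<times> {0..1}" for xt
      using that linear_basis_expand[OF Dlin[OF c], of "fst xt" "snd xt" i "fst xt - a"]
      by (auto simp: Leq)
    ultimately show "continuous_on (W \<times> cbox 0 1) (\<lambda>xt. blinfun_apply (case xt of (x, t) \<Rightarrow> L x t) i)"
      by (simp cong: continuous_on_cong)
  qed
  define f where "f x = integral (cbox 0 1) (\<lambda>t. th (c x t) (x - a))" for x
  have f: "(f has_derivative th x) (at x)" if x: "x \<in> W" for x
  proof -
    have fx: "((\<lambda>x. th (c x t) (x - a)) has_derivative blinfun_apply (L x t)) (at x within W)"
      if x: "x \<in> W" and t: "t \<in> cbox 0 1" for x t
    proof -
      have t: "t \<in> {0..1}" using t by simp
      have 1: "((\<lambda>x. c x t) has_derivative (\<lambda>v. t *\<^sub>R v)) (at x)"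
        unfolding c_def by (auto intro!: derivative_eq_intros)
      have dc: "(\<lambda>x. c x t) differentiable (at x)" using 1 by (auto simp: differentiable_def)
      have dth: "(\<lambda>y. th y v) differentiable (at (c x t))" for v
        by (rule smooth_on_differentiable[OF sm c[OF x t]])
      have 2: "(\<lambda>x. th (c x t) v) differentiable (at x)"
          "D (\<lambda>x. th (c x t) v) x u = D (\<lambda>y. th y v) (c x t) (t *\<^sub>R u)" for u v
        using D_compose[OF dc dth] D_eqI[OF 1] by auto
      have "(\<lambda>x. x - a) differentiable (at x)" by simp
      note 3 = D_apply[OF W(1) x, of "\<lambda>x. th (c x t)" "\<lambda>x. x - a", OF _ 2(1) this]
      have "(\<lambda>x. th (c x t) (x - a)) differentiable (at x)" by (rule 3(1)) (use lin c t in auto)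
      moreover have "D (\<lambda>x. th (c x t) (x - a)) x v = L x t v" for v
      proof -
        have D1: "D (\<lambda>x. x - a) x v = v"
          by (rule D_eqI[where f' = "\<lambda>v. v"]) (auto intro!: derivative_eq_intros)
        have "D (\<lambda>x. th (c x t) (x - a)) x v =
            D (\<lambda>y. th y (x - a)) (c x t) (t *\<^sub>R v) + th (c x t) (D (\<lambda>x. x - a) x v)"
          using 3(2)[of v] lin c t 2(2) by auto
        then show ?thesis
          by (simp only: Leq[OF x t] D1 linear_scale[OF Dlin[OF c[OF x t]]]
              closed[OF c[OF x t], of "x - a" v] real_scaleR_def)
      qed
      ultimately show ?thesis
        using has_derivative_D has_derivative_at_withinI by (metis (no_types, lifting) ext)
    qed
    have int: "(\<lambda>t. th (c y t) (y - a)) integrable_on cbox 0 1" if y: "y \<in> W" for y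
    proof (rule integrable_continuous)
      have "continuous_on {0..1} (c y)" unfolding c_def by (intro continuous_intros)
      then show "continuous_on (cbox 0 1) (\<lambda>t. th (c y t) (y - a))"
        using continuous_on_compose2[OF smooth_on_continuous[OF sm], of "{0..1}" "c y"] c[OF y]
        by (auto simp: image_subset_iff)
    qed
    have "(f has_derivative integral (cbox 0 1) (L x)) (at x within W)"
      unfolding f_def by (rule leibniz_rule[OF fx int Lcont x W(2)])
    moreover have "blinfun_apply (integral (cbox 0 1) (L x)) v = th x v" for v
    proof -
      have "continuous_on (cbox 0 1) (\<lambda>t. case (x, t) of (x, t) \<Rightarrow> L x t)"
        by (rule continuous_on_compose2[OF Lcont]) (use x in \<open>auto intro!: continuous_intros\<close>)
      then have "L x integrable_on cbox 0 1" by (intro integrable_continuous) simp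
      then have "blinfun_apply (integral (cbox 0 1) (L x)) v = integral (cbox 0 1) (\<lambda>t. L x t v)"
        by (rule blinfun_apply_integral)
      moreover have "((\<lambda>t. L x t v) has_integral 1 * th (c x 1) v - 0 * th (c x 0) v) {0..1}"
      proof (rule fundamental_theorem_of_calculus)
        fix t :: real assume t: "t \<in> {0..1}"
        have "((\<lambda>s. th (a + s *\<^sub>R (x - a)) v) has_real_derivative
            D (\<lambda>y. th y v) (c x t) (x - a)) (at t)"
          unfolding c_def
          by (rule DERIV_along_line) (use smooth_on_differentiable[OF sm c[OF x t]] in \<open>simp add: c_def\<close>)
        then have "((\<lambda>s. th (c x s) v) has_real_derivative D (\<lambda>y. th y v) (c x t) (x - a)) (at t)"
          by (simp add: c_def)
        then have "((\<lambda>s. s * th (c x s) v) has_real_derivative L x t v) (at t)"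
          by (auto intro!: derivative_eq_intros simp: Leq[OF x t])
        then show "((\<lambda>s. s * th (c x s) v) has_vector_derivative L x t v) (at t within {0..1})"
          by (simp add: has_real_derivative_iff_has_vector_derivative has_vector_derivative_at_within)
      qed simp
      then have "integral (cbox 0 1) (\<lambda>t. L x t v) = th (c x 1) v"
        by (simp add: integral_unique)
      ultimately show ?thesis by (simp add: c_def)
    qed
    then have "blinfun_apply (integral (cbox 0 1) (L x)) = th x" by blast
    ultimately show ?thesis unfolding at_within_open[OF x W(1)] by (simp only:)
  qed
  show ?thesis
    by (rule that[OF smooth_on_if_D[OF W(1) f sm] f]; assumption)
qed

subsection \<open>Local diffeomorphisms\<close>

text \<open>A left inverse of the derivative at \<open>a\<close> and continuity of the derivative
  give injectivity on a ball. Equality of dimensions makes the map open by invariance of domain, so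
  its inverse is continuous, and then differentiable with derivative \<open>H x\<close>.\<close>

lemma local_inverse:
  fixes F :: "'e::euclidean_space \<Rightarrow> 'f::euclidean_space"
  assumes W: "open W" "a \<in> W" and dim: "DIM('e) = DIM('f)" and F: "smooth_on W F"
    and H: "\<And>x. x \<in> W \<Longrightarrow> linear (H x)" "\<And>x. x \<in> W \<Longrightarrow> H x \<circ> D F x = id"
  obtains r where "r > 0" "ball a r \<subseteq> W" "inj_on F (ball a r)" "open (F ` ball a r)"
    "\<And>S. open S \<Longrightarrow> S \<subseteq> ball a r \<Longrightarrow> open (F ` S)"
    "\<And>x. x \<in> ball a r \<Longrightarrow> (inv_into (ball a r) F has_derivative H x) (at (F x))"
proof -
  define F' where "F' x = Blinfun (D F x)" for x
  have dF: "(F has_derivative D F x) (at x)" if "x \<in> W" for x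
    by (rule has_derivative_D[OF smooth_on_differentiable[OF F that]])
  have F': "blinfun_apply (F' x) = D F x" if "x \<in> W" for x
    unfolding F'_def
    by (rule bounded_linear_Blinfun_apply) (rule has_derivative_bounded_linear[OF dF[OF that]])
  have "continuous_on W F'"
  proof (rule continuous_on_blinfun_componentwise)
    fix i :: 'e
    have "continuous_on W (\<lambda>x. D F x i)" by (rule smooth_on_continuous[OF smooth_on_D1[OF F]])
    then show "continuous_on W (\<lambda>x. blinfun_apply (F' x) i)"
      using F' by (simp cong: continuous_on_cong)
  qed
  then have cont: "isCont F' a" using W by (simp add: continuous_on_eq_continuous_at)
  obtain r where r: "r > 0" "ball a r \<subseteq> W" "inj_on F (ball a r)"
  proof (rule has_derivative_locally_injective[OF W(2,1), of "H a" "D F" F])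
    show "bounded_linear (H a)" using H(1)[OF W(2)] by (simp add: linear_conv_bounded_linear)
    show "\<exists>d>0. \<forall>x. dist a x < d \<longrightarrow> onorm (\<lambda>v. D F x v - D F a v) < e" if e: "e > 0" for e
    proof -
      obtain d1 where d1: "d1 > 0" "\<And>x. dist x a < d1 \<Longrightarrow> dist (F' x) (F' a) < e"
        using cont e unfolding continuous_at_eps_delta by blast
      obtain d2 where d2: "d2 > 0" "ball a d2 \<subseteq> W" using W open_contains_ball by blast
      have "onorm (\<lambda>v. D F x v - D F a v) < e" if x: "dist a x < min d1 d2" for x
      proof -
        have "x \<in> W" using d2 x by auto
        then have "onorm (\<lambda>v. D F x v - D F a v) = norm (F' x - F' a)"
          by (simp add: norm_blinfun.rep_eq F' W(2) minus_blinfun.rep_eq)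
        then show ?thesis using d1(2)[of x] x by (simp add: dist_norm norm_minus_commute)
      qed
      then show ?thesis using d1(1) d2(1) by (intro exI[of _ "min d1 d2"]) auto
    qed
  qed (use H W dF in auto)
  have contF: "continuous_on (ball a r) F"
    using smooth_on_continuous[OF F] r(2) continuous_on_subset by blast
  have op: "open (F ` S)" if "open S" "S \<subseteq> ball a r" for S
    by (rule invariance_of_domain_gen)
      (use that dim contF r(3) continuous_on_subset inj_on_subset in auto)
  have opF: "open (F ` ball a r)" by (rule op) auto
  let ?G = "inv_into (ball a r) F"
  have contG: "continuous_on (F ` ball a r) ?G"
    by (rule continuous_on_inverse_open) (use contF dim r(3) in auto)
  have "(?G has_derivative H x) (at (F x))" if x: "x \<in> ball a r" for x
  proof (rule has_derivative_inverse_basic[of F "D F x"])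
    show "(F has_derivative D F x) (at (?G (F x)))" using dF[of x] r x by (simp add: subset_iff)
    show "bounded_linear (H x)" using H(1)[of x] x r(2) by (auto simp: linear_conv_bounded_linear)
    show "H x \<circ> D F x = id" using H(2)[of x] x r(2) by auto
    show "continuous (at (F x)) ?G"
      using contG opF x by (simp add: continuous_on_eq_continuous_at)
    show "F (?G z) = z" if "z \<in> F ` ball a r" for z using that by (rule f_inv_into_f)
  qed (use opF x in auto)
  then show ?thesis using that[OF r opF op] by blast
qed

section \<open>Riemannian geometry in an orthonormal frame\<close>

lemma bilinear_linear_left: "bilinear T \<Longrightarrow> linear (\<lambda>u. T u w)"
  by (simp add: bilinear_def)

lemma bilinear_linear_right: "bilinear T \<Longrightarrow> linear (T u)"
  by (simp add: bilinear_def)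

lemma bilinear_sum_left:
  "bilinear T \<Longrightarrow> T (\<Sum>i\<in>I. c i *\<^sub>R X i) w = (\<Sum>i\<in>I. c i *\<^sub>R T (X i) w)"
  by (simp add: linear_sum[OF bilinear_linear_left] bilinear_lmul)

lemma bilinear_sum_right:
  "bilinear T \<Longrightarrow> T w (\<Sum>i\<in>I. c i *\<^sub>R X i) = (\<Sum>i\<in>I. c i *\<^sub>R T w (X i))"
  by (simp add: linear_sum[OF bilinear_linear_right] bilinear_rmul)

lemmas bilinear_simps = bilinear_ladd bilinear_radd bilinear_lsub bilinear_rsub bilinear_lmul
  bilinear_rmul bilinear_lneg bilinear_rneg bilinear_lzero bilinear_rzero

locale orthonormal_frame =
  fixes W :: "(real ^ 'n::finite) set" and g :: "(real ^ 'n) form2"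
    and E :: "'n \<Rightarrow> (real ^ 'n) vec_field"
  assumes open_W: "open W"
    and bil: "x \<in> W \<Longrightarrow> bilinear (g x)"
    and sym: "x \<in> W \<Longrightarrow> g x v w = g x w v"
    and smooth_g: "smooth_on W (\<lambda>x. g x v w)"
    and smooth_E: "smooth_on W (E i)"
    and orth: "x \<in> W \<Longrightarrow> g x (E i x) (E j x) = (if i = j then 1 else 0)"
begin

lemma g_sum_left: "x \<in> W \<Longrightarrow> g x (\<Sum>i\<in>I. c i *\<^sub>R X i) w = (\<Sum>i\<in>I. c i * g x (X i) w)"
  by (simp add: bilinear_sum_left[OF bil])

lemma g_frame_sum: "x \<in> W \<Longrightarrow> g x (\<Sum>i\<in>UNIV. c i *\<^sub>R E i x) (E j x) = c j"
  by (simp add: g_sum_left orth if_distrib cong: if_cong)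

text \<open>Orthonormality shows that taking components is onto. Frame and coordinates share their
  index type, so this is a surjective endomorphism of a finite-dimensional space and therefore
  injective.\<close>

lemma frame_expand:
  assumes x: "x \<in> W"
  shows "v = (\<Sum>i\<in>UNIV. g x v (E i x) *\<^sub>R E i x)"
proof -
  define T where "T v = (\<chi> i. g x v (E i x))" for v
  have lin: "linear T"
    unfolding T_def using bil[OF x]
    by (simp add: linear_iff vec_eq_iff bilinear_ladd bilinear_lmul)
  have "surj T"
  proof (rule surjI)
    fix c show "T (\<Sum>i\<in>UNIV. (c $ i) *\<^sub>R E i x) = c" by (simp add: T_def vec_eq_iff g_frame_sum[OF x])
  qed
  then have "inj T" using lin linear_surjective_imp_injective by blast
  moreover have "T v = T (\<Sum>i\<in>UNIV. g x v (E i x) *\<^sub>R E i x)"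
    by (simp add: T_def vec_eq_iff g_frame_sum[OF x])
  ultimately show ?thesis by (simp add: inj_eq)
qed

lemma frame_eqI:
  assumes "x \<in> W" "\<And>i. g x v (E i x) = g x w (E i x)"
  shows "v = w"
proof -
  have "(\<Sum>i\<in>UNIV. g x v (E i x) *\<^sub>R E i x) = (\<Sum>i\<in>UNIV. g x w (E i x) *\<^sub>R E i x)"
    using assms(2) by simp
  then show ?thesis by (simp only: frame_expand[OF assms(1), symmetric])
qed

lemma g_eqI: "x \<in> W \<Longrightarrow> (\<And>u. g x v u = g x w u) \<Longrightarrow> v = w"
  by (rule frame_eqI)

text \<open>Independence of the trace from the basis: each standard basis vector is expanded in the
  frame, and after exchanging the sums the standard basis contracts away.\<close>

lemma trace_frame:
  assumes x: "x \<in> W" and F: "linear F"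
  shows "trace_endo F = (\<Sum>i\<in>UNIV. g x (F (E i x)) (E i x))"
proof -
  have "F b = (\<Sum>i\<in>UNIV. g x b (E i x) *\<^sub>R F (E i x))" for b
    by (rule trans[OF arg_cong[OF frame_expand[OF x, of b], of F]])
      (simp add: linear_sum[OF F] linear_scale[OF F])
  then have "F b \<bullet> b = (\<Sum>i\<in>UNIV. g x b (E i x) *\<^sub>R F (E i x)) \<bullet> b" for b
    by (rule arg_cong)
  then have "trace_endo F = (\<Sum>b\<in>Basis. (\<Sum>i\<in>UNIV. g x b (E i x) *\<^sub>R F (E i x)) \<bullet> b)"
    unfolding trace_endo_def by (intro sum.cong refl)
  also have "\<dots> = (\<Sum>i\<in>UNIV. \<Sum>b\<in>Basis. (F (E i x) \<bullet> b) * g x b (E i x))"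
    by (subst sum.swap) (simp add: inner_sum_left mult.commute)
  also have "\<dots> = (\<Sum>i\<in>UNIV. g x (F (E i x)) (E i x))"
  proof (rule sum.cong[OF refl])
    fix i
    show "(\<Sum>b\<in>Basis. (F (E i x) \<bullet> b) * g x b (E i x)) = g x (F (E i x)) (E i x)"
      unfolding linear_basis_expand[OF bilinear_linear_left[OF bil[OF x]], of "F (E i x)"] by simp
  qed
  finally show ?thesis .
qed

lemma diff_W: "smooth_on W f \<Longrightarrow> x \<in> W \<Longrightarrow> f differentiable (at x)"
  by (rule smooth_on_differentiable)

lemma smooth_g_fields: "smooth_on W X \<Longrightarrow> smooth_on W Y \<Longrightarrow> smooth_on W (\<lambda>x. g x (X x) (Y x))"
  by (rule smooth_on_apply2[OF open_W bil smooth_g])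

subsection \<open>The Levi-Civita connection\<close>

definition dg :: "real ^ 'n \<Rightarrow> real ^ 'n \<Rightarrow> real ^ 'n \<Rightarrow> real ^ 'n \<Rightarrow> real" where
  "dg x u v w = D (\<lambda>y. g y v w) x u"

lemma linear_dg:
  assumes x: "x \<in> W"
  shows "linear (\<lambda>u. dg x u v w)" "linear (\<lambda>v. dg x u v w)" "linear (\<lambda>w. dg x u v w)"
proof -
  note d = diff_W[OF smooth_g x]
  show "linear (\<lambda>u. dg x u v w)" unfolding dg_def by (rule linear_D[OF d])
  show "linear (\<lambda>v. dg x u v w)"
    unfolding dg_def by (rule linear_D_arg[OF open_W x bilinear_linear_left[OF bil] d])
  show "linear (\<lambda>w. dg x u v w)"
    unfolding dg_def by (rule linear_D_arg[OF open_W x bilinear_linear_right[OF bil] d])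
qed

text \<open>The Koszul formula on constant fields, whose brackets vanish; these are the Christoffel
  symbols of the first kind.\<close>

definition koszul :: "real ^ 'n \<Rightarrow> real ^ 'n \<Rightarrow> real ^ 'n \<Rightarrow> real ^ 'n \<Rightarrow> real" where
  "koszul x u v w = (dg x u v w + dg x v u w - dg x w u v) / 2"

lemma dg_sym: "x \<in> W \<Longrightarrow> dg x u v w = dg x u w v"
  unfolding dg_def by (rule D_cong[OF open_W]) (auto simp: sym intro: diff_W[OF smooth_g])

lemma linear_koszul:
  assumes x: "x \<in> W"
  shows "linear (\<lambda>u. koszul x u v w)" "linear (\<lambda>v. koszul x u v w)" "linear (\<lambda>w. koszul x u v w)"
  unfolding koszul_def
  by (rule linearI; simp add: linear_add[OF linear_dg(1)[OF x]] linear_add[OF linear_dg(2)[OF x]]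
      linear_add[OF linear_dg(3)[OF x]] linear_scale[OF linear_dg(1)[OF x]]
      linear_scale[OF linear_dg(2)[OF x]] linear_scale[OF linear_dg(3)[OF x]] field_simps)+

lemma koszul_frame:
  assumes x: "x \<in> W"
  shows "g x (\<Sum>i\<in>UNIV. koszul x u v (E i x) *\<^sub>R E i x) w = koszul x u v w"
proof -
  have "koszul x u v w = koszul x u v (\<Sum>i\<in>UNIV. g x w (E i x) *\<^sub>R E i x)"
    by (rule arg_cong[OF frame_expand[OF x]])
  also have "\<dots> = (\<Sum>i\<in>UNIV. g x w (E i x) * koszul x u v (E i x))"
    using linear_koszul(3)[OF x] by (simp add: linear_sum linear_scale)
  finally show ?thesis by (simp add: g_sum_left[OF x] sym[OF x, of w] mult.commute)
qed

lemma koszul_connection: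
  assumes x: "x \<in> W"
  defines "G \<equiv> \<lambda>u v. \<Sum>i\<in>UNIV. koszul x u v (E i x) *\<^sub>R E i x"
  shows "bilinear G" "G u v = G v u" "D (\<lambda>y. g y v w) x u = g x (G u v) w + g x v (G u w)"
proof -
  have "linear (\<lambda>u. G u v)" "linear (\<lambda>v. G u v)" for u v
    using linear_koszul(1,2)[OF x]
    by (simp_all add: G_def linear_iff scaleR_add_left sum.distrib scaleR_sum_right)
  then show "bilinear G" by (simp add: bilinear_def)
  show "G u v = G v u"
    by (simp add: G_def koszul_def dg_sym[OF x, of _ u v] add.commute)
  have "koszul x u v w + koszul x u w v = dg x u v w"
    by (simp add: koszul_def dg_sym[OF x, of u w v] dg_sym[OF x, of v w u] dg_sym[OF x, of w v u]
        field_simps)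
  then show "D (\<lambda>y. g y v w) x u = g x (G u v) w + g x v (G u w)"
    using koszul_frame[OF x] sym[OF x, of v "G u w"] by (simp add: G_def dg_def)
qed

text \<open>Existence and uniqueness of the Levi-Civita connection, which give the definite
  description its value. For uniqueness, the alternating combination of three metric conditions and
  the symmetry of \<open>G\<close> leave only \<open>g x (G u v) w\<close>.\<close>

lemma christoffel_eq:
  assumes x: "x \<in> W"
  shows "christoffel g x = (\<lambda>u v. \<Sum>i\<in>UNIV. koszul x u v (E i x) *\<^sub>R E i x)"
  unfolding christoffel_def
proof (rule the_equality)
  fix G
  assume G: "bilinear G \<and> (\<forall>u v. G u v = G v u) \<and>
    (\<forall>u v w. D (\<lambda>y. g y v w) x u = g x (G u v) w + g x v (G u w))"
  have d: "dg x a b c = g x (G a b) c + g x (G a c) b" for a b c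
    using G sym[OF x, of b] by (simp add: dg_def)
  have "g x (G u v) w = koszul x u v w" for u v w
  proof -
    have "G v u = G u v" "G w u = G u w" "G w v = G v w" using G by blast+
    then show ?thesis by (simp add: koszul_def d)
  qed
  then show "G = (\<lambda>u v. \<Sum>i\<in>UNIV. koszul x u v (E i x) *\<^sub>R E i x)"
    by (intro ext g_eqI[OF x]) (simp add: koszul_frame[OF x])
qed (use koszul_connection[OF x] in blast)

lemma christoffel_bilinear: "x \<in> W \<Longrightarrow> bilinear (christoffel g x)"
  and christoffel_sym: "x \<in> W \<Longrightarrow> christoffel g x u v = christoffel g x v u"
  and christoffel_metric: "x \<in> W \<Longrightarrow>
    D (\<lambda>y. g y v w) x u = g x (christoffel g x u v) w + g x v (christoffel g x u w)"
  unfolding christoffel_eq using koszul_connection by blast+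

lemma smooth_christoffel: "smooth_on W (\<lambda>x. christoffel g x u v)"
proof -
  have "smooth_on W (\<lambda>x. D (\<lambda>y. g y v (E i x)) x u)" for u v i
    using smooth_on_apply[OF open_W, of "\<lambda>x w. dg x u v w" "E i"] linear_dg(3) smooth_E
    by (simp add: dg_def smooth_on_D1[OF smooth_g])
  then have "smooth_on W (\<lambda>x. koszul x u v (E i x))" for i
    unfolding koszul_def dg_def divide_inverse
    by (intro smooth_on_mult smooth_on_const smooth_on_add smooth_on_diff
        smooth_on_D[OF _ smooth_g] open_W smooth_E) auto
  then have "smooth_on W (\<lambda>x. \<Sum>i\<in>UNIV. koszul x u v (E i x) *\<^sub>R E i x)"
    by (intro smooth_on_sum smooth_on_scaleR open_W smooth_E)
  then show ?thesis by (subst smooth_on_cong[OF open_W]) (auto simp: christoffel_eq)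
qed

lemma smooth_nabla:
  assumes "smooth_on W X" "smooth_on W Y"
  shows "smooth_on W (nabla g X Y)"
  unfolding nabla_def
  by (intro smooth_on_add smooth_on_D open_W assms
      smooth_on_apply2[OF open_W christoffel_bilinear smooth_christoffel])

lemma nabla_metric:
  assumes x: "x \<in> W" and Y: "Y differentiable (at x)" and Z: "Z differentiable (at x)"
  shows "D (\<lambda>y. g y (Y y) (Z y)) x (X x) = g x (nabla g X Y x) (Z x) + g x (Y x) (nabla g X Z x)"
  using D_apply2(2)[OF open_W x bil diff_W[OF smooth_g x] Y Z]
  by (simp add: nabla_def christoffel_metric[OF x] bilinear_simps[OF bil[OF x]])

lemma nabla_torsion: "x \<in> W \<Longrightarrow> lie_bracket X Y x = nabla g X Y x - nabla g Y X x"
  by (simp add: nabla_def lie_bracket_def christoffel_sym)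

lemma nabla_cong:
  assumes x: "x \<in> W" and "X x = X' x" "\<And>y. y \<in> W \<Longrightarrow> Y y = Y' y" "Y differentiable (at x)"
  shows "nabla g X Y x = nabla g X' Y' x"
  unfolding nabla_def using D_cong[OF open_W x assms(3,4)] assms by simp

lemma nabla_sum_right:
  assumes x: "x \<in> W" and c: "\<And>k. k \<in> I \<Longrightarrow> c k differentiable (at x)"
    and Y: "\<And>k. k \<in> I \<Longrightarrow> Y k differentiable (at x)"
  shows "nabla g X (\<lambda>y. \<Sum>k\<in>I. c k y *\<^sub>R Y k y) x =
    (\<Sum>k\<in>I. D (c k) x (X x) *\<^sub>R Y k x + c k x *\<^sub>R nabla g X (Y k) x)"
proof -
  have d: "(\<lambda>y. c k y *\<^sub>R Y k y) differentiable (at x)" if "k \<in> I" for k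
    using c[OF that] Y[OF that] by simp
  have "D (\<lambda>y. \<Sum>k\<in>I. c k y *\<^sub>R Y k y) x (X x) =
      (\<Sum>k\<in>I. c k x *\<^sub>R D (Y k) x (X x) + D (c k) x (X x) *\<^sub>R Y k x)"
    using D_sum[of I "\<lambda>k y. c k y *\<^sub>R Y k y", OF d] by (simp add: D_scaleR[OF c Y])
  moreover have "christoffel g x (X x) (\<Sum>k\<in>I. c k x *\<^sub>R Y k x) =
      (\<Sum>k\<in>I. c k x *\<^sub>R christoffel g x (X x) (Y k x))"
    using bilinear_linear_right[OF christoffel_bilinear[OF x]]
    by (simp add: linear_sum linear_scale)
  ultimately show ?thesis
    by (simp add: nabla_def scaleR_add_right sum.distrib algebra_simps)
qed

lemma nabla_sum_left:
  assumes x: "x \<in> W" and Y: "Y differentiable (at x)"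
    and X: "X x = (\<Sum>k\<in>I. c k *\<^sub>R Z k x)"
  shows "nabla g X Y x = (\<Sum>k\<in>I. c k *\<^sub>R nabla g (Z k) Y x)"
  unfolding nabla_def X
  by (simp add: linear_sum[OF bilinear_linear_left[OF christoffel_bilinear[OF x]]]
      linear_sum[OF linear_D[OF Y]] linear_scale[OF linear_D[OF Y]]
      bilinear_lmul[OF christoffel_bilinear[OF x]] scaleR_add_right sum.distrib)

subsection \<open>Curvature\<close>

text \<open>Tensoriality of the curvature: second derivatives of \<open>Z\<close> cancel by
  symmetry, and derivatives of \<open>X\<close> and \<open>Y\<close> cancel against the bracket
  term, so only the values of the fields at \<open>x\<close> enter.\<close>

lemma riemann_eq:
  assumes x: "x \<in> W" and X: "smooth_on W X" and Y: "smooth_on W Y" and Z: "smooth_on W Z"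
  shows "riemann g X Y Z x =
    D (\<lambda>y. christoffel g y (Y x) (Z x)) x (X x) - D (\<lambda>y. christoffel g y (X x) (Z x)) x (Y x)
    + christoffel g x (X x) (christoffel g x (Y x) (Z x))
    - christoffel g x (Y x) (christoffel g x (X x) (Z x))"
proof -
  note bil = christoffel_bilinear[OF x]
  have n: "nabla g X (nabla g Y Z) x =
      D (\<lambda>y. D Z y (Y x)) x (X x) + D Z x (D Y x (X x))
      + (D (\<lambda>y. christoffel g y (Y x) (Z x)) x (X x) + christoffel g x (D Y x (X x)) (Z x)
        + christoffel g x (Y x) (D Z x (X x)))
      + christoffel g x (X x) (D Z x (Y x)) + christoffel g x (X x) (christoffel g x (Y x) (Z x))"
    if X: "smooth_on W X" and Y: "smooth_on W Y" for X Y
  proof -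
    note 1 = D_apply[OF open_W x linear_D[OF smooth_on_differentiable[OF Z]]
        smooth_on_differentiable[OF smooth_on_D1[OF Z] x] smooth_on_differentiable[OF Y x]]
    note 2 = D_apply2[OF open_W x christoffel_bilinear smooth_on_differentiable[OF smooth_christoffel x]
        smooth_on_differentiable[OF Y x] smooth_on_differentiable[OF Z x]]
    show ?thesis
      unfolding nabla_def
      using 1 2 by (simp add: D_add bilinear_simps[OF bil])
  qed
  show ?thesis
    unfolding riemann_def n[OF X Y] n[OF Y X]
    unfolding nabla_def lie_bracket_def
    using D_D_commute[OF open_W x Z, of "Y x" "X x"] linear_D[OF smooth_on_differentiable[OF Z x]]
    by (simp add: linear_diff bilinear_simps[OF bil])
qed

lemma riemann_K:
  assumes x: "x \<in> W" and "smooth_on W X" "smooth_on W Y" "smooth_on W Z"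
  shows "riemann g (K (X x)) (K (Y x)) (K (Z x)) x = riemann g X Y Z x"
  using riemann_eq[OF assms] riemann_eq[OF x smooth_on_const smooth_on_const smooth_on_const]
  by simp

lemma riemann_bianchi:
  assumes x: "x \<in> W"
  shows "riemann g (K a) (K b) (K c) x + riemann g (K b) (K c) (K a) x
    + riemann g (K c) (K a) (K b) x = 0"
proof -
  have "D (\<lambda>y. christoffel g y u v) x w = D (\<lambda>y. christoffel g y v u) x w" for u v w
    by (rule D_cong[OF open_W x]) (auto simp: christoffel_sym intro: diff_W[OF smooth_christoffel x])
  then show ?thesis
    unfolding riemann_eq[OF x smooth_on_const smooth_on_const smooth_on_const]
    by (simp add: christoffel_sym[OF x, of a b] christoffel_sym[OF x, of a c]
        christoffel_sym[OF x, of b c])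
qed

lemma linear_D_christoffel:
  assumes x: "x \<in> W"
  shows "linear (\<lambda>a. D (\<lambda>y. christoffel g y a c) x b)" "linear (\<lambda>c. D (\<lambda>y. christoffel g y a c) x b)"
proof -
  show "linear (\<lambda>a. D (\<lambda>y. christoffel g y a c) x b)"
    by (rule linear_D_arg[OF open_W x bilinear_linear_left[OF christoffel_bilinear]
          diff_W[OF smooth_christoffel x]])
  show "linear (\<lambda>c. D (\<lambda>y. christoffel g y a c) x b)"
    by (rule linear_D_arg[OF open_W x bilinear_linear_right[OF christoffel_bilinear]
          diff_W[OF smooth_christoffel x]])
qed

lemma linear_riemann:
  assumes x: "x \<in> W"
  shows "linear (\<lambda>a. riemann g (K a) (K b) (K c) x)" "linear (\<lambda>b. riemann g (K a) (K b) (K c) x)"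
    "linear (\<lambda>c. riemann g (K a) (K b) (K c) x)"
  unfolding riemann_eq[OF x smooth_on_const smooth_on_const smooth_on_const]
  by (rule linearI; simp add: linear_add[OF linear_D[OF diff_W[OF smooth_christoffel x]]]
      linear_scale[OF linear_D[OF diff_W[OF smooth_christoffel x]]]
      linear_add[OF linear_D_christoffel(1)[OF x]] linear_scale[OF linear_D_christoffel(1)[OF x]]
      linear_add[OF linear_D_christoffel(2)[OF x]] linear_scale[OF linear_D_christoffel(2)[OF x]]
      bilinear_simps[OF christoffel_bilinear[OF x]] algebra_simps)+

lemma smooth_riemann: "smooth_on W (\<lambda>x. riemann g (K a) (K b) (K c) x)"
proof -
  have lin: "linear (christoffel g x u)" if "x \<in> W" for x u
    using bilinear_linear_right[OF christoffel_bilinear[OF that]] .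
  have "smooth_on W (\<lambda>x. D (\<lambda>y. christoffel g y b c) x a - D (\<lambda>y. christoffel g y a c) x b
      + christoffel g x a (christoffel g x b c) - christoffel g x b (christoffel g x a c))"
    by (intro smooth_on_add smooth_on_diff smooth_on_D1 open_W smooth_christoffel
        smooth_on_apply[OF open_W lin smooth_christoffel smooth_christoffel])
  then show ?thesis
    by (subst smooth_on_cong[OF open_W])
      (auto simp: riemann_eq[OF _ smooth_on_const smooth_on_const smooth_on_const])
qed

lemma ricci_frame:
  "x \<in> W \<Longrightarrow> ricci g x v w = (\<Sum>i\<in>UNIV. g x (riemann g (K (E i x)) (K v) (K w) x) (E i x))"
  unfolding ricci_def by (rule trace_frame[OF _ linear_riemann(1)])

lemma ricci_bilinear: "x \<in> W \<Longrightarrow> bilinear (ricci g x)"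
  unfolding bilinear_def
  by (auto intro!: linearI simp: ricci_frame linear_add[OF linear_riemann(2)]
      linear_scale[OF linear_riemann(2)] linear_add[OF linear_riemann(3)]
      linear_scale[OF linear_riemann(3)] bilinear_simps[OF bil] sum.distrib sum_distrib_left)

lemma smooth_ricci: "smooth_on W (\<lambda>x. ricci g x v w)"
  unfolding ricci_def trace_endo_def
  by (intro smooth_on_sum smooth_on_inner smooth_on_const smooth_riemann open_W)

lemma ricci_op_eq:
  assumes x: "x \<in> W"
  shows "ricci_op g x v = (\<Sum>i\<in>UNIV. ricci g x v (E i x) *\<^sub>R E i x)"
  unfolding ricci_op_def
proof (rule the_equality)
  have "g x (\<Sum>i\<in>UNIV. ricci g x v (E i x) *\<^sub>R E i x) w = ricci g x v w" for w
  proof -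
    have "ricci g x v w = ricci g x v (\<Sum>i\<in>UNIV. g x w (E i x) *\<^sub>R E i x)"
      by (rule arg_cong[OF frame_expand[OF x]])
    also have "\<dots> = (\<Sum>i\<in>UNIV. g x w (E i x) * ricci g x v (E i x))"
      by (simp add: linear_sum[OF bilinear_linear_right[OF ricci_bilinear[OF x]]]
        linear_scale[OF bilinear_linear_right[OF ricci_bilinear[OF x]]])
    finally show ?thesis
      by (simp add: g_sum_left[OF x] sym[OF x, of "E _ x" w] mult.commute)
  qed
  then show *: "\<forall>w. ricci g x v w = g x (\<Sum>i\<in>UNIV. ricci g x v (E i x) *\<^sub>R E i x) w"
    by simp
  show "u = (\<Sum>i\<in>UNIV. ricci g x v (E i x) *\<^sub>R E i x)" if "\<forall>w. ricci g x v w = g x u w" for u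
    by (rule g_eqI[OF x]) (use that * in metis)
qed

lemma ricci_op_frame: "x \<in> W \<Longrightarrow> g x (ricci_op g x v) (E i x) = ricci g x v (E i x)"
  by (simp add: ricci_op_eq g_frame_sum)

lemma scalar_curv_frame: "x \<in> W \<Longrightarrow> scalar_curv g x = (\<Sum>i\<in>UNIV. ricci g x (E i x) (E i x))"
proof -
  assume x: "x \<in> W"
  have "linear (ricci_op g x)"
    unfolding ricci_op_eq[OF x]
    by (rule linearI) (simp_all add: bilinear_simps[OF ricci_bilinear[OF x]] scaleR_add_left
        sum.distrib scaleR_sum_right)
  then show ?thesis unfolding scalar_curv_def by (simp add: trace_frame[OF x] ricci_op_frame[OF x])
qed

subsection \<open>Connection coefficients\<close>

text \<open>The indices are direction, differentiated field and component, in this order.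
  Orthonormality makes the coefficients antisymmetric in the last two.\<close>

definition om :: "'n \<Rightarrow> 'n \<Rightarrow> 'n \<Rightarrow> real ^ 'n \<Rightarrow> real" where
  "om i j k x = g x (nabla g (E i) (E j) x) (E k x)"

lemma smooth_om: "smooth_on W (om i j k)"
  unfolding om_def by (intro smooth_g_fields smooth_nabla smooth_E)

lemma nabla_E: "x \<in> W \<Longrightarrow> nabla g (E i) (E j) x = (\<Sum>k\<in>UNIV. om i j k x *\<^sub>R E k x)"
  unfolding om_def by (rule frame_expand)

lemma om_antisym:
  assumes x: "x \<in> W"
  shows "om i j k x = - om i k j x"
proof -
  have "D (\<lambda>y. g y (E j y) (E k y)) x (E i x) = D (\<lambda>y. if j = k then 1 else 0 :: real) x (E i x)"
    by (rule D_cong[OF open_W x]) (auto simp: orth intro: diff_W[OF smooth_g_fields[OF smooth_E smooth_E] x])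
  then have "g x (nabla g (E i) (E j) x) (E k x) + g x (E j x) (nabla g (E i) (E k) x) = 0"
    using nabla_metric[OF x diff_W[OF smooth_E x] diff_W[OF smooth_E x]] by simp
  then show ?thesis by (simp add: om_def sym[OF x, of "E j x"])
qed

lemma om_diag: "x \<in> W \<Longrightarrow> om i j j x = 0"
  using om_antisym[of x i j j] by simp

lemma lie_bracket_E:
  "x \<in> W \<Longrightarrow> lie_bracket (E i) (E j) x = (\<Sum>m\<in>UNIV. (om i j m x - om j i m x) *\<^sub>R E m x)"
  by (simp add: nabla_torsion nabla_E scaleR_diff_left sum_subtractf)

text \<open>Symmetry of second derivatives leaves only the bracket of the two fields. This is the
  integrability condition applied later to \<open>q\<close> and to the components of
  \<open>V\<close>.\<close>

lemma D_commutator: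
  fixes f :: "real ^ 'n \<Rightarrow> real"
  assumes x: "x \<in> W" and f: "smooth_on W f"
  shows "D (\<lambda>y. D f y (E j y)) x (E i x) - D (\<lambda>y. D f y (E i y)) x (E j x)
    = (\<Sum>m\<in>UNIV. (om i j m x - om j i m x) * D f x (E m x))"
proof -
  note lin = linear_D[OF diff_W[OF f x]]
  have 1: "D (\<lambda>y. D f y (E j y)) x v = D (\<lambda>y. D f y (E j x)) x v + D f x (D (E j) x v)" for j v
    using D_apply(2)[OF open_W x linear_D[OF diff_W[OF f]] diff_W[OF smooth_on_D1[OF f] x]
        diff_W[OF smooth_E x]] .
  have "D (\<lambda>y. D f y (E j y)) x (E i x) - D (\<lambda>y. D f y (E i y)) x (E j x)
      = D f x (lie_bracket (E i) (E j) x)"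
    unfolding 1 lie_bracket_def using D_D_commute[OF open_W x f, of "E i x" "E j x"]
    by (simp add: linear_diff[OF lin])
  then show ?thesis by (simp add: lie_bracket_E[OF x] linear_sum[OF lin] linear_scale[OF lin])
qed

section \<open>Curvature and tensor derivatives in frame components\<close>

definition rm :: "'n \<Rightarrow> 'n \<Rightarrow> 'n \<Rightarrow> 'n \<Rightarrow> real ^ 'n \<Rightarrow> real" where
  "rm i j k l x = g x (riemann g (K (E i x)) (K (E j x)) (K (E k x)) x) (E l x)"

text \<open>The second structure equation in components; the last sum comes from the bracket of
  \<open>E i\<close> and \<open>E j\<close>.\<close>

lemma rm_eq:
  assumes x: "x \<in> W"
  shows "rm i j k l x = D (om j k l) x (E i x) - D (om i k l) x (E j x)
    + (\<Sum>m\<in>UNIV. om j k m x * om i m l x) - (\<Sum>m\<in>UNIV. om i k m x * om j m l x)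
    - (\<Sum>m\<in>UNIV. (om i j m x - om j i m x) * om m k l x)"
proof -
  have n: "g x (nabla g (E i) (nabla g (E j) (E k)) x) (E l x) =
      D (om j k l) x (E i x) + (\<Sum>m\<in>UNIV. om j k m x * om i m l x)" for i j
  proof -
    have "nabla g (E i) (nabla g (E j) (E k)) x =
        nabla g (E i) (\<lambda>y. \<Sum>m\<in>UNIV. om j k m y *\<^sub>R E m y) x"
      by (rule nabla_cong[OF x refl nabla_E]) (auto intro: diff_W[OF smooth_nabla[OF smooth_E smooth_E] x])
    also have "\<dots> = (\<Sum>m\<in>UNIV. D (om j k m) x (E i x) *\<^sub>R E m x + om j k m x *\<^sub>R nabla g (E i) (E m) x)"
      by (rule nabla_sum_right[OF x]) (auto intro: diff_W smooth_om smooth_E x)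
    finally show ?thesis
      by (simp add: sum.distrib bilinear_ladd[OF bil[OF x]] g_sum_left[OF x] orth[OF x] om_def
          if_distrib cong: if_cong)
  qed
  have "g x (nabla g (lie_bracket (E i) (E j)) (E k) x) (E l x) =
      (\<Sum>m\<in>UNIV. (om i j m x - om j i m x) * om m k l x)"
    unfolding nabla_sum_left[where X = "lie_bracket (E i) (E j)" and Z = E and
        c = "\<lambda>m. om i j m x - om j i m x", OF x diff_W[OF smooth_E x] lie_bracket_E[OF x]]
    by (simp add: g_sum_left[OF x] om_def)
  then show ?thesis
    unfolding rm_def riemann_K[OF x smooth_E smooth_E smooth_E]
    unfolding riemann_def
    by (simp add: bilinear_lsub[OF bil[OF x]] n)
qed

lemma rm_bianchi: "x \<in> W \<Longrightarrow> rm i j k l x + rm j k i l x + rm k i j l x = 0"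
  unfolding rm_def
  by (simp add: riemann_bianchi bilinear_lzero[OF bil] flip: bilinear_ladd[OF bil])

lemma ricci_E: "x \<in> W \<Longrightarrow> ricci g x (E j x) (E k x) = (\<Sum>i\<in>UNIV. rm i j k i x)"
  by (simp add: ricci_frame rm_def)

text \<open>Tensoriality again: the Cotton tensor is evaluated on constant extensions, whereas the
  components of \<open>T\<close> are known along the frame. The derivatives of \<open>Y\<close> and
  \<open>Z\<close> cancel in the exchange.\<close>

lemma nabla_form2_K:
  assumes x: "x \<in> W" and T: "\<And>y. y \<in> W \<Longrightarrow> bilinear (T y)" "\<And>v w. smooth_on W (\<lambda>y. T y v w)"
    and Y: "smooth_on W Y" and Z: "smooth_on W Z"
  shows "nabla_form2 g T (K (X x)) (K (Y x)) (K (Z x)) x = nabla_form2 g T X Y Z x"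
  using D_apply2(2)[OF open_W x T(1) diff_W[OF T(2) x] diff_W[OF Y x] diff_W[OF Z x], of "X x"]
  by (simp add: nabla_form2_def nabla_def bilinear_simps[OF T(1)[OF x]])

lemma nabla_form2_E:
  assumes x: "x \<in> W" and T: "\<And>y. y \<in> W \<Longrightarrow> bilinear (T y)" "\<And>v w. smooth_on W (\<lambda>y. T y v w)"
  shows "nabla_form2 g T (K (E a x)) (K (E b x)) (K (E c x)) x =
    D (\<lambda>y. T y (E b y) (E c y)) x (E a x) - (\<Sum>m\<in>UNIV. om a b m x * T x (E m x) (E c x))
    - (\<Sum>m\<in>UNIV. om a c m x * T x (E b x) (E m x))"
proof -
  have "nabla_form2 g T (K (E a x)) (K (E b x)) (K (E c x)) x = nabla_form2 g T (E a) (E b) (E c) x"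
    by (rule nabla_form2_K[OF x T smooth_E smooth_E])
  then show ?thesis
    by (simp add: nabla_form2_def nabla_E[OF x] bilinear_sum_left[OF T(1)[OF x]]
        bilinear_sum_right[OF T(1)[OF x]])
qed

text \<open>Vanishing torsion turns the Lie derivative of the metric into the symmetrised covariant
  derivative of \<open>V\<close>, which is then expanded in the components \<open>f\<close> of
  \<open>V\<close>.\<close>

lemma lie_form2_E:
  assumes x: "x \<in> W" and V: "smooth_on W V"
  defines "f \<equiv> \<lambda>m y. g y (V y) (E m y)"
  shows "lie_form2 V g (K (E i x)) (K (E j x)) x =
    D (f j) x (E i x) + (\<Sum>m\<in>UNIV. f m x * om i m j x)
    + D (f i) x (E j x) + (\<Sum>m\<in>UNIV. f m x * om j m i x)"
proof -
  have df: "f m differentiable (at x)" for m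
    unfolding f_def by (rule diff_W[OF smooth_g_fields[OF V smooth_E] x])
  have "nabla g (E i) V x = nabla g (E i) (\<lambda>y. \<Sum>m\<in>UNIV. f m y *\<^sub>R E m y) x" for i
    unfolding f_def by (rule nabla_cong[OF x refl frame_expand diff_W[OF V x]])
  then have n: "g x (nabla g (E i) V x) (E j x) = D (f j) x (E i x) + (\<Sum>m\<in>UNIV. f m x * om i m j x)"
    for i j
    using nabla_sum_right[OF x, of UNIV f E "E i", OF df diff_W[OF smooth_E x]]
    by (simp add: sum.distrib bilinear_ladd[OF bil[OF x]] g_sum_left[OF x] orth[OF x] om_def
        if_distrib cong: if_cong)
  have "lie_form2 V g (K (E i x)) (K (E j x)) x =
      g x (nabla g (E i) V x) (E j x) + g x (E i x) (nabla g (E j) V x)"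
    unfolding lie_form2_def lie_bracket_def nabla_def christoffel_metric[OF x]
    by (simp add: bilinear_simps[OF bil[OF x]] christoffel_sym[OF x, of _ "V x"])
  then show ?thesis by (simp add: n sym[OF x, of "E i x"])
qed

text \<open>First structure equation: on constant fields the left side is the exterior derivative,
  without the factor 1/2, of the 1-form dual to \<open>E k\<close>.\<close>

lemma D_dual_frame:
  assumes x: "x \<in> W"
  shows "D (\<lambda>y. g y v (E k y)) x u - D (\<lambda>y. g y u (E k y)) x v
    = g x v (nabla g (K u) (E k) x) - g x u (nabla g (K v) (E k) x)"
  using nabla_metric[OF x _ diff_W[OF smooth_E x], of "K v" k "K u"]
    nabla_metric[OF x _ diff_W[OF smooth_E x], of "K u" k "K v"]
    christoffel_sym[OF x, of u v]
  by (simp add: nabla_def)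

lemma nabla_K_E: "x \<in> W \<Longrightarrow> nabla g (K u) (E k) x = (\<Sum>m\<in>UNIV. g x u (E m x) *\<^sub>R nabla g (E m) (E k) x)"
  by (rule nabla_sum_left[OF _ diff_W[OF smooth_E] frame_expand])

end

section \<open>Almost Kenmotsu 3-manifolds in an adapted frame\<close>

lemma lie_bracket_K: "lie_bracket (K u) (K v) x = 0" "lie_bracket X (K v) x = - D X x v"
  by (simp_all add: lie_bracket_def)

lemma h_tensor_eq:
  "h_tensor F X x v = (1/2) *\<^sub>R (D (\<lambda>y. F y v) x (X x) - D X x (F x v) - F x (- D X x v))"
  by (simp add: h_tensor_def lie_endo_def lie_bracket_def)

lemma linear_h_tensor:
  assumes W: "open W" "x \<in> W" and F: "\<And>y. y \<in> W \<Longrightarrow> linear (F y)" "\<And>v. smooth_on W (\<lambda>y. F y v)"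
    and X: "smooth_on W X"
  shows "linear (h_tensor F X x)"
proof -
  have "linear (\<lambda>v. D (\<lambda>y. F y v) x (X x))"
    by (rule linear_D_arg[OF W F(1) smooth_on_differentiable[OF F(2) W(2)]])
  note l = this F(1)[OF W(2)] linear_D[OF smooth_on_differentiable[OF X W(2)]]
  show ?thesis
    by (rule linearI; simp add: h_tensor_eq linear_neg[OF l(2)] linear_diff[OF l(2)] linear_add[OF l(1)]
        linear_add[OF l(2)] linear_add[OF l(3)] linear_scale[OF l(1)] linear_scale[OF l(2)]
        linear_scale[OF l(3)] algebra_simps)
qed

lemma smooth_h_tensor:
  assumes W: "open W" and F: "\<And>y. y \<in> W \<Longrightarrow> linear (F y)" "\<And>v. smooth_on W (\<lambda>y. F y v)"
    and X: "smooth_on W X"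
  shows "smooth_on W (\<lambda>y. h_tensor F X y v)"
  unfolding h_tensor_eq
  by (intro smooth_on_scaleR smooth_on_diff smooth_on_const smooth_on_D smooth_on_minus W F X
      smooth_on_apply[OF W F])

locale kenmotsu_frame = orthonormal_frame W g E
  for W :: "(real ^ 3) set" and g :: "(real ^ 3) form2" and E :: "3 \<Rightarrow> (real ^ 3) vec_field" +
  fixes \<phi> :: "(real ^ 3) endo_field" and \<eta> :: "(real ^ 3) one_form"
  assumes linear_phi: "x \<in> W \<Longrightarrow> linear (\<phi> x)"
    and smooth_phi: "smooth_on W (\<lambda>x. \<phi> x v)"
    and phi_E: "x \<in> W \<Longrightarrow> \<phi> x (E 1 x) = 0" "x \<in> W \<Longrightarrow> \<phi> x (E 2 x) = E 3 x"
      "x \<in> W \<Longrightarrow> \<phi> x (E 3 x) = - E 2 x"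
    and eta_eq: "x \<in> W \<Longrightarrow> \<eta> x v = g x v (E 1 x)"
    and d_eta: "x \<in> W \<Longrightarrow> ext_d1 \<eta> (K u) (K v) x = 0"
    and d_Phi: "x \<in> W \<Longrightarrow> ext_d2 (fund_form \<phi> g) (K u) (K v) (K w) x
      = 2 * wedge12 \<eta> (fund_form \<phi> g) x u v w"
begin

lemma expand_3:
  "x \<in> W \<Longrightarrow> v = g x v (E 1 x) *\<^sub>R E 1 x + g x v (E 2 x) *\<^sub>R E 2 x + g x v (E 3 x) *\<^sub>R E 3 x"
  using frame_expand[of x v] by (simp add: sum_3)

lemma orth_3:
  "x \<in> W \<Longrightarrow> g x (E 1 x) (E 1 x) = 1" "x \<in> W \<Longrightarrow> g x (E 2 x) (E 2 x) = 1"
  "x \<in> W \<Longrightarrow> g x (E 3 x) (E 3 x) = 1"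
  "x \<in> W \<Longrightarrow> g x (E 1 x) (E 2 x) = 0" "x \<in> W \<Longrightarrow> g x (E 1 x) (E 3 x) = 0"
  "x \<in> W \<Longrightarrow> g x (E 2 x) (E 1 x) = 0" "x \<in> W \<Longrightarrow> g x (E 2 x) (E 3 x) = 0"
  "x \<in> W \<Longrightarrow> g x (E 3 x) (E 1 x) = 0" "x \<in> W \<Longrightarrow> g x (E 3 x) (E 2 x) = 0"
  by (simp_all add: orth)

lemma phi_eq:
  assumes x: "x \<in> W"
  shows "\<phi> x v = g x v (E 2 x) *\<^sub>R E 3 x - g x v (E 3 x) *\<^sub>R E 2 x"
  by (rule trans[OF arg_cong[OF expand_3[OF x, of v], of "\<phi> x"]])
    (simp add: linear_add[OF linear_phi[OF x]] linear_scale[OF linear_phi[OF x]] phi_E[OF x])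

lemma frame_eqI_3:
  assumes "x \<in> W" "g x v (E 1 x) = g x w (E 1 x)" "g x v (E 2 x) = g x w (E 2 x)"
    "g x v (E 3 x) = g x w (E 3 x)"
  shows "v = w"
proof (rule frame_eqI[OF assms(1)])
  fix i show "g x v (E i x) = g x w (E i x)" using assms(2-4) exhaust_3[of i] by auto
qed

lemma linear_eqI_frame:
  fixes F G :: "real ^ 3 \<Rightarrow> 'v::real_vector"
  assumes x: "x \<in> W" and "linear F" "linear G" "F (E 1 x) = G (E 1 x)" "F (E 2 x) = G (E 2 x)"
    "F (E 3 x) = G (E 3 x)"
  shows "F v = G v"
proof -
  have *: "F v = g x v (E 1 x) *\<^sub>R F (E 1 x) + g x v (E 2 x) *\<^sub>R F (E 2 x) + g x v (E 3 x) *\<^sub>R F (E 3 x)"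
    if "linear F" for F :: "real ^ 3 \<Rightarrow> 'v"
    by (rule trans[OF arg_cong[OF expand_3[OF x, of v], of F]])
      (simp add: linear_add[OF that] linear_scale[OF that])
  show ?thesis unfolding *[OF assms(2)] *[OF assms(3)] assms(4-6) ..
qed

lemma D_eta:
  assumes x: "x \<in> W"
  shows "D (\<lambda>y. \<eta> y v) x u = D (\<lambda>y. g y v (E 1 y)) x u"
  by (rule D_cong[OF open_W x, symmetric])
    (auto simp: eta_eq intro: diff_W[OF smooth_g_fields[OF smooth_on_const smooth_E] x])

text \<open>By the first structure equation the antisymmetric part of \<nabla>\<xi> is the exterior
  derivative of \<eta>, which vanishes.\<close>

lemma om_1_sym:
  assumes x: "x \<in> W"
  shows "om i 1 j x = om j 1 i x"
proof -
  have "D (\<lambda>y. \<eta> y (E j x)) x (E i x) - D (\<lambda>y. \<eta> y (E i x)) x (E j x) = 0"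
    using d_eta[OF x, of "E i x" "E j x"] eta_eq[OF x, of 0] bil[OF x]
    by (simp add: ext_d1_def lie_bracket_K bilinear_lzero)
  then have "g x (E j x) (nabla g (K (E i x)) (E 1) x) = g x (E i x) (nabla g (K (E j x)) (E 1) x)"
    unfolding D_eta[OF x] using D_dual_frame[OF x] by simp
  moreover have "nabla g (K (E i x)) (E 1) x = nabla g (E i) (E 1) x" for i
    by (simp add: nabla_def)
  ultimately show ?thesis by (simp add: om_def sym[OF x, of "E _ x"])
qed

lemma om_11: "x \<in> W \<Longrightarrow> om 1 1 j x = 0"
  using om_1_sym[of x 1 j] om_diag[of x j 1] by simp

text \<open>The equation d\<Phi> = 2 \<eta> \<and> \<Phi> evaluated on the frame. The components of
  \<Phi> in the frame are constant, so its derivatives fall on the frame fields and combine with one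
  another into minus the divergence of \<xi>.\<close>

lemma om_1_trace:
  assumes x: "x \<in> W"
  shows "om 2 1 2 x + om 3 1 3 x = 2"
proof -
  define P where "P = fund_form \<phi> g"
  have P: "P y v w = g y w (E 2 y) * g y v (E 3 y) - g y w (E 3 y) * g y v (E 2 y)"
    if "y \<in> W" for y v w
    unfolding P_def fund_form_def phi_eq[OF that, of w]
    by (simp add: bilinear_simps[OF bil[OF that]])
  have bilP: "bilinear (P y)" if "y \<in> W" for y
    using linear_phi[OF that] bil[OF that]
    by (simp add: P_def fund_form_def bilinear_def linear_iff)
  have smP: "smooth_on W (\<lambda>y. P y v w)" for v w
    unfolding P_def fund_form_def by (intro smooth_g_fields smooth_on_const smooth_phi)
  note diffP = diff_W[OF smP x]
  have D: "D (\<lambda>y. P y (E i x) (E j x)) x u = - P x (D (E i) x u) (E j x) - P x (E i x) (D (E j) x u)"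
    if c: "\<And>y. y \<in> W \<Longrightarrow> P y (E i y) (E j y) = c" for i j c u
  proof -
    have "D (\<lambda>y. P y (E i y) (E j y)) x u = D (\<lambda>y. c) x u"
      by (rule D_cong[OF open_W x c]) (auto intro: D_apply2(1)[OF open_W x bilP diffP] diff_W smooth_E x)
    then show ?thesis
      using D_apply2(2)[OF open_W x bilP diffP diff_W[OF smooth_E x] diff_W[OF smooth_E x], of i j u]
      by simp
  qed
  \<comment> \<open>The constant is -1 because \<Phi>(e, \<phi> e) = g(e, \<phi>^2 e) = - g(e,
    e).\<close>
  have D1: "D (\<lambda>y. P y (E 2 x) (E 3 x)) x (E 1 x) = g x (D (E 2) x (E 1 x)) (E 2 x) + g x (D (E 3) x (E 1 x)) (E 3 x)"
    by (subst D[where c = "-1"]) (simp_all add: P orth_3 x)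
  have D2: "D (\<lambda>y. P y (E 3 x) (E 1 x)) x (E 2 x) = - g x (D (E 1) x (E 2 x)) (E 2 x)"
    by (subst D[where c = 0]) (simp_all add: P orth_3 x)
  have D3: "D (\<lambda>y. P y (E 1 x) (E 2 x)) x (E 3 x) = - g x (D (E 1) x (E 3 x)) (E 3 x)"
    by (subst D[where c = 0]) (simp_all add: P orth_3 x)
  have "g x (lie_bracket (E 1) (E j) x) (E j x) = - om j 1 j x" for j
    by (simp add: lie_bracket_E[OF x] g_frame_sum[OF x] om_diag[OF x])
  then have b: "g x (D (E j) x (E 1 x)) (E j x) - g x (D (E 1) x (E j x)) (E j x) = - om j 1 j x" for j
    by (simp add: lie_bracket_def bilinear_simps[OF bil[OF x]])
  have P0: "P x 0 w = 0" for w by (simp add: bilinear_lzero[OF bilP[OF x]])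
  have "ext_d2 P (K (E 1 x)) (K (E 2 x)) (K (E 3 x)) x = (1/3) * (- om 2 1 2 x - om 3 1 3 x)"
    unfolding ext_d2_def lie_bracket_K P0 D1 D2 D3 using b[of 2] b[of 3] by simp
  moreover have "wedge12 \<eta> P x (E 1 x) (E 2 x) (E 3 x) = - (1/3)"
    by (simp add: wedge12_def P[OF x] eta_eq[OF x] orth_3[OF x])
  ultimately show ?thesis
    using d_Phi[OF x, of "E 1 x" "E 2 x" "E 3 x"] by (simp flip: P_def)
qed

subsection \<open>The tensor h and normality\<close>

abbreviation h :: "(real ^ 3) endo_field" where
  "h \<equiv> h_tensor \<phi> (E 1)"

lemma linear_h: "x \<in> W \<Longrightarrow> linear (h x)"
  by (rule linear_h_tensor[OF open_W _ linear_phi smooth_phi smooth_E])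

lemma smooth_h: "smooth_on W (\<lambda>y. h y v)"
  by (rule smooth_h_tensor[OF open_W linear_phi smooth_phi smooth_E])

lemma D_phi:
  assumes x: "x \<in> W" and Y: "smooth_on W Y"
  shows "D (\<lambda>y. \<phi> y (Y x)) x u = D (\<lambda>y. \<phi> y (Y y)) x u - \<phi> x (D Y x u)"
  using D_apply(2)[OF open_W x linear_phi diff_W[OF smooth_phi x] diff_W[OF Y x]] by simp

lemma D_phi_E:
  assumes x: "x \<in> W"
  shows "D (\<lambda>y. \<phi> y (E 1 x)) x u = - \<phi> x (D (E 1) x u)"
    "D (\<lambda>y. \<phi> y (E 2 x)) x u = D (E 3) x u - \<phi> x (D (E 2) x u)"
    "D (\<lambda>y. \<phi> y (E 3 x)) x u = - D (E 2) x u - \<phi> x (D (E 3) x u)"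
proof -
  have d: "(\<lambda>y. \<phi> y (E i y)) differentiable (at x)" for i
    by (rule D_apply(1)[OF open_W x linear_phi diff_W[OF smooth_phi x] diff_W[OF smooth_E x]])
  have "D (\<lambda>y. \<phi> y (E 1 y)) x u = 0"
    using D_cong[OF open_W x phi_E(1) d] by simp
  then show "D (\<lambda>y. \<phi> y (E 1 x)) x u = - \<phi> x (D (E 1) x u)"
    by (simp add: D_phi[OF x smooth_E])
  show "D (\<lambda>y. \<phi> y (E 2 x)) x u = D (E 3) x u - \<phi> x (D (E 2) x u)"
    using D_cong[OF open_W x phi_E(2) d] by (simp add: D_phi[OF x smooth_E])
  show "D (\<lambda>y. \<phi> y (E 3 x)) x u = - D (E 2) x u - \<phi> x (D (E 3) x u)"
    using D_cong[OF open_W x phi_E(3) d] by (simp add: D_phi[OF x smooth_E] D_minus[OF diff_W[OF smooth_E x]])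
qed

text \<open>On constant fields the definition of \<open>h\<close> differentiates
  \<open>\<phi>\<close> itself. \<open>D_phi_E\<close> moves this derivative onto the frame fields
  and restores the brackets in 2 h X = [\<xi>, \<phi> X] - \<phi> [\<xi>, X].\<close>

lemma h_bracket:
  assumes x: "x \<in> W"
  shows "h x (E 1 x) = 0"
    "h x (E 2 x) = (1/2) *\<^sub>R (lie_bracket (E 1) (E 3) x - \<phi> x (lie_bracket (E 1) (E 2) x))"
    "h x (E 3 x) = (1/2) *\<^sub>R (- lie_bracket (E 1) (E 2) x - \<phi> x (lie_bracket (E 1) (E 3) x))"
  using linear_D[OF diff_W[OF smooth_E x], of 1] linear_phi[OF x]
  by (simp_all add: h_tensor_eq lie_bracket_def D_phi_E[OF x] phi_E[OF x] linear_0 linear_neg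
      linear_diff algebra_simps)

text \<open>On the contact distribution \<open>h\<close> is \<phi> composed with the trace-free part
  of \<nabla>\<xi>; the rotation \<open>om 1 2 3\<close> of the frame along \<xi> cancels.\<close>

lemma h_E:
  assumes x: "x \<in> W"
  shows "h x (E 2 x) = ((om 2 1 2 x - om 3 1 3 x) / 2) *\<^sub>R E 3 x - om 2 1 3 x *\<^sub>R E 2 x"
    "h x (E 3 x) = ((om 2 1 2 x - om 3 1 3 x) / 2) *\<^sub>R E 2 x + om 2 1 3 x *\<^sub>R E 3 x"
proof -
  have "om 1 3 1 x = 0" "om 1 2 1 x = 0" "om 1 3 2 x = - om 1 2 3 x" "om 3 1 2 x = om 2 1 3 x"
    using om_antisym[OF x, of 1 3 1] om_antisym[OF x, of 1 2 1] om_antisym[OF x, of 1 3 2]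
      om_1_sym[OF x, of 3 2] om_11[OF x] by auto
  then have b: "lie_bracket (E 1) (E 2) x = - om 2 1 2 x *\<^sub>R E 2 x + (om 1 2 3 x - om 2 1 3 x) *\<^sub>R E 3 x"
      "lie_bracket (E 1) (E 3) x = - (om 1 2 3 x + om 2 1 3 x) *\<^sub>R E 2 x - om 3 1 3 x *\<^sub>R E 3 x"
    by (simp_all add: lie_bracket_E[OF x] sum_3 om_diag[OF x] om_11[OF x])
  show "h x (E 2 x) = ((om 2 1 2 x - om 3 1 3 x) / 2) *\<^sub>R E 3 x - om 2 1 3 x *\<^sub>R E 2 x"
    "h x (E 3 x) = ((om 2 1 2 x - om 3 1 3 x) / 2) *\<^sub>R E 2 x + om 2 1 3 x *\<^sub>R E 3 x"
    unfolding h_bracket[OF x] b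
    by (rule frame_eqI_3[OF x];
        simp add: phi_eq[OF x] bilinear_simps[OF bil[OF x]] orth_3[OF x]; simp add: field_simps)+
qed

text \<open>For X = e and X = \<phi> e the Nijenhuis tensor on (\<xi>, X) is -2 \<phi> h X. On (e,
  \<phi> e) it is the \<xi>-component of a bracket of contact fields, zero because \<eta> is closed.
  Bilinearity and antisymmetry cover the rest.\<close>

lemma normal_if_h_zero:
  assumes x: "x \<in> W" and h0: "\<And>v. h x v = 0"
  shows "nijenhuis \<phi> (K u) (K v) x + (2 * ext_d1 \<eta> (K u) (K v) x) *\<^sub>R E 1 x = 0"
proof -
  define N where "N u v = D (\<lambda>y. \<phi> y v) x (\<phi> x u) - D (\<lambda>y. \<phi> y u) x (\<phi> x v)
    + \<phi> x (D (\<lambda>y. \<phi> y u) x v) - \<phi> x (D (\<lambda>y. \<phi> y v) x u)" for u v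
  note linD = linear_D_arg[OF open_W x linear_phi diff_W[OF smooth_phi x]]
    linear_D[OF diff_W[OF smooth_phi x]]
  have nij: "nijenhuis \<phi> (K u) (K v) x = N u v" for u v
    using linear_phi[OF x]
    by (simp add: nijenhuis_def lie_bracket_def N_def linear_0 linear_neg)
  have lin: "linear (N u)" for u
    unfolding N_def
    by (rule linearI; simp add: linear_add[OF linear_phi[OF x]] linear_scale[OF linear_phi[OF x]]
        linear_add[OF linD(1)] linear_scale[OF linD(1)] linear_add[OF linD(2)]
        linear_scale[OF linD(2)] algebra_simps)
  have anti: "N u v = - N v u" for u v by (simp add: N_def)
  have lin': "linear (\<lambda>u. N u v)" for v
    using lin[of v] by (subst anti) (rule linear_compose_neg)
  note lphi = linear_add[OF linear_phi[OF x]] linear_diff[OF linear_phi[OF x]]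
    linear_neg[OF linear_phi[OF x]] linear_0[OF linear_phi[OF x]]
  note lDE = linear_0[OF linear_D[OF diff_W[OF smooth_E x]]] linear_neg[OF linear_D[OF diff_W[OF smooth_E x]]]
  have phi2: "\<phi> x (\<phi> x v) = - v + g x v (E 1 x) *\<^sub>R E 1 x" for v
    by (rule linear_eqI_frame[OF x])
      (use linear_phi[OF x] bil[OF x] in \<open>auto simp: linear_iff phi_E orth_3 x lphi bilinear_ladd
        bilinear_lmul algebra_simps\<close>)
  have h2: "lie_bracket (E 1) (E 3) x - \<phi> x (lie_bracket (E 1) (E 2) x) = 0"
    using h_bracket(2)[OF x] h0 by simp
  have h3: "- lie_bracket (E 1) (E 2) x - \<phi> x (lie_bracket (E 1) (E 3) x) = 0"
    using h_bracket(3)[OF x] h0 by simp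
  have N12: "N (E 1 x) (E 2 x) = 0"
  proof -
    have "N (E 1 x) (E 2 x) = - \<phi> x (lie_bracket (E 1) (E 3) x - \<phi> x (lie_bracket (E 1) (E 2) x))"
      by (simp add: N_def D_phi_E[OF x] phi_E[OF x] lphi lDE lie_bracket_def)
    then show ?thesis by (simp add: h2 lphi)
  qed
  have N13: "N (E 1 x) (E 3 x) = 0"
  proof -
    have "N (E 1 x) (E 3 x) = - \<phi> x (- lie_bracket (E 1) (E 2) x - \<phi> x (lie_bracket (E 1) (E 3) x))"
      by (simp add: N_def D_phi_E[OF x] phi_E[OF x] lphi lDE lie_bracket_def)
    then show ?thesis by (simp add: h3 lphi)
  qed
  have N23: "N (E 2 x) (E 3 x) = 0"
  proof -
    have "N (E 2 x) (E 3 x) = lie_bracket (E 2) (E 3) x + \<phi> x (\<phi> x (lie_bracket (E 2) (E 3) x))"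
      by (simp add: N_def D_phi_E[OF x] phi_E[OF x] lphi lDE lie_bracket_def)
    also have "\<dots> = (om 2 3 1 x - om 3 2 1 x) *\<^sub>R E 1 x"
      by (simp add: phi2 lie_bracket_E[OF x] g_frame_sum[OF x])
    also have "\<dots> = 0"
      using om_antisym[OF x, of 2 3 1] om_antisym[OF x, of 3 2 1] om_1_sym[OF x, of 2 3] by simp
    finally show ?thesis .
  qed
  have diag: "N u u = 0" for u by (simp add: N_def)
  have N: "N (E i x) (E j x) = 0" for i j
  proof -
    have "i \<in> {1, 2, 3}" "j \<in> {1, 2, 3}" using exhaust_3 by auto
    then show ?thesis
      using N12 N13 N23 diag anti[of "E 2 x" "E 1 x"] anti[of "E 3 x" "E 1 x"] anti[of "E 3 x" "E 2 x"]
      by auto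
  qed
  have N0: "N (E i x) v = 0" for i v
    by (rule linear_eqI_frame[OF x lin, of "\<lambda>_. 0"]) (simp_all add: N linear_zero)
  have "N u v = 0" for u v
    by (rule linear_eqI_frame[OF x lin', of "\<lambda>_. 0"]; simp add: N0 linear_zero)
  then show ?thesis by (simp add: nij d_eta[OF x])
qed

end

subsection \<open>Frames diagonalising the covariant derivative of the Reeb field\<close>

text \<open>The strict order \<open>om_less\<close> decides which eigendirection is called
  \<open>E 2\<close> and keeps away from zeros of \<open>h\<close>, so that \<open>q - 1\<close> is
  positive.\<close>

locale diagonal_frame = kenmotsu_frame +
  assumes om_213: "x \<in> W \<Longrightarrow> om 2 1 3 x = 0"
    and om_less: "x \<in> W \<Longrightarrow> om 3 1 3 x < om 2 1 2 x"
    and h_parallel: "x \<in> W \<Longrightarrow> nabla_endo g h (E 1) (K v) x = 0"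
    and reeb_eigen: "x \<in> W \<Longrightarrow> \<exists>\<rho>. ricci_op g x (E 1 x) = \<rho> *\<^sub>R E 1 x"
begin

abbreviation "q \<equiv> om 2 1 2"

lemma om_313: "x \<in> W \<Longrightarrow> om 3 1 3 x = 2 - q x"
  using om_1_trace[of x] by simp

lemma q_gt_1: "x \<in> W \<Longrightarrow> q x > 1"
  using om_less[of x] om_313[of x] by simp

lemma h_diag:
  assumes "x \<in> W"
  shows "h x (E 2 x) = (q x - 1) *\<^sub>R E 3 x" "h x (E 3 x) = (q x - 1) *\<^sub>R E 2 x"
  by (simp_all add: h_E[OF assms] om_213[OF assms] om_313[OF assms])

lemma D_q_1_and_om_123:
  assumes x: "x \<in> W"
  shows "D q x (E 1 x) = 0" "om 1 2 3 x = 0"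
proof -
  note dh = diff_W[OF smooth_h x]
  have dq: "(\<lambda>y. q y - 1) differentiable (at x)"
    by (intro derivative_intros diff_W smooth_om x)
  have tens: "nabla g (E 1) (\<lambda>y. h y (E 2 y)) x = h x (nabla g (E 1) (E 2) x)"
    using h_parallel[OF x, of "E 2 x"]
      D_apply(2)[OF open_W x linear_h dh diff_W[OF smooth_E x], of 2 "E 1 x"]
    by (simp add: nabla_endo_def nabla_def linear_add[OF linear_h[OF x]])
  have "nabla g (E 1) (\<lambda>y. h y (E 2 y)) x = nabla g (E 1) (\<lambda>y. (q y - 1) *\<^sub>R E 3 y) x"
    by (rule nabla_cong[OF x refl h_diag(1)])
      (auto intro: D_apply(1)[OF open_W x linear_h dh diff_W[OF smooth_E x]])
  also have "\<dots> = D q x (E 1 x) *\<^sub>R E 3 x + (q x - 1) *\<^sub>R nabla g (E 1) (E 3) x"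
    using nabla_sum_right[OF x, of "{0::nat}" "\<lambda>_ y. q y - 1" "\<lambda>_. E 3" "E 1"]
      dq diff_W[OF smooth_E x] diff_W[OF smooth_om x]
    by (simp add: D_diff)
  finally have e: "D q x (E 1 x) *\<^sub>R E 3 x + (q x - 1) *\<^sub>R nabla g (E 1) (E 3) x
      = h x (nabla g (E 1) (E 2) x)"
    using tens by simp
  have o: "om 1 2 1 x = 0" "om 1 3 1 x = 0" "om 1 3 2 x = - om 1 2 3 x"
    using om_antisym[OF x, of 1 2 1] om_antisym[OF x, of 1 3 1] om_antisym[OF x, of 1 3 2]
      om_11[OF x] by auto
  \<comment> \<open>\<open>h\<close> exchanges \<open>E 2\<close> and \<open>E 3\<close>
    symmetrically, while differentiation along \<xi> rotates them antisymmetrically; the term with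
    \<open>om 1 2 3\<close> thus enters the two sides with opposite signs and vanishes as
    \<open>q > 1\<close>.\<close>
  have e': "D q x (E 1 x) *\<^sub>R E 3 x - ((q x - 1) * om 1 2 3 x) *\<^sub>R E 2 x
      = ((q x - 1) * om 1 2 3 x) *\<^sub>R E 2 x"
    using e by (simp add: nabla_E[OF x] sum_3 om_diag[OF x] o h_diag[OF x]
        linear_scale[OF linear_h[OF x]] mult.commute)
  show "D q x (E 1 x) = 0"
    using arg_cong[OF e', of "\<lambda>v. g x v (E 3 x)"]
    by (simp add: bilinear_simps[OF bil[OF x]] orth_3[OF x])
  show "om 1 2 3 x = 0"
    using arg_cong[OF e', of "\<lambda>v. g x v (E 2 x)"] q_gt_1[OF x]
    by (simp add: bilinear_simps[OF bil[OF x]] orth_3[OF x])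
qed

lemma om_1:
  assumes x: "x \<in> W"
  shows "om 1 j k x = 0"
proof -
  have "om 1 1 2 x = 0" "om 1 1 3 x = 0" "om 1 2 1 x = 0" "om 1 3 1 x = 0" "om 1 2 3 x = 0" "om 1 3 2 x = 0"
    using om_antisym[OF x, of 1 2 1] om_antisym[OF x, of 1 3 1] om_antisym[OF x, of 1 3 2]
      om_11[OF x] D_q_1_and_om_123[OF x] by auto
  then show ?thesis using exhaust_3[of j] exhaust_3[of k] om_diag[OF x] by metis
qed

lemma om_table:
  assumes x: "x \<in> W"
  shows "om 2 2 1 x = - q x" "om 2 3 1 x = 0" "om 2 3 2 x = - om 2 2 3 x"
    "om 3 1 2 x = 0" "om 3 2 1 x = 0" "om 3 3 1 x = q x - 2" "om 3 2 3 x = - om 3 3 2 x"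
  using om_213[OF x] om_313[OF x] om_1_sym[OF x, of 3 2] om_antisym[OF x, of 2 2 1]
    om_antisym[OF x, of 2 3 1] om_antisym[OF x, of 2 3 2] om_antisym[OF x, of 3 2 1]
    om_antisym[OF x, of 3 3 1] om_antisym[OF x, of 3 2 3] by auto

lemmas om_simps = om_1 om_diag om_213 om_313 om_table

lemma D_om_cong:
  assumes x: "x \<in> W" and "\<And>y. y \<in> W \<Longrightarrow> om i j k y = f y"
  shows "D (om i j k) x v = D f x v"
  by (rule D_cong[OF open_W x assms(2) diff_W[OF smooth_om x]])

lemma D_om:
  assumes x: "x \<in> W"
  shows "D (om 1 j k) x v = 0" "D (om i j j) x v = 0" "D (om 2 1 3) x v = 0"
    "D (om 3 1 3) x v = - D q x v" "D (om 2 2 1) x v = - D q x v"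
    "D (om 2 3 1) x v = 0" "D (om 2 3 2) x v = - D (om 2 2 3) x v"
    "D (om 3 1 2) x v = 0" "D (om 3 2 1) x v = 0" "D (om 3 3 1) x v = D q x v"
    "D (om 3 2 3) x v = - D (om 3 3 2) x v"
  using D_om_cong[OF x om_1] D_om_cong[OF x om_diag] D_om_cong[OF x om_213]
    D_om_cong[OF x om_313] D_om_cong[OF x om_table(1)] D_om_cong[OF x om_table(2)]
    D_om_cong[OF x om_table(3)] D_om_cong[OF x om_table(4)] D_om_cong[OF x om_table(5)]
    D_om_cong[OF x om_table(6)] D_om_cong[OF x om_table(7)] diff_W[OF smooth_om x]
  by (simp_all add: D_minus D_diff)

lemma ricci_1_orth:
  assumes x: "x \<in> W" and j: "j \<noteq> 1"
  shows "ricci g x (E 1 x) (E j x) = 0"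
  using reeb_eigen[OF x] ricci_op_frame[OF x, of "E 1 x" j] bil[OF x] j
  by (auto simp: bilinear_simps orth[OF x])

text \<open>The four equations are \<open>Ric(\<xi>, e) = Ric(\<xi>, \<phi> e) = 0\<close> and the two nontrivial components
  of the Bianchi identity.\<close>

lemma structure_equations:
  assumes x: "x \<in> W"
  shows "D (om 3 3 2) x (E 1 x) = (q x - 2) * om 3 3 2 x"
    "D (om 2 2 3) x (E 1 x) = - q x * om 2 2 3 x"
    "D q x (E 2 x) = 2 * (q x - 1) * om 3 3 2 x"
    "D q x (E 3 x) = 2 * (q x - 1) * om 2 2 3 x"
proof -
  note rm = rm_eq[OF x] sum_3 om_simps[OF x] D_om[OF x] D_q_1_and_om_123[OF x]
  show 1: "D (om 3 3 2) x (E 1 x) = (q x - 2) * om 3 3 2 x"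
    using ricci_1_orth[OF x, of 2] by (simp add: ricci_E[OF x] rm algebra_simps)
  show 2: "D (om 2 2 3) x (E 1 x) = - q x * om 2 2 3 x"
    using ricci_1_orth[OF x, of 3] by (simp add: ricci_E[OF x] rm algebra_simps)
  show "D q x (E 2 x) = 2 * (q x - 1) * om 3 3 2 x"
    using rm_bianchi[OF x, of 1 2 3 3] 1 by (simp add: rm algebra_simps)
  show "D q x (E 3 x) = 2 * (q x - 1) * om 2 2 3 x"
    using rm_bianchi[OF x, of 1 2 3 2] 2 by (simp add: rm algebra_simps)
qed

text \<open>Two evaluations of \<xi>(e q) compete. The structure equations give (q - 2) e(q), while
  \<xi>(q) = 0 and [e, \<xi>] = q e give - q e(q). Their difference (2 q - 2) e(q) must vanish, and
  e(q) is a nonzero multiple of \<open>om 3 3 2\<close>. For \<phi> e the two rates are - q and q -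
  2.\<close>

lemma om_332_223:
  assumes x: "x \<in> W"
  shows "om 3 3 2 x = 0" "om 2 2 3 x = 0"
proof -
  note sq = smooth_om[of 2 1 2]
  have E1: "D (\<lambda>y. D q y (E 1 y)) x v = 0" for v
    using D_cong[OF open_W x D_q_1_and_om_123(1) diff_W[OF smooth_on_D[OF open_W sq smooth_E] x]]
    by simp
  have Ej: "D (\<lambda>y. D q y (E j y)) x (E 1 x) = 2 * (q x - 1) * D f x (E 1 x)"
    if "\<And>y. y \<in> W \<Longrightarrow> D q y (E j y) = 2 * (q y - 1) * f y" and f: "smooth_on W f" for j f
  proof -
    have "D (\<lambda>y. D q y (E j y)) x (E 1 x) = D (\<lambda>y. 2 * (q y - 1) * f y) x (E 1 x)"
      by (rule D_cong[OF open_W x that(1) diff_W[OF smooth_on_D[OF open_W sq smooth_E] x]])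
    also have "\<dots> = 2 * (q x - 1) * D f x (E 1 x)"
      using diff_W[OF sq x] diff_W[OF f x]
      by (simp add: D_mult D_diff D_q_1_and_om_123[OF x])
    finally show ?thesis .
  qed
  have "2 * (q x - 1) * (2 * (q x - 1)) * om 3 3 2 x = 0"
    using D_commutator[OF x sq, of 2 1] Ej[OF structure_equations(3) smooth_om] E1
      structure_equations[OF x]
    by (simp add: sum_3 om_simps[OF x] algebra_simps)
  then show "om 3 3 2 x = 0" using q_gt_1[OF x] by simp
  have "2 * (q x - 1) * (2 * (q x - 1)) * om 2 2 3 x = 0"
    using D_commutator[OF x sq, of 3 1] Ej[OF structure_equations(4) smooth_om] E1
      structure_equations[OF x]
    by (simp add: sum_3 om_simps[OF x] algebra_simps)
  then show "om 2 2 3 x = 0" using q_gt_1[OF x] by simp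
qed

lemma D_q:
  assumes x: "x \<in> W"
  shows "D q x v = 0"
proof (rule linear_eqI_frame[OF x linear_D[OF diff_W[OF smooth_om x]], of "\<lambda>_. 0"])
qed (simp_all add: structure_equations[OF x] D_q_1_and_om_123[OF x] om_332_223[OF x] linear_zero)

section \<open>Ricci and Cotton tensors for locally constant q\<close>

lemma D_fun_q:
  fixes F :: "real \<Rightarrow> real"
  assumes x: "x \<in> W" and F: "F differentiable (at (q x))" and f: "\<And>y. y \<in> W \<Longrightarrow> f y = F (q y)"
  shows "D f x v = 0"
proof -
  note c = D_compose[OF diff_W[OF smooth_om x] F]
  have "D f x v = D (\<lambda>y. F (q y)) x v"
    by (rule D_cong[OF open_W x, symmetric]) (use c(1) f in auto)
  then show ?thesis by (simp add: c(2) D_q[OF x] linear_0[OF linear_D[OF F]])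
qed

text \<open>Ricci components written as functions of the value t of \<open>q\<close>, so that
  constancy of \<open>q\<close> passes to them. For t = 2 the diagonal is -4, -4, 0, as for the
  model product.\<close>

definition s :: "3 \<Rightarrow> 3 \<Rightarrow> real \<Rightarrow> real" where
  "s b c t = (if b \<noteq> c then 0 else if b = 1 then - t\<^sup>2 - (2 - t)\<^sup>2 else if b = 2 then - 2 * t
    else - 2 * (2 - t))"

lemma ricci_table:
  assumes x: "x \<in> W"
  shows "ricci g x (E b x) (E c x) = s b c (q x)"
proof -
  have "b \<in> {1, 2, 3}" "c \<in> {1, 2, 3}" using exhaust_3 by auto
  then show ?thesis
    by (auto simp: ricci_E[OF x] rm_eq[OF x] sum_3 om_simps[OF x] D_om[OF x] D_q[OF x]
        om_332_223[OF x] s_def power2_eq_square algebra_simps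
        D_fun_q[OF x, of "\<lambda>_. 0", OF _ om_332_223(1)] D_fun_q[OF x, of "\<lambda>_. 0", OF _ om_332_223(2)])
qed

lemma differentiable_s: "s b c differentiable (at t)"
proof -
  have [simp]: "(\<lambda>t::real. - t\<^sup>2 - (2 - t)\<^sup>2) differentiable (at t)" "(\<lambda>t::real. - (2 * t)) differentiable (at t)"
    "(\<lambda>t::real. 2 * t - 4) differentiable (at t)"
    by (intro derivative_intros)+
  show ?thesis unfolding s_def by (cases "b = c"; cases "b = 1"; cases "b = 2") (simp_all)
qed

text \<open>Ricci components and scalar curvature are locally constant along with \<open>q\<close>,
  so only the connection terms of the two covariant derivatives survive.\<close>

lemma cotton3_E:
  assumes x: "x \<in> W"
  shows "cotton3 g (K (E a x)) (K (E b x)) (K (E c x)) x =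
    (\<Sum>m\<in>UNIV. om b a m x * s m c (q x) + om b c m x * s a m (q x)
      - om a b m x * s m c (q x) - om a c m x * s b m (q x))"
proof -
  have "D (scalar_curv g) x v = 0" for v
    by (rule D_fun_q[OF x, of "\<lambda>t. \<Sum>i\<in>UNIV. s i i t"])
      (auto simp: scalar_curv_frame ricci_table intro!: differentiable_sum differentiable_s)
  moreover have "nabla_form2 g (ricci g) (K (E a x)) (K (E b x)) (K (E c x)) x =
      - (\<Sum>m\<in>UNIV. om a b m x * s m c (q x)) - (\<Sum>m\<in>UNIV. om a c m x * s b m (q x))" for a b
    using D_fun_q[OF x differentiable_s ricci_table, of b c]
    by (simp add: nabla_form2_E[OF x ricci_bilinear smooth_ricci] ricci_table[OF x])
  ultimately show ?thesis
    by (simp add: cotton3_def sum.distrib sum_subtractf)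
qed

lemma adapted_frame_nth: "x \<in> W \<Longrightarrow> adapted_frame \<phi> (E 1) x (E 2 x) $ i = E i x"
  using exhaust_3[of i] by (auto simp: adapted_frame_def phi_E vector_3)

text \<open>The nonzero value is C(\<xi>, e, e) = q (S(e, e) - S(\<xi>, \<xi>)) with the Ricci
  components taken from \<open>s\<close>.\<close>

lemma cotton_comp_E:
  assumes x: "x \<in> W"
  defines "F \<equiv> adapted_frame \<phi> (E 1) x (E 2 x)"
  shows "cotton_comp g F x 1 1 = 0" "cotton_comp g F x 1 2 = 0" "cotton_comp g F x 1 3 = 0"
    "cotton_comp g F x 2 2 = 0" "cotton_comp g F x 3 3 = 0"
    "cotton_comp g F x 2 3 = 2 * q x * (q x - 1) * (q x - 2)"
  by (simp_all add: F_def cotton_comp_def adapted_frame_nth[OF x] cotton3_E[OF x] sum_3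
      levi_civita_symbol_def om_simps[OF x] om_332_223[OF x] s_def power2_eq_square algebra_simps)

lemma orthogonal_cotton_soliton:
  assumes x: "x \<in> W" and V: "smooth_on W V" and V1: "\<And>y. y \<in> W \<Longrightarrow> g y (V y) (E 1 y) = 0"
    and C: "\<And>y i j. y \<in> W \<Longrightarrow>
      C y (E i y) (E j y) = cotton_comp g (adapted_frame \<phi> (E 1) y (E 2 y)) y i j"
    and sol: "\<And>y v w. y \<in> W \<Longrightarrow> lie_form2 V g (K v) (K w) y + C y v w - \<sigma> * g y v w = 0"
  shows "\<sigma> = 0" "q x = 2"
proof -
  define f where "f m y = g y (V y) (E m y)" for m y
  have f: "smooth_on W (f m)" for m unfolding f_def by (rule smooth_g_fields[OF V smooth_E])
  have f1: "f 1 y = 0" if "y \<in> W" for y using V1[OF that] by (simp add: f_def)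
  have Df1: "D (f 1) y v = 0" if y: "y \<in> W" for y v
    using D_cong[OF open_W y f1 diff_W[OF f y]] by simp
  have e: "D (f j) y (E i y) + (\<Sum>m\<in>UNIV. f m y * om i m j y)
      + D (f i) y (E j y) + (\<Sum>m\<in>UNIV. f m y * om j m i y)
      + cotton_comp g (adapted_frame \<phi> (E 1) y (E 2 y)) y i j - \<sigma> * (if i = j then 1 else 0) = 0"
    if y: "y \<in> W" for i j y
    using sol[OF y, of "E i y" "E j y"] lie_form2_E[OF y V, of i j] C[OF y]
    by (simp add: orth[OF y] flip: f_def)
  show sigma: "\<sigma> = 0"
    using e[OF x, of 1 1]
    by (simp add: sum_3 om_simps[OF x] f1[OF x] Df1[OF x] cotton_comp_E[OF x])
  \<comment> \<open>The components (\<xi>, e), (\<xi>, \<phi> e), (e, e), (\<phi> e, \<phi> e) and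
    (e, \<phi> e) of the soliton equation, in this order.\<close>
  have eqs: "D (f 2) y (E 1 y) = q y * f 2 y" "D (f 3) y (E 1 y) = (2 - q y) * f 3 y"
    "D (f 2) y (E 2 y) = 0" "D (f 3) y (E 3 y) = 0"
    "D (f 3) y (E 2 y) = - D (f 2) y (E 3 y) - 2 * q y * (q y - 1) * (q y - 2)" if y: "y \<in> W" for y
    using e[OF y, of 2 1] e[OF y, of 3 1] e[OF y, of 2 2] e[OF y, of 3 3] e[OF y, of 3 2]
    by (simp_all add: sum_3 om_simps[OF y] om_332_223[OF y] f1[OF y] Df1[OF y] cotton_comp_E[OF y]
        sigma algebra_simps)
  have smD: "(\<lambda>y. D (f m) y (E j y)) differentiable (at y)" if "y \<in> W" for m j y
    by (rule diff_W[OF smooth_on_D[OF open_W f smooth_E] that])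
  note dq = diff_W[OF smooth_om] and df = diff_W[OF f]
  \<comment> \<open>Commuting \<xi> past e costs [e, \<xi>] = q e, which lowers the rate 2 - q of
    \<open>f 3\<close> by q.\<close>
  have a: "D (\<lambda>y. D (f 3) y (E 2 y)) y (E 1 y) = (2 - 2 * q y) * D (f 3) y (E 2 y)" if y: "y \<in> W" for y
  proof -
    have "D (\<lambda>y. D (f 3) y (E 1 y)) y (E 2 y) = D (\<lambda>y. (2 - q y) * f 3 y) y (E 2 y)"
      by (rule D_cong[OF open_W y eqs(2) smD[OF y]])
    also have "\<dots> = (2 - q y) * D (f 3) y (E 2 y)"
      using dq[OF y] df[OF y] by (simp add: D_mult D_diff D_q[OF y])
    finally show ?thesis
      using D_commutator[OF y f, of 3 2 1] by (simp add: sum_3 om_simps[OF y] algebra_simps)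
  qed
  \<comment> \<open>Here [\<phi> e, \<xi>] = (2 - q) \<phi> e lowers the rate q of
    \<open>f 2\<close> by 2 - q, so the result is opposite to the previous rate.\<close>
  have b: "D (\<lambda>y. D (f 2) y (E 3 y)) y (E 1 y) = (2 * q y - 2) * D (f 2) y (E 3 y)" if y: "y \<in> W" for y
  proof -
    have "D (\<lambda>y. D (f 2) y (E 1 y)) y (E 3 y) = D (\<lambda>y. q y * f 2 y) y (E 3 y)"
      by (rule D_cong[OF open_W y eqs(1) smD[OF y]])
    also have "\<dots> = q y * D (f 2) y (E 3 y)"
      using dq[OF y] df[OF y] by (simp add: D_mult D_q[OF y])
    finally show ?thesis
      using D_commutator[OF y f, of 2 3 1] by (simp add: sum_3 om_simps[OF y] algebra_simps)
  qed
  \<comment> \<open>The two functions add up to the constant \<open>- k\<close>. The derivative of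
    the sum along \<xi> is 2 - 2 q times their difference, so the difference vanishes.\<close>
  have ab: "D (f 3) y (E 2 y) = D (f 2) y (E 3 y)" if y: "y \<in> W" for y
  proof -
    define k where "k y = 2 * q y * (q y - 1) * (q y - 2)" for y
    have k: "D k y v = 0" "k differentiable (at y)" for v
      using dq[OF y]
      by (auto simp: k_def[abs_def] intro!: D_fun_q[OF y, of "\<lambda>t. 2 * t * (t - 1) * (t - 2)"] derivative_intros)
    have "D (\<lambda>y. D (f 3) y (E 2 y)) y (E 1 y) = D (\<lambda>y. - D (f 2) y (E 3 y) - k y) y (E 1 y)"
      by (rule D_cong[OF open_W y _ smD[OF y]]) (simp add: eqs(5) k_def)
    also have "\<dots> = - D (\<lambda>y. D (f 2) y (E 3 y)) y (E 1 y)"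
      using smD[OF y] k by (simp add: D_diff D_minus)
    finally have "(2 * q y - 2) * (D (f 3) y (E 2 y) - D (f 2) y (E 3 y)) = 0"
      unfolding a[OF y] b[OF y] by (simp add: algebra_simps)
    then show ?thesis using q_gt_1[OF y] by simp
  qed
  \<comment> \<open>Equal functions with opposite nonzero rates along \<xi> vanish, and with them
    the Cotton term of \<open>eqs(5)\<close>.\<close>
  have "D (\<lambda>y. D (f 3) y (E 2 y)) x (E 1 x) = D (\<lambda>y. D (f 2) y (E 3 y)) x (E 1 x)"
    by (rule D_cong[OF open_W x ab smD[OF x]])
  then have "(4 * q x - 4) * D (f 2) x (E 3 x) = 0"
    unfolding a[OF x] b[OF x] ab[OF x] by (simp add: algebra_simps)
  then have "D (f 2) x (E 3 x) = 0" using q_gt_1[OF x] by simp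
  then show "q x = 2" using eqs(5)[OF x] ab[OF x] q_gt_1[OF x] by simp
qed

end

section \<open>The local isometry\<close>

context diagonal_frame
begin

lemma D_dual_frame_3:
  assumes x: "x \<in> W"
  shows "D (\<lambda>y. g y v (E k y)) x u - D (\<lambda>y. g y u (E k y)) x v =
    (\<Sum>m\<in>UNIV. \<Sum>l\<in>UNIV. om m k l x * (g x u (E m x) * g x v (E l x) - g x v (E m x) * g x u (E l x)))"
proof -
  have "g x v (nabla g (K u) (E k) x) = (\<Sum>m\<in>UNIV. \<Sum>l\<in>UNIV. om m k l x * (g x u (E m x) * g x v (E l x)))"
    for u v
    by (simp add: nabla_K_E[OF x] nabla_E[OF x] bilinear_sum_right[OF bil[OF x]] sum_distrib_left
        ac_simps)
  then show ?thesis
    unfolding D_dual_frame[OF x] by (simp add: right_diff_distrib sum_subtractf)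
qed

text \<open>For \<open>q = 2\<close> the coframe is \<open>dt\<close>, \<open>exp (2 t) dy\<close>, \<open>dz\<close>; the upper half plane of
  curvature \<open>-4\<close> has the coordinates \<open>2 y + i exp (- 2 t)\<close>.\<close>

lemma local_isometry:
  assumes q2: "\<And>y. y \<in> W \<Longrightarrow> q y = 2" and a: "a \<in> W"
  obtains r and F :: "real ^ 3 \<Rightarrow> complex \<times> real"
  where "r > 0" "ball a r \<subseteq> W" "inj_on F (ball a r)" "smooth_on (ball a r) F"
    "\<And>S. open S \<Longrightarrow> S \<subseteq> ball a r \<Longrightarrow> open (F ` S)"
    "smooth_on (F ` ball a r) (inv_into (ball a r) F)"
    "\<And>x. x \<in> ball a r \<Longrightarrow> Im (fst (F x)) > 0"
    "\<And>x v w. x \<in> ball a r \<Longrightarrow>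
      prod_metric (hyperbolic_metric 4) line_metric (F x) (D F x v) (D F x w) = g x v w"
proof -
  obtain r0 where r0: "r0 > 0" "ball a r0 \<subseteq> W" using open_W a open_contains_ball by blast
  \<comment> \<open>A ball supplies the convexity required for integrating closed forms.\<close>
  define B where "B = ball a r0"
  have B: "open B" "convex B" "a \<in> B" and BW: "\<And>x. x \<in> B \<Longrightarrow> x \<in> W" "B \<subseteq> W"
    using r0 by (auto simp: B_def)
  have lin: "linear (\<lambda>v. g x v (E k x))" if "x \<in> B" for x k
    using bilinear_linear_left[OF bil[OF BW(1)[OF that]]] .
  have sm: "smooth_on B (\<lambda>x. g x v (E k x))" for v k
    by (rule smooth_on_subset[OF smooth_g_fields[OF smooth_on_const smooth_E] BW(2)])
  have smE: "smooth_on B (E i)" for i by (rule smooth_on_subset[OF smooth_E BW(2)])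
  note diff = smooth_on_differentiable[OF sm]
  note simps = sum_3 om_simps[OF BW(1)] om_332_223[OF BW(1)] q2[OF BW(1)]
  \<comment> \<open>The forms dual to \<open>E 1\<close> and \<open>E 3\<close> are closed; the form
    \<theta> dual to \<open>E 2\<close> satisfies d\<theta> = 2 \<eta> \<and> \<theta>, with the
    exterior derivative and the wedge product taken without numerical factors.\<close>
  have cl1: "D (\<lambda>y. g y v (E 1 y)) x u = D (\<lambda>y. g y u (E 1 y)) x v"
    and cl3: "D (\<lambda>y. g y v (E 3 y)) x u = D (\<lambda>y. g y u (E 3 y)) x v"
    and cl2: "D (\<lambda>y. g y v (E 2 y)) x u - D (\<lambda>y. g y u (E 2 y)) x v
      = 2 * (g x v (E 2 x) * g x u (E 1 x) - g x u (E 2 x) * g x v (E 1 x))"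
    if x: "x \<in> B" for x u v
    using D_dual_frame_3[OF BW(1)[OF x], where v = v and u = u and k = 1]
      D_dual_frame_3[OF BW(1)[OF x], where v = v and u = u and k = 3]
      D_dual_frame_3[OF BW(1)[OF x], where v = v and u = u and k = 2] x by (simp_all add: simps algebra_simps)
  obtain t where t: "smooth_on B t" "\<And>x. x \<in> B \<Longrightarrow> (t has_derivative (\<lambda>v. g x v (E 1 x))) (at x)"
    using poincare_closed_one_form[OF B, of "\<lambda>x v. g x v (E 1 x)"] lin sm cl1 by blast
  obtain z where z: "smooth_on B z" "\<And>x. x \<in> B \<Longrightarrow> (z has_derivative (\<lambda>v. g x v (E 3 x))) (at x)"
    using poincare_closed_one_form[OF B, of "\<lambda>x v. g x v (E 3 x)"] lin sm cl3 by blast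
  have sme: "smooth_on B (\<lambda>x. exp (- 2 * t x))"
    by (intro smooth_on_exp_compose smooth_on_mult smooth_on_const B t)
  have De: "((\<lambda>x. exp (- 2 * t x)) has_derivative (\<lambda>v. - 2 * exp (- 2 * t x) * g x v (E 1 x))) (at x)"
    if "x \<in> B" for x
    using t(2)[OF that] by (auto intro!: derivative_eq_intros)
  \<comment> \<open>\<open>exp (- 2 * t)\<close> is the integrating factor that makes the form dual
    to \<open>E 2\<close> closed.\<close>
  have cl: "D (\<lambda>y. exp (- 2 * t y) * g y v (E 2 y)) x u = D (\<lambda>y. exp (- 2 * t y) * g y u (E 2 y)) x v"
    if x: "x \<in> B" for x u v
  proof -
    have *: "D (\<lambda>y. exp (- 2 * t y) * g y v (E 2 y)) x u =
        exp (- 2 * t x) * (D (\<lambda>y. g y v (E 2 y)) x u - 2 * (g x v (E 2 x) * g x u (E 1 x)))" for u v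
      unfolding D_mult[OF smooth_on_differentiable[OF sme x] diff[OF x]] D_eqI[OF De[OF x]]
      by (simp add: algebra_simps)
    show ?thesis unfolding * using cl2[OF x, of v u] by simp
  qed
  obtain y where y: "smooth_on B y"
    "\<And>x. x \<in> B \<Longrightarrow> (y has_derivative (\<lambda>v. exp (- 2 * t x) * g x v (E 2 x))) (at x)"
  proof (rule poincare_closed_one_form[OF B, of "\<lambda>x v. exp (- 2 * t x) * g x v (E 2 x)"])
    show "linear (\<lambda>v. exp (- 2 * t x) * g x v (E 2 x))" if "x \<in> B" for x
      using linear_compose_scale_right[OF lin[OF that], of "exp (- 2 * t x)"] by simp
    show "smooth_on B (\<lambda>x. exp (- 2 * t x) * g x v (E 2 x))" for v
      by (rule smooth_on_mult[OF B(1) sme sm])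
  qed (use cl in blast)+
  define F where "F x = (2 * y x) *\<^sub>R (1 :: complex, 0 :: real) + exp (- 2 * t x) *\<^sub>R (\<i>, 0) + z x *\<^sub>R (0, 1)" for x
  have F: "smooth_on B F"
    unfolding F_def by (intro smooth_on_add smooth_on_scaleR smooth_on_mult smooth_on_const sme y z B)
  have DF: "D F x v = (2 * (exp (- 2 * t x) * g x v (E 2 x))) *\<^sub>R (1, 0)
      + (- 2 * exp (- 2 * t x) * g x v (E 1 x)) *\<^sub>R (\<i>, 0) + g x v (E 3 x) *\<^sub>R (0, 1)"
    if x: "x \<in> B" for x v
    unfolding F_def
    by (rule D_eqI) (intro has_derivative_add has_derivative_scaleR_left has_derivative_mult_right
        De y(2) z(2) x)
  \<comment> \<open>The coframe written in the target coordinates: dt = - d Im / (2 Im) and exp (2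
    t) dy = d Re / (2 Im). Applied to a target vector \<open>v\<close> at \<open>p\<close> it gives
    the components of the preimage of \<open>v\<close> under \<open>D F\<close>.\<close>
  define c where "c i v p = (if i = (1::3) then - Im (fst v) * inverse (2 * Im (fst p))
    else if i = 2 then Re (fst v) * inverse (2 * Im (fst p)) else snd v)"
    for i and v p :: "complex \<times> real"
  define H where "H x v = (\<Sum>i\<in>UNIV. c i v (F x) *\<^sub>R E i x)" for x v
  have "c i (u + v) p = c i u p + c i v p" "c i (k *\<^sub>R v) p = k * c i v p" for i u v p k
    by (simp_all add: c_def ring_distribs)
  then have linH: "linear (H x)" for x
    by (intro linearI) (simp_all add: H_def scaleR_left_distrib sum.distrib scaleR_sum_right)
  have ImF: "Im (fst (F x)) = exp (- 2 * t x)" for x by (simp add: F_def)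
  have HD: "H x \<circ> D F x = id" if x: "x \<in> B" for x
  proof
    fix v
    have e: "exp (- (2 * t x)) * (w * inverse (exp (- (2 * t x)))) = w" for w by simp
    show "(H x \<circ> D F x) v = id v"
      unfolding id_apply
      by (rule trans[OF _ expand_3[OF BW(1)[OF x], symmetric]])
        (simp add: H_def c_def sum_3 ImF DF[OF x] e)
  qed
  have dim: "DIM(real ^ 3) = DIM(complex \<times> real)" by simp
  obtain r where r: "r > 0" "ball a r \<subseteq> B" "inj_on F (ball a r)" "open (F ` ball a r)"
    "\<And>S. open S \<Longrightarrow> S \<subseteq> ball a r \<Longrightarrow> open (F ` S)"
    "\<And>x. x \<in> ball a r \<Longrightarrow> (inv_into (ball a r) F has_derivative H x) (at (F x))"
    using local_inverse[OF B(1,3) dim F, of H] linH HD by blast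
  \<comment> \<open>The derivative of the inverse at \<open>p\<close> depends smoothly on
    \<open>p\<close> and on the value of the inverse there, so its regularity bootstraps.\<close>
  have "smooth_on (F ` ball a r) (inv_into (ball a r) F)"
  proof (rule smooth_on_if_autonomous[OF r(4) B(1), where I = UNIV and c = c and E = E])
    show "inv_into (ball a r) F p \<in> B" if "p \<in> F ` ball a r" for p
      using inv_into_into[OF that] r(2) by blast
    show "(inv_into (ball a r) F has_derivative
        (\<lambda>v. \<Sum>i\<in>UNIV. c i v p *\<^sub>R E i (inv_into (ball a r) F p))) (at p)" if "p \<in> F ` ball a r" for p
      using r(6) that by (auto simp: inv_into_f_f[OF r(3)] H_def[abs_def])
    have "smooth_on (F ` ball a r) (\<lambda>p. Im (fst p))"
      by (intro smooth_on_linear_compose[OF r(4), of "\<lambda>p. Im (fst p)"] smooth_on_ident r(4)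
          bounded_linear_compose[OF bounded_linear_Im bounded_linear_fst])
    then have s: "smooth_on (F ` ball a r) (\<lambda>p. k * inverse (2 * Im (fst p)))" for k
      by (intro smooth_on_mult smooth_on_inverse_compose smooth_on_const r(4)) (auto simp: ImF)
    have c_eq: "c i v = (if i = 1 then \<lambda>p. - Im (fst v) * inverse (2 * Im (fst p))
        else if i = 2 then \<lambda>p. Re (fst v) * inverse (2 * Im (fst p)) else (\<lambda>_. snd v))" for i v
      by (auto simp: c_def)
    show "smooth_on (F ` ball a r) (c i v)" for i v
      unfolding c_eq by (simp only: s smooth_on_const simp_thms split: if_split)
  qed (use smE in auto)
  moreover have "prod_metric (hyperbolic_metric 4) line_metric (F x) (D F x v) (D F x w) = g x v w"
    if x: "x \<in> B" for x v w
  proof -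
    have "g x v w = g x v (E 1 x) * g x w (E 1 x) + g x v (E 2 x) * g x w (E 2 x) + g x v (E 3 x) * g x w (E 3 x)"
      by (rule trans[OF arg_cong[OF expand_3[OF BW(1)[OF x], of w], of "g x v"]])
        (simp add: bilinear_simps[OF bil[OF BW(1)[OF x]]] ac_simps)
    then show ?thesis
      by (simp add: prod_metric_def hyperbolic_metric_def line_metric_def DF[OF x] ImF
          inner_complex_def power2_eq_square field_simps)
  qed
  ultimately show ?thesis
    using r BW(2) ImF smooth_on_subset[OF F r(2)] by (intro that[of r F]) auto
qed

end

subsection \<open>Existence of adapted frames\<close>

text \<open>A rotation of the contact plane given by the cosine \<open>c\<close> and the sine
  \<open>s\<close>, which spares a smooth choice of the angle itself.\<close>

definition rotated_frame :: "(3 \<Rightarrow> (real ^ 3) vec_field) \<Rightarrow> (real ^ 3 \<Rightarrow> real) \<Rightarrow> (real ^ 3 \<Rightarrow> real) \<Rightarrow>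
    3 \<Rightarrow> (real ^ 3) vec_field" where
  "rotated_frame E c s i = (if i = 1 then E 1 else if i = 2 then (\<lambda>y. c y *\<^sub>R E 2 y + s y *\<^sub>R E 3 y)
    else (\<lambda>y. c y *\<^sub>R E 3 y - s y *\<^sub>R E 2 y))"

lemma rotated_frame_simps [simp]: "rotated_frame E c s 1 = E 1"
  "rotated_frame E c s 2 = (\<lambda>y. c y *\<^sub>R E 2 y + s y *\<^sub>R E 3 y)"
  "rotated_frame E c s 3 = (\<lambda>y. c y *\<^sub>R E 3 y - s y *\<^sub>R E 2 y)"
  by (simp_all add: rotated_frame_def)

context kenmotsu_frame
begin

text \<open>Rotations of the contact plane commute with \<open>\<phi>\<close>, so the rotated third
  field is again \<phi> of the second.\<close>

lemma kenmotsu_rotated_frame: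
  assumes W': "open W'" "W' \<subseteq> W" and c: "smooth_on W' c" and s: "smooth_on W' s"
    and cs: "\<And>y. y \<in> W' \<Longrightarrow> c y * c y + s y * s y = 1"
  shows "kenmotsu_frame W' g (rotated_frame E c s) \<phi> \<eta>"
proof
  have i: "i = 1 \<or> i = 2 \<or> i = 3" for i :: 3 using exhaust_3 by auto
  note sub = smooth_on_subset[OF _ W'(2)]
  show "smooth_on W' (rotated_frame E c s i)" for i
    using i[of i] by (auto intro!: smooth_on_add smooth_on_diff smooth_on_scaleR W' c s sub[OF smooth_E])
  show "g x (rotated_frame E c s i x) (rotated_frame E c s j x) = (if i = j then 1 else 0)"
    if x: "x \<in> W'" for x i j
  proof -
    have xW: "x \<in> W" using W'(2) x by blast
    show ?thesis
      using i[of i] i[of j] cs[OF x]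
      by (elim disjE; simp add: bilinear_simps[OF bil[OF xW]] orth_3[OF xW])
  qed
  fix x v
  assume "x \<in> W'"
  then have x: "x \<in> W" using W'(2) by blast
  note l = linear_add[OF linear_phi[OF x]] linear_diff[OF linear_phi[OF x]] linear_scale[OF linear_phi[OF x]]
  show "\<phi> x (rotated_frame E c s 2 x) = rotated_frame E c s 3 x"
    "\<phi> x (rotated_frame E c s 3 x) = - rotated_frame E c s 2 x"
    by (simp_all add: l phi_E[OF x])
qed (use W' bil sym smooth_on_subset[OF smooth_g W'(2)] smooth_on_subset[OF smooth_phi W'(2)] phi_E eta_eq d_eta d_Phi in
    \<open>auto simp: subset_iff linear_add[OF linear_phi] linear_scale[OF linear_phi]\<close>)

text \<open>\<nabla>\<xi> is a tensor and \<xi> is not rotated, so these components transform as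
  those of a bilinear form; derivatives of \<open>c\<close> and \<open>s\<close> do not
  appear.\<close>

lemma om_rotated_frame:
  fixes c s :: "real ^ 3 \<Rightarrow> real"
  assumes x: "x \<in> W"
  defines "om' \<equiv> orthonormal_frame.om g (rotated_frame E c s)"
  assumes k: "kenmotsu_frame W' g (rotated_frame E c s) \<phi> \<eta>" "x \<in> W'"
  shows "om' 2 1 2 x = c x * c x * om 2 1 2 x + 2 * c x * s x * om 2 1 3 x + s x * s x * om 3 1 3 x"
    "om' 3 1 3 x = s x * s x * om 2 1 2 x - 2 * c x * s x * om 2 1 3 x + c x * c x * om 3 1 3 x"
    "om' 2 1 3 x = (c x * c x - s x * s x) * om 2 1 3 x - c x * s x * (om 2 1 2 x - om 3 1 3 x)"
proof -
  interpret k: kenmotsu_frame W' g "rotated_frame E c s" \<phi> \<eta> by (rule k(1))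
  have n: "nabla g X (E 1) x = a *\<^sub>R nabla g (E 2) (E 1) x + b *\<^sub>R nabla g (E 3) (E 1) x"
    if "X x = a *\<^sub>R E 2 x + b *\<^sub>R E 3 x" for X a b
    using linear_D[OF diff_W[OF smooth_E x], of 1] christoffel_bilinear[OF x]
    by (simp add: nabla_def that linear_add linear_scale bilinear_simps algebra_simps)
  have n2: "nabla g (rotated_frame E c s 2) (E 1) x =
      c x *\<^sub>R nabla g (E 2) (E 1) x + s x *\<^sub>R nabla g (E 3) (E 1) x"
    by (rule n) simp
  have n3: "nabla g (rotated_frame E c s 3) (E 1) x =
      (- s x) *\<^sub>R nabla g (E 2) (E 1) x + c x *\<^sub>R nabla g (E 3) (E 1) x"
    by (rule n) simp
  have o: "g x (nabla g (E i) (E 1) x) (E j x) = om i 1 j x" for i j by (simp add: om_def)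
  note os = om_1_sym[OF x, of 3 2]
  show "om' 2 1 2 x = c x * c x * om 2 1 2 x + 2 * c x * s x * om 2 1 3 x + s x * s x * om 3 1 3 x"
    "om' 3 1 3 x = s x * s x * om 2 1 2 x - 2 * c x * s x * om 2 1 3 x + c x * c x * om 3 1 3 x"
    "om' 2 1 3 x = (c x * c x - s x * s x) * om 2 1 3 x - c x * s x * (om 2 1 2 x - om 3 1 3 x)"
    unfolding om'_def k.om_def rotated_frame_simps(1) n2 n3 unfolding rotated_frame_simps
    by (simp_all add: bilinear_simps[OF bil[OF x]] o os algebra_simps)
qed

lemma h_zero_iff:
  assumes x: "x \<in> W"
  shows "(\<forall>v. h x v = 0) \<longleftrightarrow> om 2 1 2 x = om 3 1 3 x \<and> om 2 1 3 x = 0"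
proof
  assume "\<forall>v. h x v = 0"
  then have "((om 2 1 2 x - om 3 1 3 x) / 2) *\<^sub>R E 3 x - om 2 1 3 x *\<^sub>R E 2 x = 0"
    using h_E(1)[OF x] by metis
  from arg_cong[OF this, of "\<lambda>v. g x v (E 2 x)"] arg_cong[OF this, of "\<lambda>v. g x v (E 3 x)"]
  show "om 2 1 2 x = om 3 1 3 x \<and> om 2 1 3 x = 0"
    by (simp add: bilinear_simps[OF bil[OF x]] orth_3[OF x])
next
  assume "om 2 1 2 x = om 3 1 3 x \<and> om 2 1 3 x = 0"
  then have "h x v = 0" for v
    by (intro linear_eqI_frame[OF x linear_h[OF x], of "\<lambda>_. 0" v, OF linear_zero])
      (simp_all add: h_E[OF x] h_bracket(1)[OF x])
  then show "\<forall>v. h x v = 0" by blast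
qed

text \<open>The right side is twice the squared half-gap between the two eigenvalues of
  \<nabla>\<xi>. The left side refers to no frame, so it also makes sense where no eigenframe has
  been constructed.\<close>

lemma trace_h_squared:
  assumes x: "x \<in> W"
  shows "trace_endo (\<lambda>v. h x (h x v)) = (om 2 1 2 x - om 3 1 3 x)\<^sup>2 / 2 + 2 * (om 2 1 3 x)\<^sup>2"
  using linear_h[OF x]
  by (subst trace_frame[OF x])
    (simp_all add: linear_compose[unfolded o_def] sum_3 h_E[OF x] h_bracket(1)[OF x] linear_add
      linear_diff linear_scale linear_0 bilinear_simps[OF bil[OF x]] orth_3[OF x] power2_eq_square field_simps)

text \<open>The rotation by half the angle of the vector \<open>(\<beta>, b)\<close> of length \<open>\<lambda>\<close>.\<close>

lemma exists_diagonal_rotation: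
  assumes x: "x \<in> W" and hx: "h x v \<noteq> 0" and pos: "om 3 1 3 x \<le> om 2 1 2 x"
  obtains W' c s where "x \<in> W'" "W' \<subseteq> W" "kenmotsu_frame W' g (rotated_frame E c s) \<phi> \<eta>"
    "\<And>y. y \<in> W' \<Longrightarrow> orthonormal_frame.om g (rotated_frame E c s) 2 1 3 y = 0"
    "\<And>y. y \<in> W' \<Longrightarrow> orthonormal_frame.om g (rotated_frame E c s) 3 1 3 y
      < orthonormal_frame.om g (rotated_frame E c s) 2 1 2 y"
proof -
  define b where "b = om 2 1 3"
  \<comment> \<open>The trace-free part of \<nabla>\<xi> has diagonal entries \<beta>, - \<beta> and
    off-diagonal entry b. Its nonnegative eigenvalue is \<open>l\<close>, with eigenvector (l +
    \<beta>, b) of squared length \<open>n\<close>.\<close>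
  define \<beta> where "\<beta> y = (om 2 1 2 y - om 3 1 3 y) * inverse 2" for y
  define L where "L y = \<beta> y * \<beta> y + b y * b y" for y
  define l where "l y = sqrt (L y)" for y
  define n where "n y = (l y + \<beta> y) * (l y + \<beta> y) + b y * b y" for y
  have sb: "smooth_on W b" unfolding b_def by (rule smooth_om)
  have s\<beta>: "smooth_on W \<beta>"
    unfolding \<beta>_def[abs_def] by (intro smooth_on_mult smooth_on_diff smooth_on_const smooth_om open_W)
  have sL: "smooth_on W L"
    unfolding L_def[abs_def] by (intro smooth_on_add smooth_on_mult sb s\<beta> open_W)
  \<comment> \<open>The square root is smooth only away from the zeros of \<open>L\<close>.\<close>
  define W1 where "W1 = {y \<in> W. L y > 0}"
  have W1: "open W1" "W1 \<subseteq> W"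
    unfolding W1_def using continuous_open_preimage[OF smooth_on_continuous[OF sL] open_W, of "{0<..}"]
    by (auto simp: vimage_def Int_def)
  note sub1 = smooth_on_subset[OF _ W1(2)]
  have sl: "smooth_on W1 l"
    unfolding l_def[abs_def] by (rule smooth_on_sqrt_compose[OF W1(1) _ sub1[OF sL]]) (simp add: W1_def)
  have sn: "smooth_on W1 n"
    unfolding n_def[abs_def] by (intro smooth_on_add smooth_on_mult W1 sl sub1[OF sb] sub1[OF s\<beta>])
  define W' where "W' = {y \<in> W1. n y > 0}"
  have W': "open W'" "W' \<subseteq> W1" "W' \<subseteq> W"
    unfolding W'_def using continuous_open_preimage[OF smooth_on_continuous[OF sn] W1(1), of "{0<..}"] W1(2)
    by (auto simp: vimage_def Int_def)
  note sub = smooth_on_subset[OF _ W'(2)]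
  define c where "c y = (l y + \<beta> y) / sqrt (n y)" for y
  define s where "s y = b y / sqrt (n y)" for y
  have npos: "n y > 0" if "y \<in> W'" for y using that by (simp add: W'_def)
  have ssn: "smooth_on W' (\<lambda>y. sqrt (n y))"
    by (rule smooth_on_sqrt_compose[OF W'(1) npos sub[OF sn]])
  have sn0: "sqrt (n y) \<noteq> 0" if "y \<in> W'" for y using npos[OF that] by simp
  have sc: "smooth_on W' c"
    unfolding c_def[abs_def]
    by (rule smooth_on_divide[OF W'(1) sn0 _ ssn])
      (auto intro!: smooth_on_add W' sub[OF sl] sub[OF sub1[OF s\<beta>]])
  have ss: "smooth_on W' s"
    unfolding s_def[abs_def] by (rule smooth_on_divide[OF W'(1) sn0 sub[OF sub1[OF sb]] ssn])
  have sq: "sqrt (n y) * sqrt (n y) = n y" if "y \<in> W'" for y using npos[OF that] by simp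
  have c2: "c y * c y = (l y + \<beta> y) * (l y + \<beta> y) / n y" and s2: "s y * s y = b y * b y / n y"
    and cs: "c y * s y = (l y + \<beta> y) * b y / n y" if "y \<in> W'" for y
    using sq[OF that] by (simp_all add: c_def s_def)
  have one: "c y * c y + s y * s y = 1" if "y \<in> W'" for y
  proof -
    have "c y * c y + s y * s y = n y / n y"
      unfolding c2[OF that] s2[OF that] n_def add_divide_distrib ..
    then show ?thesis using npos[OF that] by simp
  qed
  have k: "kenmotsu_frame W' g (rotated_frame E c s) \<phi> \<eta>"
    by (rule kenmotsu_rotated_frame[OF W'(1,3) sc ss one])
  have l2: "l y * l y = \<beta> y * \<beta> y + b y * b y" and lpos: "l y > 0" if "y \<in> W1" for y
    using that by (auto simp: W1_def l_def L_def)
  show ?thesis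
  proof (rule that[OF _ W'(3) k])
    have "om 2 1 2 x \<noteq> om 3 1 3 x \<or> om 2 1 3 x \<noteq> 0" using h_zero_iff[OF x] hx by blast
    then have "\<beta> x \<noteq> 0 \<or> b x \<noteq> 0" by (auto simp: \<beta>_def b_def)
    then have "L x > 0" by (simp add: L_def sum_squares_gt_zero_iff)
    then have x1: "x \<in> W1" using x by (simp add: W1_def)
    \<comment> \<open>For b = 0 and \<beta> < 0 the vector (l + \<beta>, b) would be zero; the order
      of the diagonal entries at \<open>x\<close> excludes this.\<close>
    have "\<beta> x \<ge> 0" using pos by (simp add: \<beta>_def)
    then have "l x + \<beta> x > 0" using lpos[OF x1] by simp
    then have "n x > 0" unfolding n_def by (auto intro!: add_pos_nonneg[OF mult_pos_pos])
    then show "x \<in> W'" using x1 by (simp add: W'_def)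
  next
    fix y assume y: "y \<in> W'"
    then have y1: "y \<in> W1" and yW: "y \<in> W" using W' by auto
    note o = om_rotated_frame[OF yW k y]
    have \<beta>: "om 2 1 2 y - om 3 1 3 y = 2 * \<beta> y" by (simp add: \<beta>_def)
    have n0: "n y \<noteq> 0" using npos[OF y] by simp
    have e: "l y * l y = \<beta> y * \<beta> y + b y * b y" by (rule l2[OF y1])
    have "n y * orthonormal_frame.om g (rotated_frame E c s) 2 1 3 y =
        ((l y + \<beta> y) * (l y + \<beta> y) - b y * b y) * b y - (l y + \<beta> y) * b y * (2 * \<beta> y)"
      unfolding o(3) c2[OF y] s2[OF y] cs[OF y] \<beta> using n0 by (simp add: field_simps flip: b_def)
    also have "\<dots> = b y * (l y * l y - (\<beta> y * \<beta> y + b y * b y))" by (simp add: algebra_simps)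
    finally show "orthonormal_frame.om g (rotated_frame E c s) 2 1 3 y = 0" using e n0 by simp
    have nn: "n y = 2 * l y * (l y + \<beta> y)" unfolding n_def using e by (simp add: algebra_simps)
    have "n y * (orthonormal_frame.om g (rotated_frame E c s) 2 1 2 y
        - orthonormal_frame.om g (rotated_frame E c s) 3 1 3 y)
        = ((l y + \<beta> y) * (l y + \<beta> y) - b y * b y) * (om 2 1 2 y - om 3 1 3 y) + 4 * (l y + \<beta> y) * b y * b y"
      unfolding o(1,2) c2[OF y] s2[OF y] mult.assoc cs[OF y] using n0 by (simp add: field_simps flip: b_def)
    also have "\<dots> = ((l y + \<beta> y) * (l y + \<beta> y) - (l y * l y - \<beta> y * \<beta> y)) * (2 * \<beta> y)
        + 4 * (l y + \<beta> y) * (l y * l y - \<beta> y * \<beta> y)"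
      unfolding \<beta> using e by (simp add: algebra_simps)
    also have "\<dots> = n y * (2 * l y)" unfolding nn by (simp add: algebra_simps)
    finally show "orthonormal_frame.om g (rotated_frame E c s) 3 1 3 y
      < orthonormal_frame.om g (rotated_frame E c s) 2 1 2 y"
      using n0 lpos[OF y1] by simp
  qed
qed

end

section \<open>Almost Kenmotsu 3-h-structures in one chart\<close>

locale almost_kenmotsu_3h_chart =
  fixes R :: "(real ^ 3) set" and g :: "(real ^ 3) form2" and \<phi> :: "(real ^ 3) endo_field"
    and \<xi> :: "(real ^ 3) vec_field" and \<eta> :: "(real ^ 3) one_form"
  assumes open_R: "open R"
    and bil: "x \<in> R \<Longrightarrow> bilinear (g x)"
    and sym: "x \<in> R \<Longrightarrow> g x v w = g x w v"
    and pos: "x \<in> R \<Longrightarrow> v \<noteq> 0 \<Longrightarrow> g x v v > 0"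
    and smooth_g: "smooth_on R (\<lambda>x. g x v w)"
    and linear_phi: "x \<in> R \<Longrightarrow> linear (\<phi> x)"
    and smooth_phi: "smooth_on R (\<lambda>x. \<phi> x v)"
    and smooth_xi: "smooth_on R \<xi>"
    and unit_xi: "x \<in> R \<Longrightarrow> g x (\<xi> x) (\<xi> x) = 1"
    and eta_eq: "x \<in> R \<Longrightarrow> \<eta> x v = g x v (\<xi> x)"
    and phi_phi: "x \<in> R \<Longrightarrow> \<phi> x (\<phi> x v) = - v + g x v (\<xi> x) *\<^sub>R \<xi> x"
    and g_phi_phi: "x \<in> R \<Longrightarrow> g x (\<phi> x v) (\<phi> x w) = g x v w - g x v (\<xi> x) * g x w (\<xi> x)"
    and d_eta: "x \<in> R \<Longrightarrow> ext_d1 \<eta> (K u) (K v) x = 0"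
    and d_Phi: "x \<in> R \<Longrightarrow> ext_d2 (fund_form \<phi> g) (K u) (K v) (K w) x
      = 2 * wedge12 \<eta> (fund_form \<phi> g) x u v w"
    and h_parallel: "x \<in> R \<Longrightarrow> nabla_endo g (h_tensor \<phi> \<xi>) \<xi> (K v) x = 0"
    and reeb_eigen: "x \<in> R \<Longrightarrow> \<exists>\<rho>. ricci_op g x (\<xi> x) = \<rho> *\<^sub>R \<xi> x"
begin

lemma phi_xi: "x \<in> R \<Longrightarrow> \<phi> x (\<xi> x) = 0"
  using g_phi_phi[of x "\<xi> x" "\<xi> x"] unit_xi[of x] pos[of x "\<phi> x (\<xi> x)"] by fastforce

text \<open>Since \<phi> \<xi> = 0, the cube of \<phi> is - \<phi>; comparing with the formula for
  \<phi>^2 on \<phi> v isolates the \<xi>-component.\<close>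

lemma g_phi_xi:
  assumes x: "x \<in> R"
  shows "g x (\<phi> x v) (\<xi> x) = 0"
proof -
  have "\<phi> x (\<phi> x (\<phi> x v)) = - \<phi> x v"
    by (simp add: phi_phi[OF x, of v] linear_add[OF linear_phi[OF x]] linear_neg[OF linear_phi[OF x]]
        linear_diff[OF linear_phi[OF x]] linear_scale[OF linear_phi[OF x]] phi_xi[OF x])
  then have "g x (\<phi> x v) (\<xi> x) *\<^sub>R \<xi> x = 0" using phi_phi[OF x, of "\<phi> x v"] by simp
  moreover have "\<xi> x \<noteq> 0" using unit_xi[OF x] bilinear_lzero[OF bil[OF x]] by force
  ultimately show ?thesis by simp
qed

lemma g_phi_self:
  assumes x: "x \<in> R" and e: "g x e (\<xi> x) = 0"
  shows "g x e (\<phi> x e) = 0"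
proof -
  have "g x (\<phi> x e) (\<phi> x (\<phi> x e)) = g x e (\<phi> x e)"
    using g_phi_phi[OF x, of e "\<phi> x e"] e by simp
  moreover have "g x (\<phi> x e) (\<phi> x (\<phi> x e)) = - g x e (\<phi> x e)"
    by (simp add: phi_phi[OF x] e bilinear_rneg[OF bil[OF x]] sym[OF x, of "\<phi> x e" e])
  ultimately show ?thesis by simp
qed

lemma kenmotsu_frame_unit_field:
  assumes W: "open W" "W \<subseteq> R" and e: "smooth_on W e"
    and unit: "\<And>y. y \<in> W \<Longrightarrow> g y (e y) (e y) = 1" and orth: "\<And>y. y \<in> W \<Longrightarrow> g y (e y) (\<xi> y) = 0"
  shows "kenmotsu_frame W g (\<lambda>i. if i = 1 then \<xi> else if i = 2 then e else (\<lambda>y. \<phi> y (e y))) \<phi> \<eta>"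
proof
  have i: "i = 1 \<or> i = 2 \<or> i = 3" for i :: 3 using exhaust_3 by auto
  have WR: "x \<in> R" if "x \<in> W" for x using that W(2) by blast
  have "smooth_on W (\<lambda>y. \<phi> y (e y))"
    by (rule smooth_on_apply[OF W(1) linear_phi[OF WR] smooth_on_subset[OF smooth_phi W(2)] e])
  then show "smooth_on W (if i = 1 then \<xi> else if i = 2 then e else (\<lambda>y. \<phi> y (e y)))" for i :: 3
    using smooth_on_subset[OF smooth_xi W(2)] e by simp
  show "g x ((if i = 1 then \<xi> else if i = 2 then e else (\<lambda>y. \<phi> y (e y))) x)
      ((if j = 1 then \<xi> else if j = 2 then e else (\<lambda>y. \<phi> y (e y))) x) = (if i = j then 1 else 0)"
    if x: "x \<in> W" for x and i j :: 3
    using i[of i] i[of j] unit[OF x] orth[OF x] unit_xi[OF WR[OF x]] g_phi_xi[OF WR[OF x]]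
      g_phi_self[OF WR[OF x] orth[OF x]] sym[OF WR[OF x], of "\<xi> x" "e x"]
      sym[OF WR[OF x], of "\<xi> x" "\<phi> x (e x)"] sym[OF WR[OF x], of "\<phi> x (e x)" "e x"]
      g_phi_phi[OF WR[OF x], of "e x" "e x"]
    by (elim disjE; simp)
qed (use W bil sym smooth_on_subset[OF smooth_g W(2)] smooth_on_subset[OF smooth_phi W(2)] orth
    eta_eq d_eta d_Phi in \<open>auto simp: subset_iff linear_add[OF linear_phi] linear_scale[OF linear_phi]
      phi_xi phi_phi\<close>)

text \<open>A constant vector that is not a multiple of \<xi> at \<open>x\<close> is projected
  orthogonally to \<xi> and normalised on the neighbourhood where the projection is nonzero.\<close>

lemma exists_kenmotsu_frame:
  assumes x: "x \<in> R"
  obtains W E where "x \<in> W" "W \<subseteq> R" "E 1 = \<xi>" "kenmotsu_frame W g E \<phi> \<eta>"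
proof -
  obtain w where w: "w \<noteq> g x w (\<xi> x) *\<^sub>R \<xi> x"
  proof -
    \<comment> \<open>Two coordinate axes cannot both be multiples of the same vector.\<close>
    have False if "\<And>w. w = g x w (\<xi> x) *\<^sub>R \<xi> x"
    proof -
      define p r where "p = g x (axis 1 1) (\<xi> x)" and "r = g x (axis 2 1) (\<xi> x)"
      have "axis 1 1 = p *\<^sub>R \<xi> x" "axis 2 1 = r *\<^sub>R \<xi> x" unfolding p_def r_def by (rule that)+
      from arg_cong[OF this(1), of "\<lambda>v. v $ 1"] arg_cong[OF this(1), of "\<lambda>v. v $ 2"]
        arg_cong[OF this(2), of "\<lambda>v. v $ 2"]
      show False by (auto simp: axis_def)
    qed
    then show ?thesis using that by blast
  qed
  define w0 where "w0 y = w - g y w (\<xi> y) *\<^sub>R \<xi> y" for y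
  define N where "N y = g y (w0 y) (w0 y)" for y
  have sw0: "smooth_on R w0"
    unfolding w0_def[abs_def]
    by (intro smooth_on_diff smooth_on_const smooth_on_scaleR smooth_xi open_R
        smooth_on_apply2[OF open_R bil smooth_g])
  have sN: "smooth_on R N"
    unfolding N_def[abs_def] by (rule smooth_on_apply2[OF open_R bil smooth_g sw0 sw0])
  define W where "W = {y \<in> R. N y > 0}"
  have W: "open W" "W \<subseteq> R"
    unfolding W_def using continuous_open_preimage[OF smooth_on_continuous[OF sN] open_R, of "{0<..}"]
    by (auto simp: vimage_def Int_def)
  have Npos: "N y > 0" if "y \<in> W" for y using that by (simp add: W_def)
  define e where "e y = inverse (sqrt (N y)) *\<^sub>R w0 y" for y
  have "smooth_on W e"
    unfolding e_def[abs_def]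
    by (intro smooth_on_scaleR smooth_on_inverse_compose smooth_on_sqrt_compose W Npos
        smooth_on_subset[OF sN W(2)] smooth_on_subset[OF sw0 W(2)]) (use Npos in force)
  moreover have "g y (e y) (e y) = 1" if y: "y \<in> W" for y
  proof -
    have yR: "y \<in> R" using y W(2) by blast
    define a where "a = sqrt (N y)"
    have a: "a * a = N y" "a \<noteq> 0" using Npos[OF y] by (auto simp: a_def)
    have "g y (e y) (e y) = inverse a * (inverse a * N y)"
      unfolding e_def N_def bilinear_lmul[OF bil[OF yR]] bilinear_rmul[OF bil[OF yR]]
      by (simp add: a_def N_def)
    also have "inverse a * (inverse a * N y) = 1"
      unfolding a(1)[symmetric] using a(2) by (simp add: field_simps)
    finally show ?thesis .
  qed
  moreover have "g y (e y) (\<xi> y) = 0" if y: "y \<in> W" for y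
    using y W(2) by (simp add: e_def w0_def bilinear_simps[OF bil] subset_iff unit_xi)
  ultimately have "kenmotsu_frame W g (\<lambda>i. if i = 1 then \<xi> else if i = 2 then e else (\<lambda>y. \<phi> y (e y))) \<phi> \<eta>"
    by (intro kenmotsu_frame_unit_field W)
  moreover have "x \<in> W" using x w pos[OF x, of "w0 x"] by (simp add: W_def N_def w0_def)
  ultimately show ?thesis by (intro that[OF _ W(2)]) auto
qed

lemma exists_diagonal_frame:
  assumes x: "x \<in> R" and h: "h_tensor \<phi> \<xi> x v \<noteq> 0"
  obtains W E where "x \<in> W" "W \<subseteq> R" "E 1 = \<xi>" "diagonal_frame W g E \<phi> \<eta>"
proof -
  have "\<exists>W E. x \<in> W \<and> W \<subseteq> R \<and> E 1 = \<xi> \<and> kenmotsu_frame W g E \<phi> \<eta> \<and>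
      orthonormal_frame.om g E 3 1 3 x \<le> orthonormal_frame.om g E 2 1 2 x"
  proof -
    obtain W E where E: "x \<in> W" "W \<subseteq> R" "E 1 = \<xi>" "kenmotsu_frame W g E \<phi> \<eta>"
      by (rule exists_kenmotsu_frame[OF x])
    interpret E: kenmotsu_frame W g E \<phi> \<eta> by (rule E(4))
    \<comment> \<open>A quarter turn exchanges \<open>om 2 1 2\<close> and \<open>om 3 1 3\<close>
      and so establishes the order that the half-angle rotation needs at \<open>x\<close>.\<close>
    let ?E = "rotated_frame E (\<lambda>_. 0) (\<lambda>_. 1)"
    have k: "kenmotsu_frame W g ?E \<phi> \<eta>"
      by (rule E.kenmotsu_rotated_frame[OF E.open_W]) (auto intro: smooth_on_const)
    have "?E 1 = \<xi>" using E(3) by simp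
    moreover have "orthonormal_frame.om g ?E 3 1 3 x \<le> orthonormal_frame.om g ?E 2 1 2 x"
      if "\<not> orthonormal_frame.om g E 3 1 3 x \<le> orthonormal_frame.om g E 2 1 2 x"
      using that E.om_rotated_frame[OF E(1) k E(1)] by simp
    ultimately show ?thesis using E k by blast
  qed
  then obtain W E where E: "x \<in> W" "W \<subseteq> R" "E 1 = \<xi>" "kenmotsu_frame W g E \<phi> \<eta>"
    "orthonormal_frame.om g E 3 1 3 x \<le> orthonormal_frame.om g E 2 1 2 x" by blast
  interpret E: kenmotsu_frame W g E \<phi> \<eta> by (rule E(4))
  have "h_tensor \<phi> (E 1) x v \<noteq> 0" using h E(3) by simp
  then obtain W' c s where k: "x \<in> W'" "W' \<subseteq> W" "kenmotsu_frame W' g (rotated_frame E c s) \<phi> \<eta>"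
    "\<And>y. y \<in> W' \<Longrightarrow> orthonormal_frame.om g (rotated_frame E c s) 2 1 3 y = 0"
    "\<And>y. y \<in> W' \<Longrightarrow> orthonormal_frame.om g (rotated_frame E c s) 3 1 3 y
      < orthonormal_frame.om g (rotated_frame E c s) 2 1 2 y"
    by (rule E.exists_diagonal_rotation[OF E(1) _ E(5)]) blast
  have "diagonal_frame W' g (rotated_frame E c s) \<phi> \<eta>"
    using k E(2) h_parallel reeb_eigen
    by (intro diagonal_frame.intro diagonal_frame_axioms.intro k(3)) (auto simp: E(3) subset_iff)
  then show ?thesis using k(1,2) E(2,3) by (intro that[of W' "rotated_frame E c s"]) auto
qed

lemma normal_if_h_zero:
  assumes x: "x \<in> R" and "\<And>v. h_tensor \<phi> \<xi> x v = 0"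
  shows "nijenhuis \<phi> (K u) (K v) x + (2 * ext_d1 \<eta> (K u) (K v) x) *\<^sub>R \<xi> x = 0"
proof -
  obtain W E where E: "x \<in> W" "W \<subseteq> R" "E 1 = \<xi>" "kenmotsu_frame W g E \<phi> \<eta>"
    by (rule exists_kenmotsu_frame[OF x])
  show ?thesis using kenmotsu_frame.normal_if_h_zero[OF E(4,1)] assms(2) E(3) by simp
qed

end

section \<open>The soliton equation in one chart\<close>

locale cotton_soliton_chart = almost_kenmotsu_3h_chart +
  fixes V :: "(real ^ 3) vec_field" and C :: "(real ^ 3) form2" and \<sigma> :: real
  assumes smooth_V: "smooth_on R V"
    and V_orth: "x \<in> R \<Longrightarrow> g x (V x) (\<xi> x) = 0"
    and cotton: "x \<in> R \<Longrightarrow> g x e e = 1 \<Longrightarrow> g x e (\<xi> x) = 0 \<Longrightarrow>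
      C x (adapted_frame \<phi> \<xi> x e $ i) (adapted_frame \<phi> \<xi> x e $ j)
      = cotton_comp g (adapted_frame \<phi> \<xi> x e) x i j"
    and soliton: "x \<in> R \<Longrightarrow> lie_form2 V g (K v) (K w) x + C x v w - \<sigma> * g x v w = 0"
begin

lemma soliton_diagonal_frame:
  assumes E: "W \<subseteq> R" "E 1 = \<xi>" "diagonal_frame W g E \<phi> \<eta>" and x: "x \<in> W"
  shows "\<sigma> = 0" "orthonormal_frame.om g E 2 1 2 x = 2"
proof -
  interpret E: diagonal_frame W g E \<phi> \<eta> by (rule E(3))
  have WR: "y \<in> R" if "y \<in> W" for y using that E(1) by blast
  have V: "smooth_on W V" by (rule smooth_on_subset[OF smooth_V E(1)])
  have C: "C y (E i y) (E j y) = cotton_comp g (adapted_frame \<phi> (E 1) y (E 2 y)) y i j"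
    if y: "y \<in> W" for y i j
    using cotton[OF WR[OF y], of "E 2 y" i j] E.orth_3[OF y] E.adapted_frame_nth[OF y]
    by (simp flip: E(2))
  note * = E.orthogonal_cotton_soliton[OF x V _ C soliton[OF WR]]
  show "\<sigma> = 0" "orthonormal_frame.om g E 2 1 2 x = 2"
    by (rule *(1) *(2); use V_orth WR E(2) in simp)+
qed

lemma trace_h_squared_cases:
  assumes x: "x \<in> R"
  shows "(\<forall>v. h_tensor \<phi> \<xi> x v = 0) \<and> trace_endo (\<lambda>v. h_tensor \<phi> \<xi> x (h_tensor \<phi> \<xi> x v)) = 0 \<or>
    (\<exists>v. h_tensor \<phi> \<xi> x v \<noteq> 0) \<and> trace_endo (\<lambda>v. h_tensor \<phi> \<xi> x (h_tensor \<phi> \<xi> x v)) = 2"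
proof (cases "\<forall>v. h_tensor \<phi> \<xi> x v = 0")
  case True
  then show ?thesis by (simp add: trace_endo_def)
next
  case False
  then obtain v where "h_tensor \<phi> \<xi> x v \<noteq> 0" by blast
  then obtain W E where E: "x \<in> W" "W \<subseteq> R" "E 1 = \<xi>" "diagonal_frame W g E \<phi> \<eta>"
    by (rule exists_diagonal_frame[OF x])
  interpret E: diagonal_frame W g E \<phi> \<eta> by (rule E(4))
  \<comment> \<open>In an eigenframe the trace is (q - (2 - q))^2 / 2, which is 2 for q = 2.\<close>
  have "trace_endo (\<lambda>v. h_tensor \<phi> \<xi> x (h_tensor \<phi> \<xi> x v)) = 2"
    using E.trace_h_squared[OF E(1)] E.om_213[OF E(1)] E.om_313[OF E(1)]
      soliton_diagonal_frame(2)[OF E(2,3,4,1)] E(3) by simp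
  then show ?thesis using False by blast
qed

lemma continuous_trace_h_squared:
  "continuous_on R (\<lambda>x. trace_endo (\<lambda>v. h_tensor \<phi> \<xi> x (h_tensor \<phi> \<xi> x v)))"
proof -
  have "smooth_on R (\<lambda>x. h_tensor \<phi> \<xi> x (h_tensor \<phi> \<xi> x b) \<bullet> b)" for b
    by (intro smooth_on_inner smooth_on_const open_R
        smooth_on_apply[OF open_R linear_h_tensor[OF open_R _ linear_phi smooth_phi smooth_xi]
          smooth_h_tensor[OF open_R linear_phi smooth_phi smooth_xi]]
        smooth_h_tensor[OF open_R linear_phi smooth_phi smooth_xi])
  then show ?thesis
    unfolding trace_endo_def by (intro smooth_on_continuous smooth_on_sum open_R)
qed

end

section \<open>Charts and transition maps\<close>

text \<open>Naturality of the Lie derivative. The tensor \<open>h\<close> is computed on constant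
  fields, which \<open>T\<close> does not preserve; the resulting second derivatives of
  \<open>T\<close> cancel by symmetry.\<close>

lemma h_tensor_transition:
  fixes T :: "'e::euclidean_space \<Rightarrow> 'e"
  assumes N: "open N" "x \<in> N" "T ` N \<subseteq> N'" "open N'" and T: "smooth_on N T"
    and F: "\<And>y v. y \<in> N \<Longrightarrow> (\<lambda>y. F y v) differentiable (at y)"
    and X: "X differentiable (at x)"
    and F': "\<And>y. y \<in> N' \<Longrightarrow> linear (F' y)" "\<And>y v. y \<in> N' \<Longrightarrow> (\<lambda>y. F' y v) differentiable (at y)"
    and X': "X' differentiable (at (T x))"
    and FT: "\<And>y v. y \<in> N \<Longrightarrow> F' (T y) (D T y v) = D T y (F y v)"
    and XT: "\<And>y. y \<in> N \<Longrightarrow> X' (T y) = D T y (X y)"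
  shows "h_tensor F' X' (T x) (D T x v) = D T x (h_tensor F X x v)"
proof -
  have TO: "T y \<in> N'" if "y \<in> N" for y using N(3) that by blast
  have dT: "T differentiable (at y)" if "y \<in> N" for y by (rule smooth_on_differentiable[OF T that])
  note lT = linear_D[OF dT]
  have dDT: "(\<lambda>y. D T y v) differentiable (at x)" for v
    by (rule smooth_on_differentiable[OF smooth_on_D1[OF T] N(2)])
  note comm = D_D_commute[OF N(1,2) T]
  have 1: "D (\<lambda>y. F' y (D T x v)) (T x) (D T x u) =
      D (\<lambda>y. D T y (F x v)) x u + D T x (D (\<lambda>y. F y v) x u) - F' (T x) (D (\<lambda>y. D T y v) x u)" for v u
  proof -
    note c = D_compose[OF dT[OF N(2)] F'(2)[OF TO[OF N(2)]]]
    note a = D_apply[OF N(1,2), of "\<lambda>y. F' (T y)" "\<lambda>y. D T y v", OF F'(1)[OF TO] c(1) dDT]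
    note b = D_apply[OF N(1,2), of "D T" "\<lambda>y. F y v", OF lT dDT F[OF N(2)]]
    have "D (\<lambda>y. F' (T y) (D T x v)) x u + F' (T x) (D (\<lambda>y. D T y v) x u)
        = D (\<lambda>y. F' (T y) (D T y v)) x u"
      by (rule a(2)[symmetric])
    also have "\<dots> = D (\<lambda>y. D T y (F y v)) x u"
      by (rule D_cong[OF N(1,2) FT a(1)])
    also have "\<dots> = D (\<lambda>y. D T y (F x v)) x u + D T x (D (\<lambda>y. F y v) x u)"
      by (rule b(2))
    also have "D (\<lambda>y. F' (T y) (D T x v)) x u = D (\<lambda>y. F' y (D T x v)) (T x) (D T x u)"
      by (rule c(2))
    finally show ?thesis by (simp add: algebra_simps)
  qed
  have 2: "D X' (T x) (D T x u) = D (\<lambda>y. D T y (X x)) x u + D T x (D X x u)" for u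
  proof -
    note c = D_compose[OF dT[OF N(2)] X']
    have "D (\<lambda>y. X' (T y)) x u = D (\<lambda>y. D T y (X y)) x u"
      by (rule D_cong[OF N(1,2) XT c(1)])
    then show ?thesis
      unfolding c(2) using D_apply(2)[OF N(1,2), of "D T" X, OF lT dDT X] by simp
  qed
  note l = linear_add[OF F'(1)[OF TO[OF N(2)]]] linear_neg[OF F'(1)[OF TO[OF N(2)]]]
    linear_diff[OF F'(1)[OF TO[OF N(2)]]]
  note l' = linear_add[OF lT[OF N(2)]] linear_diff[OF lT[OF N(2)]] linear_scale[OF lT[OF N(2)]]
    linear_neg[OF lT[OF N(2)]]
  have "F' (T x) (- D X' (T x) (D T x v)) =
      - F' (T x) (D (\<lambda>y. D T y (X x)) x v) + D T x (F x (- D X x v))"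
    unfolding 2 using FT[OF N(2), of "- D X x v"] by (simp add: l l' algebra_simps)
  then show ?thesis
    unfolding h_tensor_eq XT[OF N(2)] 1 FT[OF N(2), of v] 2
    using comm[of "F x v" "X x"] comm[of v "X x"] by (simp add: l' algebra_simps)
qed

locale atlas =
  fixes M :: "'a topology" and A :: "('a, 'e::euclidean_space) chart set"
  assumes atlas: "smooth_atlas M A"
begin

lemma chart_homeomorphic:
  "c \<in> A \<Longrightarrow> homeomorphic_map (subtopology M (fst c)) (top_of_set (chart_range c)) (snd c)"
  using atlas by (simp add: smooth_atlas_def)

lemma chart_open: "c \<in> A \<Longrightarrow> openin M (fst c)" "c \<in> A \<Longrightarrow> open (chart_range c)"
  using atlas by (simp_all add: smooth_atlas_def)

lemma chart_subset: "c \<in> A \<Longrightarrow> fst c \<subseteq> topspace M"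
  using chart_open(1) openin_subset by blast

lemma exists_chart: "m \<in> topspace M \<Longrightarrow> \<exists>c\<in>A. m \<in> fst c"
  using atlas unfolding smooth_atlas_def by blast

lemma topspace_chart: "c \<in> A \<Longrightarrow> topspace (subtopology M (fst c)) = fst c"
  by (simp add: Int_absorb1 chart_subset)

lemma chart_inj: "c \<in> A \<Longrightarrow> inj_on (snd c) (fst c)"
  using chart_homeomorphic[of c] topspace_chart[of c]
  by (auto simp: homeomorphic_eq_everything_map)

lemma chart_inv_snd: "c \<in> A \<Longrightarrow> m \<in> fst c \<Longrightarrow> chart_inv c (snd c m) = m"
  by (simp add: chart_inv_def chart_inj)

lemma snd_chart_inv: "x \<in> chart_range c \<Longrightarrow> snd c (chart_inv c x) = x"
  unfolding chart_inv_def chart_range_def by (rule f_inv_into_f)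

lemma chart_inv_in: "x \<in> chart_range c \<Longrightarrow> chart_inv c x \<in> fst c"
  unfolding chart_inv_def chart_range_def by (rule inv_into_into)

lemma snd_in_range: "m \<in> fst c \<Longrightarrow> snd c m \<in> chart_range c"
  by (simp add: chart_range_def)

lemma open_chart_image:
  assumes "c \<in> A" "openin M U" "U \<subseteq> fst c"
  shows "open (snd c ` U)"
proof -
  have "openin (subtopology M (fst c)) U"
    using assms chart_open(1) by (simp add: openin_open_subtopology)
  then have "openin (top_of_set (chart_range c)) (snd c ` U)"
    using homeomorphic_map_openness[OF chart_homeomorphic[OF assms(1)], of U] assms(3)
      topspace_chart[OF assms(1)] openin_subset[OF assms(2)] by simp
  then show ?thesis using chart_open(2)[OF assms(1)] openin_open_trans by blast
qed

lemma openin_chart_vimage: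
  assumes "c \<in> A" "open S"
  shows "openin M {m \<in> fst c. snd c m \<in> S}"
proof -
  have "continuous_map (subtopology M (fst c)) euclidean (snd c)"
    using homeomorphic_imp_continuous_map[OF chart_homeomorphic[OF assms(1)]]
      continuous_map_in_subtopology by blast
  then have "openin (subtopology M (fst c)) {m \<in> topspace (subtopology M (fst c)). snd c m \<in> S}"
    using assms(2) by (intro openin_continuous_map_preimage) auto
  then show ?thesis
    unfolding topspace_chart[OF assms(1)] by (rule openin_trans_full[OF _ chart_open(1)[OF assms(1)]])
qed

lemma overlap_open: "c \<in> A \<Longrightarrow> d \<in> A \<Longrightarrow> open (overlap c d)"
  unfolding overlap_def by (intro open_chart_image openin_Int chart_open) auto

lemma transition_smooth: "c \<in> A \<Longrightarrow> d \<in> A \<Longrightarrow> smooth_on (overlap c d) (transition c d)"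
  using atlas by (simp add: smooth_atlas_def)

lemma overlap_snd: "m \<in> fst c \<Longrightarrow> m \<in> fst d \<Longrightarrow> snd c m \<in> overlap c d"
  by (simp add: overlap_def)

lemma transition_snd: "c \<in> A \<Longrightarrow> m \<in> fst c \<Longrightarrow> transition c d (snd c m) = snd d m"
  by (simp add: transition_def chart_inv_snd)

lemma transition_overlap:
  assumes "c \<in> A" "d \<in> A" "x \<in> overlap c d"
  shows "x \<in> chart_range c" "transition c d x \<in> overlap d c" "transition c d x \<in> chart_range d"
    "transition d c (transition c d x) = x"
  using assms by (auto simp: overlap_def transition_snd chart_range_def)

lemma D_transition_inverse:
  assumes cd: "c \<in> A" "d \<in> A" and x: "x \<in> overlap c d"
  shows "D (transition d c) (transition c d x) (D (transition c d) x v) = v"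
proof -
  have d: "transition c d differentiable (at x)"
    "transition d c differentiable (at (transition c d x))"
    using smooth_on_differentiable transition_smooth cd x transition_overlap(2)[OF cd x] by blast+
  note c = D_compose[OF d]
  have "D (\<lambda>y. transition d c (transition c d y)) x v = D (\<lambda>y. y) x v"
    by (rule D_cong[OF overlap_open[OF cd] x transition_overlap(4)[OF cd] c(1)])
  then show ?thesis using c(2) by simp
qed

end

section \<open>Cotton solitons on almost Kenmotsu 3-h-manifolds\<close>

locale orthogonal_soliton =
  fixes M :: "'a topology" and A :: "('a, real ^ 3) chart set"
    and \<phi> :: "('a, real ^ 3) chart \<Rightarrow> (real ^ 3) endo_field"
    and \<xi> :: "('a, real ^ 3) chart \<Rightarrow> (real ^ 3) vec_field"
    and \<eta> :: "('a, real ^ 3) chart \<Rightarrow> (real ^ 3) one_form"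
    and g :: "('a, real ^ 3) chart \<Rightarrow> (real ^ 3) form2"
    and V :: "('a, real ^ 3) chart \<Rightarrow> (real ^ 3) vec_field"
    and \<sigma> :: real
  assumes connected: "connected_space M"
    and ak: "almost_kenmotsu_3h M A \<phi> \<xi> \<eta> g"
    and not_kenmotsu: "\<not> kenmotsu M A \<phi> \<xi> \<eta> g"
    and eigen: "reeb_ricci_eigenvector A \<xi> g"
    and soliton: "cotton_soliton A \<phi> \<xi> g V \<sigma>"
    and orthogonal: "orthogonal_fields A g V \<xi>"
begin

lemma acm: "almost_contact_metric M A \<phi> \<xi> \<eta> g" and kenm: "almost_kenmotsu M A \<phi> \<xi> \<eta> g"
  using ak by (simp_all add: almost_kenmotsu_3h_def almost_kenmotsu_def)

sublocale atlas M A
  using acm by unfold_locales (simp add: almost_contact_metric_def smooth_manifold_def)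

text \<open>Fixes one Cotton tensor for all charts, so that it can serve as a parameter of the
  locale for a single chart.\<close>

definition C :: "('a, real ^ 3) chart \<Rightarrow> (real ^ 3) form2" where
  "C = (SOME C. cotton2_tensor A \<phi> \<xi> g C \<and>
        (\<forall>c\<in>A. \<forall>x\<in>chart_range c. \<forall>v w.
           lie_form2 (V c) (g c) (K v) (K w) x + C c x v w - \<sigma> * g c x v w = 0))"

lemma C: "cotton2_tensor A \<phi> \<xi> g C"
    "c \<in> A \<Longrightarrow> x \<in> chart_range c \<Longrightarrow>
      lie_form2 (V c) (g c) (K v) (K w) x + C c x v w - \<sigma> * g c x v w = 0"
proof -
  have "\<exists>C. cotton2_tensor A \<phi> \<xi> g C \<and> (\<forall>c\<in>A. \<forall>x\<in>chart_range c. \<forall>v w.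
      lie_form2 (V c) (g c) (K v) (K w) x + C c x v w - \<sigma> * g c x v w = 0)"
    using soliton by (simp add: cotton_soliton_def)
  from someI_ex[OF this, folded C_def]
  show "cotton2_tensor A \<phi> \<xi> g C" "c \<in> A \<Longrightarrow> x \<in> chart_range c \<Longrightarrow>
      lie_form2 (V c) (g c) (K v) (K w) x + C c x v w - \<sigma> * g c x v w = 0" by blast+
qed

lemma chart_locale:
  assumes c: "c \<in> A"
  shows "cotton_soliton_chart (chart_range c) (g c) (\<phi> c) (\<xi> c) (\<eta> c) (V c) (C c) \<sigma>"
proof -
  have endo: "endo_field_on A \<phi>" and vec: "vector_field_on A \<xi>" and met: "riemannian_metric_on A g"
    using acm by (auto simp: almost_contact_metric_def)
  have p: "g c x (\<xi> c x) (\<xi> c x) = 1" "\<eta> c x v = g c x v (\<xi> c x)"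
        "\<phi> c x (\<phi> c x v) = - v + \<eta> c x v *\<^sub>R \<xi> c x"
        "g c x (\<phi> c x v) (\<phi> c x w) = g c x v w - \<eta> c x v * \<eta> c x w" if "x \<in> chart_range c" for x v w
    using acm c that by (auto simp: almost_contact_metric_def)
  have k: "ext_d1 (\<eta> c) (K u) (K v) x = 0"
      "ext_d2 (fund_form (\<phi> c) (g c)) (K u) (K v) (K w) x = 2 * wedge12 (\<eta> c) (fund_form (\<phi> c) (g c)) x u v w"
    if "x \<in> chart_range c" for x u v w
    using kenm c that by (auto simp: almost_kenmotsu_def)
  show ?thesis
  proof
    fix x assume x: "x \<in> chart_range c"
    show "C c x (adapted_frame (\<phi> c) (\<xi> c) x e $ i) (adapted_frame (\<phi> c) (\<xi> c) x e $ j)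
        = cotton_comp (g c) (adapted_frame (\<phi> c) (\<xi> c) x e) x i j"
      if "g c x e e = 1" "g c x e (\<xi> c x) = 0" for e i j
      using C(1) c x that unfolding cotton2_tensor_def Let_def by blast
  qed (use c endo vec met p k C(2) eigen orthogonal soliton ak chart_open(2) in
    \<open>auto simp: endo_field_on_def vector_field_on_def riemannian_metric_on_def form2_on_def
      reeb_ricci_eigenvector_def orthogonal_fields_def cotton_soliton_def almost_kenmotsu_3h_def
      linear_add linear_scale\<close>)
qed

lemma chart_locale': "c \<in> A \<Longrightarrow> almost_kenmotsu_3h_chart (chart_range c) (g c) (\<phi> c) (\<xi> c) (\<eta> c)"
  using chart_locale cotton_soliton_chart.axioms(1) by blast

abbreviation h where "h c \<equiv> h_tensor (\<phi> c) (\<xi> c)"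

lemma h_transition:
  assumes c: "c \<in> A" and d: "d \<in> A" and x: "x \<in> overlap c d"
  shows "h d (transition c d x) (D (transition c d) x v) = D (transition c d) x (h c x v)"
proof -
  interpret c: almost_kenmotsu_3h_chart "chart_range c" "g c" "\<phi> c" "\<xi> c" "\<eta> c" by (rule chart_locale'[OF c])
  interpret d: almost_kenmotsu_3h_chart "chart_range d" "g d" "\<phi> d" "\<xi> d" "\<eta> d" by (rule chart_locale'[OF d])
  have "endo_field_on A \<phi>" "vector_field_on A \<xi>" using acm by (auto simp: almost_contact_metric_def)
  then have t: "\<phi> d (transition c d y) (D (transition c d) y v) = D (transition c d) y (\<phi> c y v)"
      "\<xi> d (transition c d y) = D (transition c d) y (\<xi> c y)" if "y \<in> overlap c d" for y v
    using c d that by (auto simp: endo_field_on_def vector_field_on_def)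
  note o = transition_overlap[OF c d]
  show ?thesis
    by (rule h_tensor_transition[OF overlap_open[OF c d] x _ d.open_R transition_smooth[OF c d]
        smooth_on_differentiable[OF c.smooth_phi o(1)] smooth_on_differentiable[OF c.smooth_xi o(1)[OF x]]
        d.linear_phi smooth_on_differentiable[OF d.smooth_phi]
        smooth_on_differentiable[OF d.smooth_xi o(3)[OF x]] t])
      (use o(3) in auto)
qed

text \<open>\<open>h\<close> transforms as a tensor and the derivative of a transition map is
  injective, so vanishing of \<open>h\<close> at a point is independent of the chart.\<close>

lemma h_nonzero_transfer:
  assumes c: "c \<in> A" "m \<in> fst c" and d: "d \<in> A" "m \<in> fst d" and h: "h c (snd c m) v \<noteq> 0"
  shows "\<exists>v. h d (snd d m) v \<noteq> 0"
proof -
  let ?x = "snd c m" and ?T = "transition c d"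
  have x: "?x \<in> overlap c d" by (rule overlap_snd[OF c(2) d(2)])
  have "D ?T ?x (h c ?x v) \<noteq> 0"
  proof
    assume 0: "D ?T ?x (h c ?x v) = 0"
    have "transition d c differentiable (at (?T ?x))"
      using smooth_on_differentiable[OF transition_smooth] c d transition_overlap(2)[OF c(1) d(1) x] by blast
    then have "h c ?x v = 0"
      using D_transition_inverse[OF c(1) d(1) x, of "h c ?x v"] 0 linear_0[OF linear_D] by metis
    then show False using h by simp
  qed
  then show ?thesis
    using h_transition[OF c(1) d(1) x, of v] transition_snd[OF c] by metis
qed

lemma h_nonzero:
  assumes c: "c \<in> A" and x: "x \<in> chart_range c"
  shows "\<exists>v. h c x v \<noteq> 0"
proof -
  define tr where "tr c x = trace_endo (\<lambda>v. h c x (h c x v))" for c x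
  have cases: "(\<forall>v. h c x v = 0) \<and> tr c x = 0 \<or> (\<exists>v. h c x v \<noteq> 0) \<and> tr c x = 2"
    if "c \<in> A" "x \<in> chart_range c" for c x
    unfolding tr_def by (rule cotton_soliton_chart.trace_h_squared_cases[OF chart_locale[OF that(1)] that(2)])
  have cont: "continuous_on (chart_range c) (tr c)" if "c \<in> A" for c
    unfolding tr_def[abs_def]
    by (rule cotton_soliton_chart.continuous_trace_h_squared[OF chart_locale[OF that]])
  \<comment> \<open>The level 1 separates the two possible values 0 and 2, so \<open>P\<close> and
    \<open>Q\<close> are open and cover the space.\<close>
  define P where "P = (\<Union>c\<in>A. {m \<in> fst c. snd c m \<in> {x \<in> chart_range c. tr c x > 1}})"
  define Q where "Q = (\<Union>c\<in>A. {m \<in> fst c. snd c m \<in> {x \<in> chart_range c. tr c x < 1}})"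
  have "open {x \<in> chart_range c. tr c x > 1}" "open {x \<in> chart_range c. tr c x < 1}" if "c \<in> A" for c
    using continuous_open_preimage[OF cont[OF that] chart_open(2)[OF that], of "{1<..}"]
      continuous_open_preimage[OF cont[OF that] chart_open(2)[OF that], of "{..<1}"]
    by (auto simp: vimage_def Int_def)
  then have "openin M P" "openin M Q"
    unfolding P_def Q_def using openin_chart_vimage by (intro openin_Union; blast)+
  moreover have "topspace M \<subseteq> P \<union> Q"
  proof
    fix m assume "m \<in> topspace M"
    then obtain c where c: "c \<in> A" "m \<in> fst c" using exists_chart by blast
    then show "m \<in> P \<union> Q" using cases[OF c(1) snd_in_range[OF c(2)]] snd_in_range[OF c(2)]
      by (auto simp: P_def Q_def)
  qed
  \<comment> \<open>Traces in different charts are compared only through the vanishing of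
    \<open>h\<close>, which does not depend on the chart.\<close>
  moreover have "P \<inter> Q = {}"
  proof -
    have False if cd: "c \<in> A" "m \<in> fst c" "tr c (snd c m) > 1" "d \<in> A" "m \<in> fst d" "tr d (snd d m) < 1" for c d m
    proof -
      have "\<exists>v. h c (snd c m) v \<noteq> 0" using cases[OF cd(1) snd_in_range[OF cd(2)]] cd(3) by auto
      then have "\<exists>v. h d (snd d m) v \<noteq> 0" using h_nonzero_transfer[OF cd(1,2,4,5)] by blast
      then show False using cases[OF cd(4) snd_in_range[OF cd(5)]] cd(6) by auto
    qed
    then show ?thesis unfolding P_def Q_def by fast
  qed
  ultimately have "P = {} \<or> Q = {}" using connected unfolding connected_space_def by blast
  moreover have "P \<noteq> {}"
  proof
    assume P: "P = {}"
    have "h c x v = 0" if c: "c \<in> A" and x: "x \<in> chart_range c" for c x v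
    proof -
      have "chart_inv c x \<notin> P" using P by blast
      then have "\<not> tr c x > 1"
        using c chart_inv_in[OF x] snd_chart_inv[OF x] x by (auto simp: P_def)
      then show ?thesis using cases[OF c x] by auto
    qed
    then have "normal_structure A \<phi> \<xi> \<eta>"
      unfolding normal_structure_def
      using almost_kenmotsu_3h_chart.normal_if_h_zero[OF chart_locale'] by blast
    then show False using not_kenmotsu kenm by (simp add: kenmotsu_def)
  qed
  ultimately have "Q = {}" by blast
  then have "chart_inv c x \<notin> Q" by blast
  then have "\<not> tr c x < 1"
    using c chart_inv_in[OF x] snd_chart_inv[OF x] x by (auto simp: Q_def)
  then show ?thesis using cases[OF c x] by auto
qed

text \<open>Without points normality would hold vacuously, so the failure of the Kenmotsu condition
  supplies the point at which \<sigma> = 0 is read off.\<close>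

lemma exists_chart_point: "\<exists>c\<in>A. \<exists>x. x \<in> chart_range c"
  using not_kenmotsu kenm by (auto simp: kenmotsu_def normal_structure_def)

lemma chart_isometry:
  assumes c: "c \<in> A" and x: "x \<in> chart_range c"
  obtains r F where "r > 0" "ball x r \<subseteq> chart_range c" "inj_on F (ball x r)" "smooth_on (ball x r) F"
    "\<And>S. open S \<Longrightarrow> S \<subseteq> ball x r \<Longrightarrow> open (F ` S)"
    "smooth_on (F ` ball x r) (inv_into (ball x r) F)"
    "\<And>y. y \<in> ball x r \<Longrightarrow> Im (fst (F y)) > 0"
    "\<And>y v w. y \<in> ball x r \<Longrightarrow>
      prod_metric (hyperbolic_metric 4) line_metric (F y) (D F y v) (D F y w) = g c y v w"
proof -
  interpret c: cotton_soliton_chart "chart_range c" "g c" "\<phi> c" "\<xi> c" "\<eta> c" "V c" "C c" \<sigma>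
    by (rule chart_locale[OF c])
  obtain v where "h c x v \<noteq> 0" using h_nonzero[OF c x] by blast
  then obtain W E where E: "x \<in> W" "W \<subseteq> chart_range c" "E 1 = \<xi> c" "diagonal_frame W (g c) E (\<phi> c) (\<eta> c)"
    by (rule c.exists_diagonal_frame[OF x])
  note s = c.soliton_diagonal_frame[OF E(2,3,4)]
  show ?thesis
    by (rule diagonal_frame.local_isometry[OF E(4) s(2) E(1)])
      (use E(2) in \<open>auto intro!: that\<close>)
qed

lemma steady_soliton: "\<sigma> = 0"
proof -
  obtain c x where c: "c \<in> A" "x \<in> chart_range c" using exists_chart_point by blast
  interpret c: cotton_soliton_chart "chart_range c" "g c" "\<phi> c" "\<xi> c" "\<eta> c" "V c" "C c" \<sigma>
    by (rule chart_locale[OF c(1)])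
  obtain v where "h c x v \<noteq> 0" using h_nonzero[OF c] by blast
  then show ?thesis
    using c.exists_diagonal_frame[OF c(2)] c.soliton_diagonal_frame(1) by metis
qed

lemma locally_isometric_HxR: "locally_isometric M A g HxR_space HxR_atlas (HxR_metric 4)"
  unfolding locally_isometric_def
proof
  fix p assume "p \<in> topspace M"
  then obtain c where c: "c \<in> A" "p \<in> fst c" using exists_chart by blast
  let ?x = "snd c p" and ?H = "upper_half_plane \<times> (UNIV :: real set)"
  obtain r F where F: "r > 0" "ball ?x r \<subseteq> chart_range c" "inj_on F (ball ?x r)" "smooth_on (ball ?x r) F"
    "\<And>S. open S \<Longrightarrow> S \<subseteq> ball ?x r \<Longrightarrow> open (F ` S)"
    "smooth_on (F ` ball ?x r) (inv_into (ball ?x r) F)"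
    "\<And>y. y \<in> ball ?x r \<Longrightarrow> Im (fst (F y)) > 0"
    "\<And>y v w. y \<in> ball ?x r \<Longrightarrow>
      prod_metric (hyperbolic_metric 4) line_metric (F y) (D F y v) (D F y w) = g c y v w"
    by (rule chart_isometry[OF c(1) snd_in_range[OF c(2)]]) (rule that; assumption)
  define B where "B = ball ?x r"
  define U where "U = {m \<in> fst c. snd c m \<in> B}"
  define W where "W = F ` B"
  define f where "f = F \<circ> snd c"
  note F = F[folded B_def]
  have UB: "snd c ` U = B"
    using F(2) by (auto simp: U_def chart_range_def)
  have opB: "open B" by (simp add: B_def)
  have U: "p \<in> U" "openin M U" "U \<subseteq> fst c"
    using openin_chart_vimage[OF c(1) opB] c F(1) by (auto simp: U_def B_def)
  have fU: "f ` U = W" using UB by (auto simp: f_def W_def image_comp[symmetric])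
  have injf: "inj_on f U"
    unfolding f_def
    by (rule comp_inj_on[OF inj_on_subset[OF chart_inj[OF c(1)] U(3)]]) (simp add: UB F(3))
  have "F y \<in> ?H" if "y \<in> B" for y
    using F(7)[OF that] by (simp add: upper_half_plane_def mem_Times_iff)
  then have WH: "W \<subseteq> ?H" unfolding W_def by blast
  have opW: "open W" unfolding W_def by (rule F(5)[OF opB]) simp
  have "openin HxR_space W" unfolding HxR_space_def by (rule open_subset[OF WH opW])
  moreover have "isometry_between M A g U HxR_space HxR_atlas (HxR_metric 4) W f"
    unfolding isometry_between_def
  proof (intro conjI)
    have "homeomorphic_map (subtopology (subtopology M (fst c)) U)
        (subtopology (top_of_set (chart_range c)) B) (snd c)"
      by (rule homeomorphic_map_subtopologies[OF chart_homeomorphic[OF c(1)]])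
        (use UB U(3) F(2) topspace_chart[OF c(1)] in \<open>auto simp: Int_absorb1\<close>)
    then have 1: "homeomorphic_map (subtopology M U) (top_of_set B) (snd c)"
      using U(3) F(2) by (simp add: subtopology_subtopology Int_absorb1)
    have "homeomorphic_map (top_of_set B) (top_of_set W) F"
    proof (rule bijective_open_imp_homeomorphic_map)
      show "continuous_map (top_of_set B) (top_of_set W) F"
        using smooth_on_continuous[OF F(4)] by (auto simp: W_def)
      show "open_map (top_of_set B) (top_of_set W) F"
        using F(5) opW opB unfolding open_map_def W_def
        by (auto simp: openin_open_eq)
    qed (use F(3) in \<open>auto simp: W_def\<close>)
    then have "homeomorphic_map (subtopology M U) (top_of_set W) f"
      unfolding f_def using 1 homeomorphic_map_compose by blast
    then show "homeomorphic_map (subtopology M U) (subtopology HxR_space W) f"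
      using WH by (simp add: HxR_space_def subtopology_subtopology Int_absorb1)
  next
    show "smooth_map_on A HxR_atlas U f"
      unfolding smooth_map_on_def
    proof (intro ballI)
      fix d and k :: "(complex \<times> real, complex \<times> real) chart"
      assume d: "d \<in> A" and "k \<in> HxR_atlas"
      then have k: "fst k = ?H" "snd k = id" by (auto simp: HxR_atlas_def)
      have S: "fst d \<inter> U \<inter> f -` fst k = fst d \<inter> U" using fU WH k by auto
      have op: "open (snd d ` (fst d \<inter> U))"
        by (rule open_chart_image[OF d openin_Int[OF chart_open(1)[OF d] U(2)]]) simp
      \<comment> \<open>\<open>F\<close> lives in the chart \<open>c\<close>; any other chart
        \<open>d\<close> reaches it through the transition map.\<close>
      have "smooth_on (snd d ` (fst d \<inter> U)) (\<lambda>y. F (transition d c y))"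
      proof (rule smooth_on_compose[OF op opB _ _ F(4)])
        show "transition d c y \<in> B" if "y \<in> snd d ` (fst d \<inter> U)" for y
          using that transition_snd[OF d, of _ c] by (auto simp: U_def)
        show "smooth_on (snd d ` (fst d \<inter> U)) (transition d c)"
          by (rule smooth_on_subset[OF transition_smooth[OF d c(1)]]) (use U in \<open>auto simp: overlap_def\<close>)
      qed
      moreover have "snd k \<circ> f \<circ> chart_inv d = (\<lambda>y. F (transition d c y))"
        by (simp add: k f_def transition_def comp_def)
      ultimately show "smooth_on (snd d ` (fst d \<inter> U \<inter> f -` fst k)) (snd k \<circ> f \<circ> chart_inv d)"
        unfolding S by simp
    qed
  next
    show "smooth_map_on HxR_atlas A W (inv_into U f)"
      unfolding smooth_map_on_def
    proof (intro ballI)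
      fix d and k :: "(complex \<times> real, complex \<times> real) chart"
      assume d: "d \<in> A" and "k \<in> HxR_atlas"
      then have k: "fst k = ?H" "snd k = id" by (auto simp: HxR_atlas_def)
      \<comment> \<open>The inverse of a chart is meaningful only on its range, here
        \<open>?H\<close>.\<close>
      have kinv: "chart_inv k z = z" if "z \<in> ?H" for z
        using that k f_inv_into_f[of z id ?H] by (simp add: chart_inv_def)
      define S where "S = F ` (snd c ` (U \<inter> fst d))"
      have Sk: "snd k ` (fst k \<inter> W \<inter> inv_into U f -` fst d) = S"
      proof -
        have "fst k \<inter> W \<inter> inv_into U f -` fst d = f ` (U \<inter> fst d)"
        proof -
          have "inv_into U f (f m) = m" if "m \<in> U" for m by (rule inv_into_f_f[OF injf that])
          moreover have "fst k \<inter> W = f ` U" using WH k(1) fU by blast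
          ultimately show ?thesis by force
        qed
        then show ?thesis by (simp add: S_def k f_def image_comp)
      qed
      have op: "open S"
        unfolding S_def
        by (rule F(5)) (use open_chart_image[OF c(1) openin_Int[OF U(2) chart_open(1)[OF d]]] U(3) UB
          in auto)
      have inv: "inv_into B F (F (snd c m)) = snd c m" "inv_into U f (F (snd c m)) = m" if "m \<in> U" for m
      proof -
        have "snd c m \<in> B" using that by (simp add: U_def)
        then show "inv_into B F (F (snd c m)) = snd c m" by (rule inv_into_f_f[OF F(3)])
        have "inv_into U f (f m) = m" by (rule inv_into_f_f[OF injf that])
        then show "inv_into U f (F (snd c m)) = m" by (simp only: f_def comp_apply)
      qed
      \<comment> \<open>Read in the chart \<open>d\<close>, the inverse of \<open>f\<close> is the
        inverse of \<open>F\<close> followed by the transition from \<open>c\<close> to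
        \<open>d\<close>.\<close>
      have sm: "smooth_on S (\<lambda>z. transition c d (inv_into B F z))"
      proof (rule smooth_on_compose[OF op overlap_open[OF c(1) d] _ _ transition_smooth[OF c(1) d]])
        show "inv_into B F z \<in> overlap c d" if "z \<in> S" for z
          using that U(3) by (auto simp: S_def inv overlap_def)
        show "smooth_on S (inv_into B F)"
          by (rule smooth_on_subset[OF F(6)]) (use UB in \<open>auto simp: S_def\<close>)
      qed
      have eq: "transition c d (inv_into B F z) = (snd d \<circ> inv_into U f \<circ> chart_inv k) z"
        if z: "z \<in> S" for z
      proof -
        obtain m where m: "m \<in> U" "m \<in> fst d" "z = F (snd c m)" using z by (auto simp: S_def)
        have "z \<in> ?H" using m UB WH by (auto simp: W_def)
        then show ?thesis using m inv U(3) transition_snd[OF c(1), of m d] by (auto simp: kinv)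
      qed
      show "smooth_on (snd k ` (fst k \<inter> W \<inter> inv_into U f -` fst d))
          (snd d \<circ> inv_into U f \<circ> chart_inv k)"
        unfolding Sk by (rule iffD1[OF smooth_on_cong[OF op eq] sm])
    qed
  next
    show "\<forall>d\<in>A. \<forall>k\<in>HxR_atlas. \<forall>x\<in>snd d ` (fst d \<inter> U \<inter> f -` fst k).
        let G = snd k \<circ> f \<circ> chart_inv d
        in \<forall>v w. HxR_metric 4 k (G x) (D G x v) (D G x w) = g d x v w"
    proof (intro ballI)
      fix d y and k :: "(complex \<times> real, complex \<times> real) chart"
      assume d: "d \<in> A" and k: "k \<in> HxR_atlas" and "y \<in> snd d ` (fst d \<inter> U \<inter> f -` fst k)"
      then obtain m where m: "m \<in> fst d" "m \<in> U" "y = snd d m" by blast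
      have G: "snd k \<circ> f \<circ> chart_inv d = (\<lambda>y. F (transition d c y))"
        using k by (auto simp: HxR_atlas_def f_def transition_def comp_def)
      have y: "y \<in> overlap d c" "transition d c y \<in> B"
        using m U(3) transition_snd[OF d m(1), of c] by (auto simp: overlap_def U_def)
      \<comment> \<open>Invariance of the metric under the transition from \<open>d\<close> to
        \<open>c\<close> reduces the claim to the isometry property of \<open>F\<close> in
        \<open>c\<close>.\<close>
      have "form2_on A g" using acm by (simp add: almost_contact_metric_def riemannian_metric_on_def)
      then have "g c (transition d c y) (D (transition d c) y v) (D (transition d c) y w) = g d y v w" for v w
        using c(1) d y(1) by (auto simp: form2_on_def)
      then show "let G = snd k \<circ> f \<circ> chart_inv d
          in \<forall>v w. HxR_metric 4 k (G y) (D G y v) (D G y w) = g d y v w"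
        unfolding G Let_def
        using D_compose(2)[OF smooth_on_differentiable[OF transition_smooth[OF d c(1)] y(1)]
            smooth_on_differentiable[OF F(4) y(2)]] F(8)[OF y(2)]
        by (simp add: HxR_metric_def)
    qed
  qed
  ultimately show "\<exists>U W f. p \<in> U \<and> openin M U \<and> openin HxR_space W \<and>
      isometry_between M A g U HxR_space HxR_atlas (HxR_metric 4) W f"
    using U by blast
qed

end

text \<open>\<open>smooth_manifold\<close> does not include connectedness, so it is assumed
  separately; it carries \<open>h \<noteq> 0\<close> from one point to the whole manifold.\<close>

theorem theorem3p6:
  fixes M :: "'a topology"
    and A :: "('a, real ^ 3) chart set"
    and \<phi> :: "('a, real ^ 3) chart \<Rightarrow> (real ^ 3) endo_field"
    and \<xi> :: "('a, real ^ 3) chart \<Rightarrow> (real ^ 3) vec_field"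
    and \<eta> :: "('a, real ^ 3) chart \<Rightarrow> (real ^ 3) one_form"
    and g :: "('a, real ^ 3) chart \<Rightarrow> (real ^ 3) form2"
    and V :: "('a, real ^ 3) chart \<Rightarrow> (real ^ 3) vec_field"
    and \<sigma> :: real
  assumes "connected_space M"
    and "almost_kenmotsu_3h M A \<phi> \<xi> \<eta> g"
    and "\<not> kenmotsu M A \<phi> \<xi> \<eta> g"
    and "reeb_ricci_eigenvector A \<xi> g"
    and "cotton_soliton A \<phi> \<xi> g V \<sigma>"
    and "orthogonal_fields A g V \<xi>"
  shows "locally_isometric M A g HxR_space HxR_atlas (HxR_metric 4) \<and> steady \<sigma>"
proof -
  interpret orthogonal_soliton M A \<phi> \<xi> \<eta> g V \<sigma>
    by (rule orthogonal_soliton.intro) (rule assms)+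
  show ?thesis using locally_isometric_HxR steady_soliton by (simp add: steady_def)
qed

end
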